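(* For every (arbitrarily small) $\delta>0$ there is a constant $c_\delta>0$ such that $$|D_1D_2\bar G_{1,\mu}(\ell,s)|\le c_\delta\,|s|^{-2+\delta}\,|\ell|^{-1/2}$$ for all $\ell,s\in\Lambda$ with $|\ell|\le|s|/16$, where $\bar G_{1,\mu}=G-\hat G_0-\hat G_{1,\mu}$ is the remainder of the lattice Green's function $G$ as defined in the context.
   Context: $\Lambda=\{m-(\tfrac12,\tfrac12): m\in\mathbb Z^2\}\subset\mathbb R^2$; $\Gamma_0=\{(x_1,0):x_1\le 0\}$; $\Gamma_\pm=\{m\in\Lambda: m_1<0,\ m_2=\pm\tfrac12\}$, $\Gamma=\Gamma_+\cup\Gamma_-$. $\mathcal R=\{e_1,e_2,-e_1,-e_2\}$; $\mathcal R(m)=\mathcal R$ if $m\notin\Gamma$ and $\mathcal R(m)=\mathcal R\setminus\{\mp e_2\}$ if $m\in\Gamma_\pm$. For $u:\Lambda\to\mathbb R$, $D_\rho u(m)=u(m+\rho)-u(m)$, and $Du(m)\in\mathbb R^{\mathcal R}$ has components $(Du(m))_\rho=D_\rho u(m)$ if $\rho\in\mathcal R(m)$ and $0$ otherwise. For $g:\Lambda\to\mathbb R^{\mathcal R}$, $-\mathrm{Div}\,g(m)=\sum_{\rho\in\mathcal R}\big(g_\rho(m-\rho)-g_\rho(m)\big)$. $\dot{\mathcal H}^1=\{u:\Lambda\to\mathbb R: Du\in\ell^2(\Lambda)\}$. For functions on $\Lambda\times\Lambda$, $D_1$, $D_2$ denote $D$ acting in the first, respectively second, variable. In polar coordinates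 $x=r(\cos\theta,\sin\theta)$, $\theta\in(-\pi,\pi)$, $\omega(x)=(\omega_1(x),\omega_2(x))=\sqrt r(\cos\tfrac\theta2,\sin\tfrac\theta2)$ on $\mathbb R^2\setminus\Gamma_0$, and $\omega^*=(-\omega_1,\omega_2)$. Green's function. It is known that there is $G:\Lambda\times\Lambda\to\mathbb R$ with $-\mathrm{Div}DG(m,s)=\delta(m,s)$ (Kronecker delta, operators acting in $m$), $G(m,s)=G(s,m)$, and $G=\hat G_0+\bar G_0$, where $\hat G_0(m,s)=F(\omega(s)-\omega(m))+F(\omega^*(s)-\omega(m))$ for $m\ne s$, $F(x)=-\frac1{4\pi}\log|x|$ (the value $\hat G_0(s,s)$ is set to $0$), and $\bar G_0(\cdot,s)\in\dot{\mathcal H}^1$ for all $s$; moreover $|D_1D_2G(m,s)|\lesssim(1+|\omega(m)||\omega(s)||\omega(m)-\omega(s)|^{2-\delta})^{-1}$ for every $\delta>0$. This $G$ is fixed. Discrete geometry predictor. $\hat G_1^m\in\dot{\mathcal H}^1$ is the solution of $-\mathrm{Div}D\hat G_1^m=\mathrm{Div}D\omega_2$ on $\Lambda$, normalised so that $\hat G_1^m(\ell)\to0$ as $|\ell|\to\infty$ (it satisfies $|D^i\hat G_1^m(\ell)|\lesssim|\ell|^{-1/2-i+\delta}$ for $i=0,1$, $\delta>0$), and $\hat G_1^s(s)=\frac{-2\,\omega_2(s)}{|s|}$. Let $\hat\eta:[0,\infty)\to\mathbb R$ be a fixed smooth, decreasing cut-off with $\hat\eta=1$ on $[0,\tfrac12]$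 and $\hat\eta=0$ on $[1,\infty)$, and $\mu(m,s)=\hat\eta(|m|/|s|^{1/2})$. Then $\hat G_{1,\mu}(m,s)=\mu(m,s)\hat G_1^m(m)\hat G_1^s(s)$ and $\bar G_{1,\mu}=G-\hat G_0-\hat G_{1,\mu}$.
   Formalization: The factor Ĝ_1^s(s) = -2ω_2(s)/|s| is multiplied by -1/(4π) (as printed the bound fails for δ<1/2), and the assumed decay of D_1D_2G has min(t^2, t^{2-δ}), t=|ω(m)-ω(s)|, in place of t^{2-δ}, which is contradictory for small t. *)

theory Defs
  imports "HOL-Analysis.Analysis"
begin

text \<open>The plane is identified with \<^typ>\<open>complex\<close>, so that \<open>e\<^sub>1 = 1\<close> and \<open>e\<^sub>2 = \<i>\<close>.  Lattice functions
  are total functions on the plane of which only the values on the lattice matter.\<close>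

definition lattice :: "complex set" where
  "lattice = {Complex (of_int a - 1/2) (of_int b - 1/2) | a b :: int. True}"

definition crack_up :: "complex set" where
  "crack_up = {m \<in> lattice. Re m < 0 \<and> Im m = 1/2}"

definition crack_down :: "complex set" where
  "crack_down = {m \<in> lattice. Re m < 0 \<and> Im m = - 1/2}"

definition dirs :: "complex set" where
  "dirs = {1, \<i>, - 1, - \<i>}"

definition dirs_at :: "complex \<Rightarrow> complex set" where
  "dirs_at m = (if m \<in> crack_up then dirs - {- \<i>}
                else if m \<in> crack_down then dirs - {\<i>} else dirs)"

definition dgrad :: "(complex \<Rightarrow> real) \<Rightarrow> complex \<Rightarrow> complex \<Rightarrow> real" where
  "dgrad u m \<rho> = (if \<rho> \<in> dirs_at m then u (m + \<rho>) - u m else 0)"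

definition ddiv :: "(complex \<Rightarrow> complex \<Rightarrow> real) \<Rightarrow> complex \<Rightarrow> real" where
  "ddiv g m = - (\<Sum>\<rho>\<in>dirs. g (m - \<rho>) \<rho> - g m \<rho>)"

definition stencil_norm :: "(complex \<Rightarrow> real) \<Rightarrow> real" where
  "stencil_norm v = sqrt (\<Sum>\<rho>\<in>dirs. (v \<rho>)\<^sup>2)"

definition H1dot :: "(complex \<Rightarrow> real) set" where
  "H1dot = {u. (\<lambda>m. (stencil_norm (dgrad u m))\<^sup>2) summable_on lattice}"

definition mixed_grad :: "(complex \<Rightarrow> complex \<Rightarrow> real) \<Rightarrow> complex \<Rightarrow> complex \<Rightarrow>
    complex \<Rightarrow> complex \<Rightarrow> real" where
  "mixed_grad H m s \<rho> \<sigma> = dgrad (\<lambda>m'. dgrad (\<lambda>s'. H m' s') s \<sigma>) m \<rho>"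

definition mixed_norm :: "(complex \<Rightarrow> complex \<Rightarrow> real) \<Rightarrow> real" where
  "mixed_norm v = sqrt (\<Sum>\<rho>\<in>dirs. \<Sum>\<sigma>\<in>dirs. (v \<rho> \<sigma>)\<^sup>2)"

definition omega :: "complex \<Rightarrow> complex" where
  "omega x = rcis (sqrt (cmod x)) (Arg x / 2)"

definition omega_star :: "complex \<Rightarrow> complex" where
  "omega_star x = Complex (- Re (omega x)) (Im (omega x))"

definition Fundsol :: "complex \<Rightarrow> real" where
  "Fundsol x = - (1 / (4 * pi)) * ln (cmod x)"

definition Ghat0 :: "complex \<Rightarrow> complex \<Rightarrow> real" where
  "Ghat0 m s = (if m = s then 0
     else Fundsol (omega s - omega m) + Fundsol (omega_star s - omega m))"

text \<open>The last condition is the decay estimate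
  \<open>\<bar>D\<^sub>1 D\<^sub>2 G(m,s)\<bar> \<le> C (1 + \<bar>\<omega>(m)\<bar> \<bar>\<omega>(s)\<bar> t powr (2 - \<delta>))\<^sup>-\<^sup>1\<close>, \<open>t = \<bar>\<omega>(m) - \<omega>(s)\<bar>\<close>, in the range
  \<open>t \<ge> 1\<close>.  For \<open>t < 1\<close> the exponent has to be \<open>2\<close>: neighbouring sites far from the tip have
  \<open>t\<close> of order \<open>\<bar>m\<bar> powr (-1/2)\<close>, and with exponent \<open>2 - \<delta>\<close> the bound would force
  \<open>D\<^sub>1 D\<^sub>2 G(m,s)\<close> to vanish in the limit there, contradicting the equation for \<open>G\<close>.\<close>

definition crack_green :: "(complex \<Rightarrow> complex \<Rightarrow> real) \<Rightarrow> bool" where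
  "crack_green G \<longleftrightarrow>
     (\<forall>m\<in>lattice. \<forall>s\<in>lattice. - ddiv (dgrad (\<lambda>m'. G m' s)) m = (if m = s then 1 else 0)) \<and>
     (\<forall>m\<in>lattice. \<forall>s\<in>lattice. G m s = G s m) \<and>
     (\<forall>s\<in>lattice. (\<lambda>m. G m s - Ghat0 m s) \<in> H1dot) \<and>
     (\<forall>\<delta>>0. \<exists>C>0. \<forall>m\<in>lattice. \<forall>s\<in>lattice.
        mixed_norm (mixed_grad G m s)
          \<le> C / (1 + cmod (omega m) * cmod (omega s) *
                   min ((cmod (omega m - omega s))\<^sup>2) (cmod (omega m - omega s) powr (2 - \<delta>))))"

definition tip_corrector :: "(complex \<Rightarrow> real) \<Rightarrow> bool" where
  "tip_corrector u \<longleftrightarrow>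
     u \<in> H1dot \<and>
     (\<forall>m\<in>lattice. - ddiv (dgrad u) m = ddiv (dgrad (\<lambda>x. Im (omega x))) m) \<and>
     (u \<longlongrightarrow> 0) (inf at_infinity (principal lattice)) \<and>
     (\<forall>\<delta>>0. \<exists>C>0. \<forall>l\<in>lattice. \<bar>u l\<bar> \<le> C * cmod l powr (- 1/2 + \<delta>)) \<and>
     (\<forall>\<delta>>0. \<exists>C>0. \<forall>l\<in>lattice. stencil_norm (dgrad u l) \<le> C * cmod l powr (- 3/2 + \<delta>))"

text \<open>The factor \<open>-1/(4\<pi>)\<close> is that of \<^const>\<open>Fundsol\<close>: the term of \<open>Ghat0 m s\<close> linear in \<open>\<omega>(m)\<close> is
  \<open>- (\<nabla>F(\<omega>(s)) + \<nabla>F(\<omega>\<^sup>*(s))) \<cdot> \<omega>(m) = -2 \<partial>\<^sub>2F(\<omega>(s)) \<omega>\<^sub>2(m)\<close>, where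
  \<open>\<partial>\<^sub>2F(\<omega>(s)) = -1/(4\<pi>) \<omega>\<^sub>2(s)/\<bar>s\<bar>\<close>, and \<open>Ghat1s s\<close> is its coefficient \<open>-2 \<partial>\<^sub>2F(\<omega>(s))\<close>.
  The formula \<open>-2 \<omega>\<^sub>2(s)/\<bar>s\<bar>\<close>, without this factor, belongs to \<open>F = log\<close>; with it the remainder
  below would decay only like \<open>\<bar>s\<bar> powr (-3/2)\<close> for fixed \<open>l\<close>.\<close>

definition Ghat1s :: "complex \<Rightarrow> real" where
  "Ghat1s s = - (1 / (4 * pi)) * (- 2 * Im (omega s) / cmod s)"

text \<open>Since the function is constant near \<open>0\<close>, smoothness on \<open>[0, \<infinity>)\<close> amounts to smoothness on
  \<open>(0, \<infinity>)\<close>.\<close>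

definition cutoff :: "(real \<Rightarrow> real) \<Rightarrow> bool" where
  "cutoff \<eta> \<longleftrightarrow>
     (\<forall>k::nat. (deriv ^^ k) \<eta> differentiable_on {0<..}) \<and>
     antimono_on {0..} \<eta> \<and>
     (\<forall>x\<in>{0..1/2}. \<eta> x = 1) \<and> (\<forall>x\<ge>1. \<eta> x = 0)"

definition mu :: "(real \<Rightarrow> real) \<Rightarrow> complex \<Rightarrow> complex \<Rightarrow> real" where
  "mu \<eta> m s = \<eta> (cmod m / cmod s powr (1/2))"

definition Ghat1mu :: "(complex \<Rightarrow> real) \<Rightarrow> (real \<Rightarrow> real) \<Rightarrow> complex \<Rightarrow> complex \<Rightarrow> real" where
  "Ghat1mu G1m \<eta> m s = mu \<eta> m s * G1m m * Ghat1s s"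

definition Gbar1mu :: "(complex \<Rightarrow> complex \<Rightarrow> real) \<Rightarrow> (complex \<Rightarrow> real) \<Rightarrow> (real \<Rightarrow> real) \<Rightarrow>
    complex \<Rightarrow> complex \<Rightarrow> real" where
  "Gbar1mu G G1m \<eta> m s = G m s - Ghat0 m s - Ghat1mu G1m \<eta> m s"

end

theory Submission
  imports Defs "HOL-Complex_Analysis.Cauchy_Integral_Formula"
begin

text \<open>In the coordinate \<open>\<omega>\<close> the crack disappears: lattice functions lift to functions
  on a double cover that are even under \<open>Z \<mapsto> -cnj Z\<close>, and \<open>Div D\<close> lifts to a
  five-point Laplacian with nodes \<open>Z csqrt (1 + \<rho>/Z\<^sup>2)\<close>. For \<open>\<sigma>\<close>,
  \<open>\<tau>\<close> fixed let \<open>k\<close> be the lift of \<open>G(\<cdot>, l + \<tau>) - G(\<cdot>,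
  l)\<close>, and let \<open>w\<close> be a function on the cover whose sum over the two sheets is the
  \<open>\<sigma>\<close>-increment in \<open>s\<close> of \<open>Ghat0 + Ghat1s G1m\<close>, cut off far from
  the tip. Since the Laplacian of \<open>k\<close> is a difference of point masses, summation by parts turns
  \<open>\<Sum> k lap w\<close> into the mixed difference of \<open>Ghat0 + Ghat1s G1m\<close>, while the mass
  of \<open>lap w\<close> near \<open>s\<close> reproduces that of \<open>G\<close>; it remains to bound the
  rest of \<open>lap w\<close> against \<open>k\<close>. Away from \<open>s\<close> the predictor is the real
  part of a holomorphic function of \<open>Z\<close>, so its five-point residual is of order
  \<open>\<bar>Z\<bar>\<^sup>-\<^sup>8\<close>. Near the tip its linear term is a multiple of
  \<open>\<omega>\<^sub>2\<close>, which the corrector compensates, plus a part odd under the reflection, which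
  sums to zero against the even \<open>k\<close>. Near \<open>s\<close> the residual has zero mass in the limit,
  so that only second differences of the discrete harmonic function \<open>k\<close> enter. The bounds for
  \<open>k\<close> follow from the decay of \<open>D\<^sub>1 D\<^sub>2 G\<close> by summation along lattice
  paths to a distant point. Finally, the cut-off \<open>\<mu>\<close> only changes the corrector term where it
  is already of the size of the remainder.\<close>

section \<open>The five-point stencil and the square root\<close>

text \<open>Only mixed differences of \<open>G\<close> are bounded, so \<open>k\<close> is known
  only up to a constant, normalised at a distant point. This is harmless: the summation identity
  involves \<open>k\<close> through \<open>lap k\<close> and \<open>k z' - k z\<close> alone. With
  lam = |omega(l)| and z = omega(s), the kernel is at most of order |Z|/lam near the tip and 1/(lam
  |Z|) beyond l, while the target |s|^-2 |l|^-1/2 equals |z|^-4/lam. Apart from the convolution at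
  the source, every residual is brought to the form |z|^-4/lam times |Z|^-5, which is summable
  because exponent 5 on the cover is 5/2 > 2 on the lattice. Small powers are lost when the decay
  hypothesis is replaced by its quadratic form and when a harmonic series along a ray is summed.
  Each loss is a power of the radius up to which \<open>k\<close> is used, so the truncation radius
  has to be polynomial in |s|; |z|^6 = |s|^3 is also large enough to make the truncation error
  negligible. The corrector adds one more loss, measured in |s|. The geometric constants require |s|
  >= 100000; the remaining pairs of sites are finite in number and go into the constant.\<close>

lemma dirs_props [simp]: "finite dirs" "0 \<notin> dirs" "1 \<in> dirs" "\<i> \<in> dirs" "-1 \<in> dirs" "-\<i> \<in> dirs"
  by (auto simp: dirs_def)

lemma sum_dirs: "(\<Sum>\<rho>\<in>dirs. f \<rho>) = f 1 + f \<i> + f (-1) + f (-\<i>)"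
  for f :: "complex \<Rightarrow> 'a::comm_monoid_add"
  unfolding dirs_def by (simp add: complex_eq_iff add.assoc)

lemma card_dirs [simp]: "card dirs = 4"
  using sum_dirs[of "\<lambda>_. 1::nat"] by simp

lemma norm_dirs: "\<rho> \<in> dirs \<Longrightarrow> cmod \<rho> = 1"
  by (auto simp: dirs_def)

lemma minus_dirs: "\<rho> \<in> dirs \<Longrightarrow> - \<rho> \<in> dirs"
  by (auto simp: dirs_def)

lemma cnj_dirs: "\<rho> \<in> dirs \<Longrightarrow> cnj \<rho> \<in> dirs"
  by (auto simp: dirs_def)

lemma sum_dirs_uminus: "(\<Sum>\<rho>\<in>dirs. f (- \<rho>)) = (\<Sum>\<rho>\<in>dirs. f \<rho>)"
  for f :: "complex \<Rightarrow> 'a::comm_monoid_add"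
  by (simp add: sum_dirs ac_simps)

lemma sum_dirs_cnj: "(\<Sum>\<rho>\<in>dirs. f (cnj \<rho>)) = (\<Sum>\<rho>\<in>dirs. f \<rho>)"
  for f :: "complex \<Rightarrow> 'a::comm_monoid_add"
  by (simp add: sum_dirs ac_simps)

text \<open>The powers of order \<open>1, 2, 3\<close> cancel in the five-point stencil, so Cauchy's estimates bound
  the discrete Laplacian of a holomorphic function by its fourth order Taylor coefficient.\<close>

lemma holomorphic_stencil:
  assumes hol: "g holomorphic_on ball 0 r'" and r: "r < r'" "2 \<le> r"
    and M: "\<And>y. cmod y = r \<Longrightarrow> cmod (g y) \<le> M"
  shows "cmod (\<Sum>\<rho>\<in>dirs. g \<rho> - g 0) \<le> 8 * M / r ^ 4"
    and "\<rho> \<in> dirs \<Longrightarrow> cmod (g \<rho> - g 0) \<le> 2 * M / r"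
proof -
  define a where "a k = (deriv ^^ k) g 0 / fact k" for k
  have "cmod (g (of_real r)) \<le> M" using M[of "of_real r"] r by simp
  then have M0: "0 \<le> M" using norm_ge_zero order_trans by blast
  have a_bound: "cmod (a k) \<le> M / r ^ k" for k
  proof -
    have "cmod ((deriv ^^ k) g 0) \<le> fact k * M / r ^ k"
    proof (rule Cauchy_inequality)
      show "g holomorphic_on ball 0 r" using hol r by (auto elim!: holomorphic_on_subset)
      have "cball 0 r \<subseteq> ball (0::complex) r'" using r by auto
      then show "continuous_on (cball 0 r) g"
        using hol holomorphic_on_imp_continuous_on continuous_on_subset by blast
      show "cmod (0 - x) = r \<Longrightarrow> cmod (g x) \<le> M" for x using M by simp
    qed (use r in auto)
    moreover have "cmod (a k) * fact k = cmod ((deriv ^^ k) g 0)"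
      by (simp add: a_def norm_divide)
    ultimately have "cmod (a k) * fact k \<le> (M / r ^ k) * fact k" by (simp add: mult_ac)
    then show ?thesis by (rule mult_right_le_imp_le) simp
  qed
  define b where "b \<rho> k = (if k = 0 then 0 else a k * \<rho> ^ k)" for \<rho> k
  have b_sums: "b \<rho> sums (g \<rho> - g 0)" if "\<rho> \<in> dirs" for \<rho>
  proof -
    have "(\<lambda>n. (deriv ^^ n) g 0 / fact n * (\<rho> - 0) ^ n) sums g \<rho>"
      by (rule holomorphic_power_series[OF hol]) (use that r norm_dirs in auto)
    then have "(\<lambda>n. a n * \<rho> ^ n) sums g \<rho>" by (simp add: a_def)
    then have "(\<lambda>n. a n * \<rho> ^ n - (if n = 0 then g 0 else 0)) sums (g \<rho> - g 0)"
      using sums_single[of 0 "\<lambda>_. g 0"] by (intro sums_diff) auto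
    moreover have "(\<lambda>n. a n * \<rho> ^ n - (if n = 0 then g 0 else 0)) = b \<rho>"
      by (auto simp: b_def a_def)
    ultimately show ?thesis by simp
  qed
  have geom: "(\<lambda>k. C * (1/2) ^ k) sums (2 * C)" for C :: real
    using sums_mult[OF geometric_sums[of "1/2::real"], of C] by (simp add: mult.commute)
  \<comment> \<open>\<open>2 \<le> r\<close> makes each further Taylor coefficient lose a factor
    1/2, so both tails are dominated by geometric series.\<close>
  have pw: "M / r ^ (k + j) \<le> M / r ^ j * (1/2) ^ k" for k j
  proof -
    have "2 ^ k \<le> r ^ k" using r by (intro power_mono) auto
    then have "1 / r ^ k \<le> (1/2) ^ k" by (simp add: power_one_over frac_le)
    then have "M / r ^ j * (1 / r ^ k) \<le> M / r ^ j * (1/2) ^ k"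
      using M0 r by (intro mult_left_mono) auto
    then show ?thesis by (simp add: power_add mult_ac)
  qed
  show "cmod (\<Sum>\<rho>\<in>dirs. g \<rho> - g 0) \<le> 8 * M / r ^ 4"
  proof -
    define B where "B k = (\<Sum>\<rho>\<in>dirs. b \<rho> k)" for k
    have B: "B sums (\<Sum>\<rho>\<in>dirs. g \<rho> - g 0)"
      unfolding B_def by (intro sums_sum b_sums)
    \<comment> \<open>For k = 1, 2, 3 the k-th powers of the four directions sum to zero; the term k
      = 0 was removed in \<open>b\<close>.\<close>
    have B0: "B k = 0" if "k < 4" for k
    proof -
      have "k = 0 \<or> k = 1 \<or> k = 2 \<or> k = 3" using that by auto
      then show ?thesis
        by (auto simp: B_def b_def sum_dirs power3_eq_cube power2_eq_square algebra_simps)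
    qed
    have "(\<lambda>k. B (k + 4)) sums (\<Sum>\<rho>\<in>dirs. g \<rho> - g 0)"
      using B sums_split_initial_segment[OF B, of 4] B0 by simp
    moreover have "cmod (B (k + 4)) \<le> 4 * M / r ^ 4 * (1/2) ^ k" for k
    proof -
      have "cmod (B (k + 4)) \<le> (\<Sum>\<rho>\<in>dirs. cmod (b \<rho> (k + 4)))"
        unfolding B_def by (rule norm_sum)
      also have "\<dots> \<le> (\<Sum>\<rho>\<in>dirs. M / r ^ (k + 4))"
        by (intro sum_mono)
           (use a_bound in \<open>auto simp: b_def norm_mult norm_power norm_dirs\<close>)
      also have "\<dots> = 4 * (M / r ^ (k + 4))" by simp
      also have "\<dots> \<le> 4 * (M / r ^ 4 * (1/2) ^ k)" using pw[of k 4] by linarith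
      finally show ?thesis by simp
    qed
    ultimately have "cmod (\<Sum>\<rho>\<in>dirs. g \<rho> - g 0) \<le> 2 * (4 * M / r ^ 4)"
      using norm_sums_le geom by blast
    then show ?thesis by simp
  qed
  show "cmod (g \<rho> - g 0) \<le> 2 * M / r" if \<rho>: "\<rho> \<in> dirs"
  proof -
    have "(\<lambda>k. b \<rho> (k + 1)) sums (g \<rho> - g 0)"
      using sums_split_initial_segment[OF b_sums[OF \<rho>], of 1] by (simp add: b_def)
    moreover have "cmod (b \<rho> (k + 1)) \<le> M / r * (1/2) ^ k" for k
      using a_bound[of "k + 1"] pw[of k 1]
      by (simp add: b_def norm_mult norm_power norm_dirs[OF \<rho>])
    ultimately have "cmod (g \<rho> - g 0) \<le> 2 * (M / r)"
      using norm_sums_le geom by blast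
    then show ?thesis by simp
  qed
qed

section \<open>Principal square roots and logarithms near 1\<close>

declare csqrt.simps [simp del]

lemma Re_csqrt_pos: "w \<notin> \<real>\<^sub>\<le>\<^sub>0 \<Longrightarrow> 0 < Re (csqrt w)"
  using csqrt_principal[of w] by (metis Re_csqrt complex_nonpos_Reals_iff less_eq_real_def
      not_less_iff_gr_or_eq power2_csqrt Re_power2 Im_power2 mult_zero_left mult_zero_right
      power_zero_numeral diff_0 neg_le_0_iff_le zero_le_power2)

lemma one_plus_not_nonpos_Reals: "cmod v < 1 \<Longrightarrow> 1 + v \<notin> \<real>\<^sub>\<le>\<^sub>0"
  using abs_Re_le_cmod[of v] by (auto simp: complex_nonpos_Reals_iff)

text \<open>The principal root of a number with positive real part has argument of modulus below
  pi/4. The product of two such roots therefore stays in the right half plane, where it is the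
  principal root. This is what makes consecutive steps near the source compose in
  \<open>chart\<close>.\<close>

lemma csqrt_mult_halfplane:
  assumes "0 < Re a" "0 < Re b"
  shows "csqrt a * csqrt b = csqrt (a * b)"
proof -
  have "\<bar>Im (csqrt w)\<bar> < Re (csqrt w)" if "0 < Re w" for w
  proof -
    have "Re w = (Re (csqrt w))\<^sup>2 - (Im (csqrt w))\<^sup>2"
      by (metis power2_csqrt Re_power2)
    then have "(Im (csqrt w))\<^sup>2 < (Re (csqrt w))\<^sup>2" using that by simp
    then show ?thesis
      using Re_csqrt[of w] by (metis abs_of_nonneg abs_less_iff power2_abs power_less_imp_less_base)
  qed
  from this[OF assms(1)] this[OF assms(2)]
  have "\<bar>Im (csqrt a)\<bar> * \<bar>Im (csqrt b)\<bar> < Re (csqrt a) * Re (csqrt b)"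
    by (intro mult_strict_mono) auto
  then have "0 < Re (csqrt a * csqrt b)"
    by (simp flip: abs_mult) 
  then show ?thesis
    by (intro csqrt_unique[symmetric]) (auto simp: power_mult_distrib)
qed

text \<open>Multiplied by \<open>csqrt (1 + v) + 1\<close> the left side becomes v, and this factor
  has modulus at least 1 because a principal root has nonnegative real part.\<close>

lemma norm_csqrt_minus_1: "cmod (csqrt (1 + v) - 1) \<le> cmod v"
proof -
  have "(csqrt (1 + v) - 1) * (csqrt (1 + v) + 1) = v"
    using power2_csqrt[of "1 + v"] by (simp add: algebra_simps power2_eq_square)
  then have "cmod (csqrt (1 + v) - 1) * cmod (csqrt (1 + v) + 1) = cmod v"
    by (metis norm_mult)
  moreover have "1 \<le> cmod (csqrt (1 + v) + 1)"
    using complex_Re_le_cmod[of "csqrt (1 + v) + 1"] Re_csqrt[of "1 + v"] by simp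
  ultimately show ?thesis
    by (metis mult_right_mono[of 1 _ "cmod (csqrt (1 + v) - 1)"] mult.commute mult_1 norm_ge_zero)
qed

lemma norm_Ln_1p_le:
  assumes "cmod v \<le> 1 / 2"
  shows "cmod (Ln (1 + v)) \<le> 2 * cmod v"
proof -
  have "cmod (Ln (1 + v) - Ln 1) \<le> 2 * cmod (1 + v - 1)"
  proof (rule field_differentiable_bound[where S = "cball 1 (1/2)"])
    fix x :: complex assume x: "x \<in> cball 1 (1/2)"
    then have "cmod (x - 1) \<le> 1/2" by (simp add: dist_norm norm_minus_commute)
    then have "x \<notin> \<real>\<^sub>\<le>\<^sub>0" using one_plus_not_nonpos_Reals[of "x - 1"] by auto
    then show "(Ln has_field_derivative inverse x) (at x within cball 1 (1/2))"
      by (metis has_field_derivative_Ln has_field_derivative_at_within)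
    have "1/2 \<le> cmod x" using norm_triangle_ineq2[of 1 "1 - x"] \<open>cmod (x - 1) \<le> 1/2\<close>
      by (simp add: norm_minus_commute)
    then have "inverse (cmod x) \<le> inverse (1/2)" by (intro le_imp_inverse_le) auto
    then show "cmod (inverse x) \<le> 2" by (simp add: norm_inverse)
  qed (use assms in \<open>auto simp: dist_norm\<close>)
  then show ?thesis by simp
qed

section \<open>The double cover of the cracked lattice\<close>

lemma lattice_iff: "t \<in> lattice \<longleftrightarrow> (\<exists>a b::int. Re t = of_int a - 1/2 \<and> Im t = of_int b - 1/2)"
  unfolding lattice_def by (auto simp: complex_eq_iff)

lemma half_int_ge: "1 / 2 \<le> \<bar>real_of_int a - 1 / 2\<bar>"
proof (cases "a \<ge> 1")
  case False
  then have "real_of_int a \<le> 0" by simp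
  then show ?thesis by linarith
qed simp

lemma lattice_Re_Im: "t \<in> lattice \<Longrightarrow> 1/2 \<le> \<bar>Re t\<bar>" "t \<in> lattice \<Longrightarrow> 1/2 \<le> \<bar>Im t\<bar>"
  using half_int_ge by (auto simp: lattice_iff)

lemma lattice_nonzero:
  assumes "t \<in> lattice" shows "Re t \<noteq> 0" "Im t \<noteq> 0" "t \<noteq> 0"
  using lattice_Re_Im[OF assms] by auto

lemma lattice_norm: "t \<in> lattice \<Longrightarrow> 1/2 \<le> cmod t"
  using lattice_Re_Im(1)[of t] abs_Re_le_cmod[of t] by linarith

lemma lattice_add_dirs: "t \<in> lattice \<Longrightarrow> \<rho> \<in> dirs \<Longrightarrow> t + \<rho> \<in> lattice"
proof -
  assume "t \<in> lattice" "\<rho> \<in> dirs"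
  then obtain a b :: int where "Re t = of_int a - 1/2" "Im t = of_int b - 1/2"
    by (auto simp: lattice_iff)
  moreover obtain c d :: int where "Re \<rho> = of_int c" "Im \<rho> = of_int d"
    using \<open>\<rho> \<in> dirs\<close> by (auto simp: dirs_def intro: that[of 1 0] that[of 0 1] that[of "-1" 0] that[of 0 "-1"])
  ultimately show ?thesis
    unfolding lattice_iff by (intro exI[of _ "a + c"] exI[of _ "b + d"]) auto
qed

lemma lattice_cnj: "t \<in> lattice \<Longrightarrow> cnj t \<in> lattice"
  unfolding lattice_iff
proof (elim exE conjE)
  fix a b :: int assume "Re t = of_int a - 1/2" "Im t = of_int b - 1/2"
  then show "\<exists>a b::int. Re (cnj t) = of_int a - 1/2 \<and> Im (cnj t) = of_int b - 1/2"
    by (intro exI[of _ a] exI[of _ "1 - b"]) auto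
qed

section \<open>Square roots, the cover and its steps\<close>

lemma omega_eq_csqrt: "omega x = csqrt x"
  using rcis_cmod_Arg[of "csqrt x"] by (simp add: omega_def)

lemma norm_omega [simp]: "(cmod (omega x))\<^sup>2 = cmod x"
  by (simp add: omega_eq_csqrt)

lemma omega_square [simp]: "(omega x)\<^sup>2 = x"
  by (simp add: omega_eq_csqrt)

text \<open>The double cover of the plane branched at the tip, in the coordinate \<open>\<omega>\<close>: a lattice function
  is turned into a function on the cover that is even under the reflection \<open>sheet\<close>, and the crack
  disappears, because a bond across the crack joins a site to its own mirror image.\<close>

definition cov :: "complex set" where
  "cov = {Z. Z\<^sup>2 \<in> lattice}"

text \<open>The factor is relative to Z in order to follow the root continuously: on the segment
  from \<open>Z\<^sup>2\<close> to \<open>Z\<^sup>2 + \<rho>\<close> the argument of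
  \<open>csqrt\<close> never meets the branch cut, so this is the continuation of the square root
  along the bond.\<close>

definition step :: "complex \<Rightarrow> complex \<Rightarrow> complex" where
  "step \<rho> Z = Z * csqrt (1 + \<rho> / Z\<^sup>2)"

definition sheet :: "complex \<Rightarrow> complex" where
  "sheet Z = - cnj Z"

text \<open>The left half of the cover carries the reflected copy of the lattice. Evenness under
  \<open>sheet\<close> then encodes the Neumann condition that the missing bonds impose on the crack
  faces.\<close>

definition proj :: "complex \<Rightarrow> complex" where
  "proj Z = (if 0 < Re Z then Z\<^sup>2 else cnj (Z\<^sup>2))"

definition lap :: "(complex \<Rightarrow> real) \<Rightarrow> complex \<Rightarrow> real" where
  "lap f Z = (\<Sum>\<rho>\<in>dirs. f (step \<rho> Z) - f Z)"

lemma cov_nonzero: "Z \<in> cov \<Longrightarrow> Z \<noteq> 0" "Z \<in> cov \<Longrightarrow> Re Z \<noteq> 0"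
  using lattice_nonzero[of "Z\<^sup>2"] by (auto simp: cov_def Im_power2)

text \<open>Otherwise \<rho> would be a negative multiple of t. Both coordinates of t are
  half-integers, hence nonzero, whereas \<rho> is parallel to an axis.\<close>

lemma step_arg_not_nonpos:
  assumes t: "t \<in> lattice" and \<rho>: "\<rho> \<in> dirs"
  shows "1 + \<rho> / t \<notin> \<real>\<^sub>\<le>\<^sub>0"
proof
  assume "1 + \<rho> / t \<in> \<real>\<^sub>\<le>\<^sub>0"
  then obtain r where r: "1 + \<rho> / t = of_real r" "r \<le> 0"
    by (auto elim!: nonpos_Reals_cases)
  have "\<rho> = of_real (r - 1) * t"
    using r(1) lattice_nonzero[OF t] by (simp add: field_simps)
  then have "Re \<rho> = (r - 1) * Re t" "Im \<rho> = (r - 1) * Im t" by simp_all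
  then have "Re \<rho> \<noteq> 0" "Im \<rho> \<noteq> 0" using r lattice_nonzero[OF t] by auto
  then show False using \<rho> by (auto simp: dirs_def)
qed

lemma step_square:
  assumes "Z \<in> cov"
  shows "(step \<rho> Z)\<^sup>2 = Z\<^sup>2 + \<rho>"
  using cov_nonzero[OF assms] by (simp add: step_def power_mult_distrib algebra_simps)

lemma step_cov: "Z \<in> cov \<Longrightarrow> \<rho> \<in> dirs \<Longrightarrow> step \<rho> Z \<in> cov"
  using lattice_add_dirs by (auto simp: cov_def step_square[unfolded cov_def])

text \<open>The two relative factors are inverse to each other, and \<open>csqrt\<close> commutes
  with inversion off the negative axis. Bonds of the cover can thus be traversed backwards, on which
  every summation by parts rests.\<close>

lemma step_step:
  assumes Z: "Z \<in> cov" and \<rho>: "\<rho> \<in> dirs"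
  shows "step (- \<rho>) (step \<rho> Z) = Z"
proof -
  define A where "A = 1 + \<rho> / Z\<^sup>2"
  have A: "A \<notin> \<real>\<^sub>\<le>\<^sub>0" using step_arg_not_nonpos Z \<rho> by (auto simp: A_def cov_def)
  then have A0: "A \<noteq> 0" by auto
  have sq: "(step \<rho> Z)\<^sup>2 = Z\<^sup>2 * A"
    using cov_nonzero[OF Z] by (simp add: step_square[OF Z] A_def algebra_simps)
  have "Z\<^sup>2 * A - \<rho> = Z\<^sup>2" using cov_nonzero[OF Z] by (simp add: A_def algebra_simps)
  moreover have "1 - \<rho> / (Z\<^sup>2 * A) = (Z\<^sup>2 * A - \<rho>) / (Z\<^sup>2 * A)"
    using A0 cov_nonzero[OF Z] by (simp add: diff_divide_distrib)
  ultimately have "1 - \<rho> / (Z\<^sup>2 * A) = inverse A"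
    using cov_nonzero[OF Z] by (simp add: inverse_eq_divide)
  then have "step (- \<rho>) (step \<rho> Z) = Z * csqrt A * csqrt (inverse A)"
    by (simp add: step_def[of "- \<rho>"] sq) (simp add: step_def A_def)
  also have "\<dots> = Z" using A0 by (simp add: csqrt_inverse[OF A])
  finally show ?thesis .
qed

lemma step_norm:
  assumes "Z \<in> cov" "\<rho> \<in> dirs"
  shows "\<bar>(cmod (step \<rho> Z))\<^sup>2 - (cmod Z)\<^sup>2\<bar> \<le> 1"
proof -
  have "(cmod (step \<rho> Z))\<^sup>2 = cmod (Z\<^sup>2 + \<rho>)" using step_square[OF assms(1)] by (metis norm_power)
  moreover have "\<bar>cmod (Z\<^sup>2 + \<rho>) - cmod (Z\<^sup>2)\<bar> \<le> 1"
    using norm_triangle_ineq3[of "Z\<^sup>2 + \<rho>" "Z\<^sup>2"] norm_dirs[OF assms(2)] by simp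
  ultimately show ?thesis by (simp add: norm_power)
qed

lemma sheet_cov: "Z \<in> cov \<Longrightarrow> sheet Z \<in> cov"
  using lattice_cnj[of "Z\<^sup>2"] by (simp add: cov_def sheet_def)

lemma sheet_sheet [simp]: "sheet (sheet Z) = Z" and norm_sheet [simp]: "cmod (sheet Z) = cmod Z"
  by (simp_all add: sheet_def)

lemma step_sheet:
  assumes Z: "Z \<in> cov" and \<rho>: "\<rho> \<in> dirs"
  shows "step \<rho> (sheet Z) = sheet (step (cnj \<rho>) Z)"
proof -
  have "1 + cnj \<rho> / Z\<^sup>2 \<notin> \<real>\<^sub>\<le>\<^sub>0"
    using step_arg_not_nonpos cnj_dirs[OF \<rho>] Z by (auto simp: cov_def)
  from cnj_csqrt[OF this] show ?thesis
    by (simp add: step_def sheet_def)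
qed

lemma omega_cov: "t \<in> lattice \<Longrightarrow> omega t \<in> cov"
  by (simp add: cov_def)

lemma Re_omega: "t \<in> lattice \<Longrightarrow> 0 < Re (omega t)"
  using lattice_nonzero[of t] by (auto simp: omega_eq_csqrt complex_nonpos_Reals_iff intro!: Re_csqrt_pos)

lemma proj_omega [simp]: "t \<in> lattice \<Longrightarrow> proj (omega t) = t"
  using Re_omega by (simp add: proj_def)

lemma proj_sheet: "Z \<in> cov \<Longrightarrow> proj (sheet Z) = proj Z"
  using cov_nonzero(2)[of Z] by (auto simp: proj_def sheet_def)

lemma proj_lattice: "Z \<in> cov \<Longrightarrow> proj Z \<in> lattice"
  using lattice_cnj[of "Z\<^sup>2"] by (auto simp: proj_def cov_def)

lemma norm_proj: "cmod (proj Z) = (cmod Z)\<^sup>2"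
  by (simp add: proj_def norm_power)

lemma cov_cases: "Z \<in> cov \<Longrightarrow> Z = omega (proj Z) \<or> Z = sheet (omega (proj Z))"
proof -
  assume Z: "Z \<in> cov"
  show ?thesis
  proof (cases "0 < Re Z")
    case True
    then show ?thesis by (simp add: proj_def omega_eq_csqrt csqrt_square)
  next
    case False
    then have "0 < Re (sheet Z)" using cov_nonzero(2)[OF Z] by (simp add: sheet_def)
    then have "omega ((sheet Z)\<^sup>2) = sheet Z" by (simp add: omega_eq_csqrt csqrt_square)
    then show ?thesis using False by (simp add: proj_def sheet_def)
  qed
qed

lemma dirs_at_subset: "dirs_at m \<subseteq> dirs"
  by (auto simp: dirs_at_def)

text \<open>With a, b the principal roots of t and \<open>t + \<rho>\<close>, the step is a times
  the principal root of (b/a)^2, hence b or -b according to the sign of Re (b/a). The minus sign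
  occurs only for a bond through the crack, and there -b = -cnj a is the mirror image of a.\<close>

lemma step_omega:
  assumes t: "t \<in> lattice" and \<rho>: "\<rho> \<in> dirs"
  shows "step \<rho> (omega t) = (if \<rho> \<in> dirs_at t then omega (t + \<rho>) else sheet (omega t))"
proof -
  define a where "a = omega t"
  define b where "b = omega (t + \<rho>)"
  have w: "t + \<rho> \<in> lattice" by (rule lattice_add_dirs[OF t \<rho>])
  have a2: "a\<^sup>2 = t" and b2: "b\<^sup>2 = t + \<rho>" by (simp_all add: a_def b_def)
  have a0: "0 < Re a" and b0: "0 < Re b" using Re_omega t w by (auto simp: a_def b_def)
  then have nz: "a \<noteq> 0" by auto
  have quot: "1 + \<rho> / t = (b / a)\<^sup>2"
    using lattice_nonzero[OF t] by (simp add: power_divide a2 b2 add_divide_distrib)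
  have Re_quot: "Re (b / a) = (Re a * Re b + Im a * Im b) / (cmod a)\<^sup>2"
    by (simp add: Re_divide cmod_power2 mult.commute)
  have Im_t: "Im t = 2 * Re a * Im a" "Im (t + \<rho>) = 2 * Re b * Im b"
    using arg_cong[OF a2, of Im] arg_cong[OF b2, of Im] by (simp_all add: Im_power2)
  have key: "step \<rho> a = b" if "0 < Re (b / a)"
    using that nz csqrt_square[of "b / a"] by (simp add: step_def a2 quot)
  have "Im t * Im (t + \<rho>) = 4 * (Re a * Re b) * (Im a * Im b)"
    unfolding Im_t by (simp add: mult_ac)
  moreover have "0 < 4 * P * Q \<longleftrightarrow> 0 < Q" if "0 < P" for P Q :: real
    using that by (simp add: zero_less_mult_iff)
  ultimately have same_sign: "0 < Im t * Im (t + \<rho>) \<longleftrightarrow> 0 < Im a * Im b"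
    using a0 b0 by (metis mult_pos_pos)
  show ?thesis
  proof (cases "0 < Im t * Im (t + \<rho>)")
    case True
    then have "0 < Re (b / a)"
      unfolding Re_quot using same_sign a0 b0 nz by (intro divide_pos_pos add_pos_pos) auto
    moreover have "\<rho> \<in> dirs_at t"
      using True \<rho> by (auto simp: dirs_at_def crack_up_def crack_down_def zero_less_mult_iff)
    ultimately show ?thesis using key by (simp add: a_def b_def)
  next
    case False
    \<comment> \<open>A bond that crosses the real axis joins the rows Im = 1/2 and Im = -1/2, so
      its end points are conjugate; only the sign of Re t tells whether it crosses the
      crack.\<close>
    obtain j :: int where j: "Im t = of_int j - 1/2" using t by (auto simp: lattice_iff)
    have "t + \<rho> = cnj t \<and> (Im t = 1/2 \<and> \<rho> = - \<i> \<or> Im t = - 1/2 \<and> \<rho> = \<i>)"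
    proof -
      have np: "Im t * Im (t + \<rho>) < 0"
        using False lattice_nonzero[OF t] lattice_nonzero[OF w] by (simp add: less_le)
      consider "Im \<rho> = 0" | "\<rho> = \<i>" | "\<rho> = - \<i>" using \<rho> by (auto simp: dirs_def)
      then show ?thesis
      proof cases
        case 1 then show ?thesis using np by (simp add: mult_less_0_iff)
      next
        case 2
        then have "j = 0" using np j by (auto simp: mult_less_0_iff)
        then show ?thesis using 2 j by (simp add: complex_eq_iff)
      next
        case 3
        then have "j = 1" using np j by (auto simp: mult_less_0_iff)
        then show ?thesis using 3 j by (simp add: complex_eq_iff)
      qed
    qed
    then have w_cnj: "t + \<rho> = cnj t" and alt: "Im t = 1/2 \<and> \<rho> = - \<i> \<or> Im t = - 1/2 \<and> \<rho> = \<i>"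
      by blast+
    have b_eq: "b = cnj a"
    proof -
      have "t \<notin> \<real>\<^sub>\<le>\<^sub>0" using lattice_nonzero[OF t] by (auto simp: complex_nonpos_Reals_iff)
      from cnj_csqrt[OF this] show ?thesis
        unfolding a_def b_def w_cnj omega_eq_csqrt by simp
    qed
    have "Re t = Re a * Re b + Im a * Im b"
      using a2 by (auto simp: b_eq power2_eq_square)
    then have Re_quot': "Re (b / a) = Re t / (cmod a)\<^sup>2" by (simp add: Re_quot)
    show ?thesis
    proof (cases "0 < Re t")
      case True
      then have "0 < Re (b / a)" using nz by (simp add: Re_quot')
      moreover have "\<rho> \<in> dirs_at t"
        using True \<rho> by (auto simp: dirs_at_def crack_up_def crack_down_def)
      ultimately show ?thesis using key by (simp add: a_def b_def)
    next
      case neg: False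
      then have "Re t < 0" using lattice_nonzero[OF t] by simp
      then have "0 < Re (- b / a)" using nz Re_quot' by (simp add: divide_neg_pos)
      then have "csqrt ((- b / a)\<^sup>2) = - b / a" by (intro csqrt_square) simp
      then have "step \<rho> a = - b" using nz by (simp add: step_def a2 quot power_divide)
      moreover have "\<rho> \<notin> dirs_at t"
        using \<open>Re t < 0\<close> alt t by (auto simp: dirs_at_def crack_up_def crack_down_def)
      ultimately show ?thesis by (simp add: b_eq a_def sheet_def)
    qed
  qed
qed

section \<open>Lifting gradient and divergence to the cover\<close>

definition pdir :: "complex \<Rightarrow> complex \<Rightarrow> complex" where
  "pdir Z \<rho> = (if 0 < Re Z then \<rho> else cnj \<rho>)"

lemma pdir_dirs: "\<rho> \<in> dirs \<Longrightarrow> pdir Z \<rho> \<in> dirs"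
  by (simp add: pdir_def cnj_dirs)

lemma sum_dirs_pdir: "(\<Sum>\<rho>\<in>dirs. f (pdir Z \<rho>)) = (\<Sum>\<rho>\<in>dirs. f \<rho>)"
  for f :: "complex \<Rightarrow> 'a::comm_monoid_add"
  by (cases "0 < Re Z") (simp_all add: pdir_def sum_dirs_cnj)

lemma proj_step:
  assumes Z: "Z \<in> cov" and \<rho>: "\<rho> \<in> dirs"
  shows "proj (step \<rho> Z) =
    (if pdir Z \<rho> \<in> dirs_at (proj Z) then proj Z + pdir Z \<rho> else proj Z)"
proof -
  have t: "proj Z \<in> lattice" by (rule proj_lattice[OF Z])
  show ?thesis
  proof (cases "0 < Re Z")
    case True
    then have "Z = omega (proj Z)" by (simp add: proj_def omega_eq_csqrt csqrt_square)
    then have "step \<rho> Z = (if \<rho> \<in> dirs_at (proj Z) then omega (proj Z + \<rho>) else sheet (omega (proj Z)))"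
      using step_omega[OF t \<rho>] by simp
    then show ?thesis
      using True t lattice_add_dirs[OF t \<rho>] omega_cov[OF t] by (simp add: pdir_def proj_sheet)
  next
    case False
    then have "0 < Re (sheet Z)" using cov_nonzero(2)[OF Z] by (simp add: sheet_def)
    then have "sheet Z = omega (proj (sheet Z))" by (simp add: proj_def omega_eq_csqrt csqrt_square)
    then have "sheet Z = omega (proj Z)" using proj_sheet[OF Z] by simp
    then have "Z = sheet (omega (proj Z))" by (metis sheet_sheet)
    then have "step \<rho> Z = sheet (step (cnj \<rho>) (omega (proj Z)))"
      using step_sheet[OF omega_cov[OF t] \<rho>] by simp
    then have "step \<rho> Z = sheet (if cnj \<rho> \<in> dirs_at (proj Z) then omega (proj Z + cnj \<rho>)
        else sheet (omega (proj Z)))"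
      using step_omega[OF t cnj_dirs[OF \<rho>]] by simp
    then show ?thesis
      using False t lattice_add_dirs[OF t cnj_dirs[OF \<rho>]] omega_cov
      by (simp add: pdir_def proj_sheet)
  qed
qed

lemma proj_step_diff:
  assumes "Z \<in> cov" "\<rho> \<in> dirs"
  shows "u (proj (step \<rho> Z)) - u (proj Z) = dgrad u (proj Z) (pdir Z \<rho>)"
  using proj_step[OF assms] by (simp add: dgrad_def)

lemma dirs_at_iff:
  assumes "\<rho> \<in> dirs"
  shows "\<rho> \<in> dirs_at m \<longleftrightarrow> \<not> (m \<in> crack_up \<and> \<rho> = - \<i>) \<and> \<not> (m \<in> crack_down \<and> \<rho> = \<i>)"
proof -
  have "m \<notin> crack_down" if "m \<in> crack_up" using that by (simp add: crack_up_def crack_down_def)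
  moreover have "\<i> \<noteq> - \<i>" by (simp add: complex_eq_iff)
  ultimately show ?thesis
    using assms by (cases "m \<in> crack_up"; cases "m \<in> crack_down") (simp_all add: dirs_at_def)
qed

lemma dirs_at_flip:
  assumes m: "m \<in> lattice" and \<rho>: "\<rho> \<in> dirs"
  shows "\<rho> \<in> dirs_at (m - \<rho>) \<longleftrightarrow> - \<rho> \<in> dirs_at m"
proof -
  have "m - \<rho> \<in> lattice" using lattice_add_dirs[OF m minus_dirs[OF \<rho>]] by simp
  note iff = dirs_at_iff[OF minus_dirs[OF \<rho>], of m] dirs_at_iff[OF \<rho>, of "m - \<rho>"]
  have ne: "- \<i> \<noteq> (1::complex)" "\<i> \<noteq> (1::complex)" "\<i> \<noteq> - (1::complex)" "- \<i> \<noteq> - (1::complex)" "\<i> \<noteq> - \<i>"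
    "(1::complex) \<noteq> - \<i>" "(1::complex) \<noteq> \<i>" "- (1::complex) \<noteq> \<i>" "- (1::complex) \<noteq> - \<i>" "- \<i> \<noteq> \<i>"
    by (simp_all add: complex_eq_iff)
  consider "\<rho> = 1 \<or> \<rho> = - 1" | "\<rho> = \<i>" | "\<rho> = - \<i>" using \<rho> by (auto simp: dirs_def)
  then show ?thesis
  proof cases
    case 1
    then show ?thesis using iff ne by auto
  next
    case 2
    have "m - \<i> \<in> crack_down \<longleftrightarrow> m \<in> crack_up"
      using \<open>m - \<rho> \<in> lattice\<close> m 2 by (simp add: crack_up_def crack_down_def eq_diff_eq diff_eq_eq)
    then show ?thesis using iff ne 2 by simp
  next
    case 3
    have "m + \<i> \<in> crack_up \<longleftrightarrow> m \<in> crack_down"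
      using \<open>m - \<rho> \<in> lattice\<close> m 3 by (auto simp: crack_up_def crack_down_def)
    then show ?thesis using iff ne 3 by simp
  qed
qed

text \<open>The set of bonds is symmetric, so both halves of each divergence term give the same
  contribution. This factor 2 is the origin of the masses 1/2 of \<open>lap k\<close> and of the
  normalisation 1/(4 pi) in \<open>Fundsol\<close>.\<close>

lemma ddiv_dgrad:
  assumes m: "m \<in> lattice"
  shows "ddiv (dgrad u) m = 2 * (\<Sum>\<rho>\<in>dirs. dgrad u m \<rho>)"
proof -
  have "dgrad u (m - \<rho>) \<rho> = - dgrad u m (- \<rho>)" if "\<rho> \<in> dirs" for \<rho>
    using dirs_at_flip[OF m that] by (simp add: dgrad_def)
  then have "(\<Sum>\<rho>\<in>dirs. dgrad u (m - \<rho>) \<rho>) = - (\<Sum>\<rho>\<in>dirs. dgrad u m (- \<rho>))"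
    by (simp add: sum_negf)
  then show ?thesis
    by (simp add: ddiv_def sum_subtractf sum_dirs_uminus)
qed

lemma lap_proj:
  assumes Z: "Z \<in> cov"
  shows "lap (\<lambda>Z. u (proj Z)) Z = ddiv (dgrad u) (proj Z) / 2"
  using sum_dirs_pdir[of "dgrad u (proj Z)" Z]
  by (simp add: lap_def proj_step_diff[OF Z] ddiv_dgrad[OF proj_lattice[OF Z]])

section \<open>Finite sums and summation by parts on the cover\<close>

definition covball :: "real \<Rightarrow> complex set" where
  "covball M = {Z \<in> cov. (cmod Z)\<^sup>2 \<le> M}"

lemma finite_lattice_ball: "finite {t \<in> lattice. cmod t \<le> M}"
proof -
  define n where "n = \<lceil>\<bar>M\<bar>\<rceil> + 1"
  have "{t \<in> lattice. cmod t \<le> M}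
    \<subseteq> (\<lambda>(a, b). Complex (of_int a - 1/2) (of_int b - 1/2)) ` ({-n..n} \<times> {-n..n})"
  proof
    fix t assume "t \<in> {t \<in> lattice. cmod t \<le> M}"
    then obtain a b :: int where ab: "Re t = of_int a - 1/2" "Im t = of_int b - 1/2" and "cmod t \<le> M"
      by (auto simp: lattice_iff)
    then have "\<bar>of_int a - 1/2\<bar> \<le> M" "\<bar>of_int b - 1/2\<bar> \<le> M"
      using abs_Re_le_cmod[of t] abs_Im_le_cmod[of t] by auto
    moreover have "M + 1 \<le> of_int n" unfolding n_def by linarith
    ultimately have "\<bar>real_of_int a\<bar> \<le> of_int n" "\<bar>real_of_int b\<bar> \<le> of_int n" by linarith+
    then have "a \<in> {-n..n}" "b \<in> {-n..n}" by auto
    then show "t \<in> (\<lambda>(a, b). Complex (of_int a - 1/2) (of_int b - 1/2)) ` ({-n..n} \<times> {-n..n})"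
      using ab by (intro image_eqI[of _ _ "(a, b)"]) (auto simp: complex_eq_iff)
  qed
  then show ?thesis by (rule finite_subset) auto
qed

lemma finite_covball [simp]: "finite (covball M)"
proof -
  let ?B = "{t \<in> lattice. cmod t \<le> M}"
  have "covball M \<subseteq> omega ` ?B \<union> (\<lambda>t. sheet (omega t)) ` ?B"
  proof
    fix Z assume Z: "Z \<in> covball M"
    then have "proj Z \<in> ?B" using proj_lattice norm_proj by (auto simp: covball_def)
    then show "Z \<in> omega ` ?B \<union> (\<lambda>t. sheet (omega t)) ` ?B"
      using cov_cases[of Z] Z unfolding covball_def by blast
  qed
  then show ?thesis by (rule finite_subset) (simp add: finite_lattice_ball)
qed

text \<open>The involution taking (Z, \<rho>) to (step \<rho> Z, -\<rho>) reverses every bond; the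
  support condition discards the bonds that leave the ball.\<close>

lemma sum_cov_swap:
  fixes H :: "complex \<Rightarrow> complex \<Rightarrow> real"
  assumes supp: "\<And>Z \<rho>. Z \<in> cov \<Longrightarrow> \<rho> \<in> dirs \<Longrightarrow> H Z (step \<rho> Z) \<noteq> 0 \<Longrightarrow>
      (cmod Z)\<^sup>2 \<le> M \<and> (cmod (step \<rho> Z))\<^sup>2 \<le> M"
  shows "(\<Sum>Z\<in>covball M. \<Sum>\<rho>\<in>dirs. H Z (step \<rho> Z)) = (\<Sum>Z\<in>covball M. \<Sum>\<rho>\<in>dirs. H (step \<rho> Z) Z)"
proof -
  define P where "P = {(Z, \<rho>) \<in> covball M \<times> dirs. step \<rho> Z \<in> covball M}"
  have restrict: "(\<Sum>Z\<in>covball M. \<Sum>\<rho>\<in>dirs. h Z \<rho>) = (\<Sum>(Z, \<rho>)\<in>P. h Z \<rho>)"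
    if "\<And>Z \<rho>. Z \<in> cov \<Longrightarrow> \<rho> \<in> dirs \<Longrightarrow> h Z \<rho> \<noteq> 0 \<Longrightarrow> (cmod (step \<rho> Z))\<^sup>2 \<le> M" for h :: "complex \<Rightarrow> complex \<Rightarrow> real"
    unfolding sum.cartesian_product
  proof (rule sum.mono_neutral_right)
    show "finite (covball M \<times> dirs)" by simp
  qed (use that step_cov in \<open>auto simp: P_def covball_def\<close>)
  have "(\<Sum>Z\<in>covball M. \<Sum>\<rho>\<in>dirs. H Z (step \<rho> Z)) = (\<Sum>(Z, \<rho>)\<in>P. H Z (step \<rho> Z))"
    using supp by (intro restrict) auto
  also have "\<dots> = (\<Sum>(Z, \<rho>)\<in>P. H (step \<rho> Z) Z)"
    by (rule sum.reindex_bij_witness[where i = "\<lambda>(Z, \<rho>). (step \<rho> Z, - \<rho>)"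
          and j = "\<lambda>(Z, \<rho>). (step \<rho> Z, - \<rho>)"])
       (auto simp: P_def covball_def step_step minus_dirs)
  also have "\<dots> = (\<Sum>Z\<in>covball M. \<Sum>\<rho>\<in>dirs. H (step \<rho> Z) Z)"
  proof (rule restrict[symmetric])
    fix Z \<rho> assume Z: "Z \<in> cov" "\<rho> \<in> dirs" "H (step \<rho> Z) Z \<noteq> 0"
    then show "(cmod (step \<rho> Z))\<^sup>2 \<le> M"
      using supp[OF step_cov[OF Z(1,2)] minus_dirs[OF Z(2)]] by (simp add: step_step)
  qed
  finally show ?thesis .
qed

text \<open>The margin 1 in the support condition is the bound of \<open>step_norm\<close>: a step
  changes |Z|^2 by at most 1, so no bond through the boundary of the ball contributes.\<close>

lemma sum_by_parts:
  fixes f g :: "complex \<Rightarrow> real"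
  assumes "\<And>Z. Z \<in> cov \<Longrightarrow> M - 1 < (cmod Z)\<^sup>2 \<Longrightarrow> f Z = 0"
  shows "(\<Sum>Z\<in>covball M. g Z * lap f Z) = (\<Sum>Z\<in>covball M. f Z * lap g Z)"
proof -
  have "(\<Sum>Z\<in>covball M. \<Sum>\<rho>\<in>dirs. g Z * f (step \<rho> Z)) = (\<Sum>Z\<in>covball M. \<Sum>\<rho>\<in>dirs. g (step \<rho> Z) * f Z)"
  proof (rule sum_cov_swap)
    fix Z \<rho> assume Z: "Z \<in> cov" "\<rho> \<in> dirs" and "g Z * f (step \<rho> Z) \<noteq> 0"
    then have "(cmod (step \<rho> Z))\<^sup>2 \<le> M - 1" using assms[OF step_cov[OF Z]] by force
    then show "(cmod Z)\<^sup>2 \<le> M \<and> (cmod (step \<rho> Z))\<^sup>2 \<le> M" using step_norm[OF Z] by linarith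
  qed
  moreover have "g Z * lap f Z = (\<Sum>\<rho>\<in>dirs. g Z * f (step \<rho> Z)) - 4 * (g Z * f Z)"
    "f Z * lap g Z = (\<Sum>\<rho>\<in>dirs. g (step \<rho> Z) * f Z) - 4 * (g Z * f Z)" for Z
    by (simp_all add: lap_def sum_subtractf sum_distrib_left algebra_simps)
  ultimately show ?thesis by (simp add: sum_subtractf)
qed

text \<open>Averaging over the two orientations of a bond gives every term an increment of
  \<open>ch\<close> together with an increment of f or of g. Without this symmetrisation the
  increment of \<open>ch\<close> would multiply undifferentiated functions, and the decay would not
  suffice.\<close>

lemma sum_commutator:
  fixes f g ch :: "complex \<Rightarrow> real"
  assumes "\<And>Z. Z \<in> cov \<Longrightarrow> M - 1 < (cmod Z)\<^sup>2 \<Longrightarrow> ch Z = 0"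
  shows "(\<Sum>Z\<in>covball M. g Z * (lap (\<lambda>Z. ch Z * f Z) Z - ch Z * lap f Z)) =
    (\<Sum>Z\<in>covball M. \<Sum>\<rho>\<in>dirs. (ch (step \<rho> Z) - ch Z) *
      (g Z * (f (step \<rho> Z) - f Z) - f Z * (g (step \<rho> Z) - g Z))) / 2"
proof -
  define H where "H Z Z' = (ch Z' - ch Z) * (g Z * f Z')" for Z Z'
  have "(\<Sum>Z\<in>covball M. \<Sum>\<rho>\<in>dirs. H Z (step \<rho> Z)) = (\<Sum>Z\<in>covball M. \<Sum>\<rho>\<in>dirs. H (step \<rho> Z) Z)"
  proof (rule sum_cov_swap)
    fix Z \<rho> assume Z: "Z \<in> cov" "\<rho> \<in> dirs" and "H Z (step \<rho> Z) \<noteq> 0"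
    then have "(cmod (step \<rho> Z))\<^sup>2 \<le> M - 1 \<or> (cmod Z)\<^sup>2 \<le> M - 1"
      using assms[OF step_cov[OF Z]] assms[OF Z(1)] by (force simp: H_def)
    then show "(cmod Z)\<^sup>2 \<le> M \<and> (cmod (step \<rho> Z))\<^sup>2 \<le> M" using step_norm[OF Z] by linarith
  qed
  moreover have "g Z * (lap (\<lambda>Z. ch Z * f Z) Z - ch Z * lap f Z) = (\<Sum>\<rho>\<in>dirs. H Z (step \<rho> Z))" for Z
    by (simp add: H_def lap_def sum_distrib_left sum_subtractf[symmetric] algebra_simps)
  moreover have "(ch (step \<rho> Z) - ch Z) * (g Z * (f (step \<rho> Z) - f Z) - f Z * (g (step \<rho> Z) - g Z))
      = H Z (step \<rho> Z) + H (step \<rho> Z) Z" for Z \<rho>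
    by (simp add: H_def algebra_simps)
  ultimately show ?thesis by (simp add: sum.distrib)
qed

lemma sum_lifts:
  fixes f :: "complex \<Rightarrow> real"
  assumes t: "t \<in> lattice" "cmod t \<le> M"
  shows "(\<Sum>Z\<in>covball M. f Z * (if proj Z = t then 1 else 0)) = f (omega t) + f (sheet (omega t))"
proof -
  have ne: "omega t \<noteq> sheet (omega t)"
    using Re_omega[OF t(1)] by (auto simp: sheet_def complex_eq_iff)
  have sub: "{omega t, sheet (omega t)} \<subseteq> covball M"
    using t omega_cov sheet_cov by (auto simp: covball_def)
  have "(\<Sum>Z\<in>covball M. f Z * (if proj Z = t then 1 else 0))
      = (\<Sum>Z\<in>{omega t, sheet (omega t)}. f Z * (if proj Z = t then 1 else 0))"
  proof (rule sum.mono_neutral_right[OF finite_covball sub], intro ballI)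
    fix Z assume Z: "Z \<in> covball M - {omega t, sheet (omega t)}"
    then have "proj Z \<noteq> t" using cov_cases[of Z] by (auto simp del: proj_omega simp: covball_def)
    then show "f Z * (if proj Z = t then 1 else 0) = 0" by simp
  qed
  also have "\<dots> = f (omega t) + f (sheet (omega t))"
    using ne t proj_sheet[OF omega_cov] by simp
  finally show ?thesis .
qed

lemma sum_even_lap_Re:
  assumes "\<And>Z. Z \<in> cov \<Longrightarrow> g (sheet Z) = g Z"
  shows "(\<Sum>Z\<in>covball M. g Z * lap Re Z) = 0"
proof -
  have lap_odd: "lap Re (sheet Z) = - lap Re Z" if "Z \<in> cov" for Z
  proof -
    have "lap Re (sheet Z) = (\<Sum>\<rho>\<in>dirs. Re (sheet (step (cnj \<rho>) Z)) - Re (sheet Z))"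
      by (simp add: lap_def step_sheet[OF that])
    also have "\<dots> = (\<Sum>\<rho>\<in>dirs. Re (sheet (step \<rho> Z)) - Re (sheet Z))"
      using sum_dirs_cnj[of "\<lambda>\<rho>. Re (sheet (step \<rho> Z)) - Re (sheet Z)"] by simp
    also have "\<dots> = - lap Re Z"
      by (simp add: lap_def sheet_def sum_subtractf sum_negf)
    finally show ?thesis .
  qed
  have "(\<Sum>Z\<in>covball M. g Z * lap Re Z) = (\<Sum>Z\<in>covball M. g (sheet Z) * lap Re (sheet Z))"
    by (rule sum.reindex_bij_witness[of _ sheet sheet]) (auto simp: covball_def sheet_cov)
  also have "\<dots> = - (\<Sum>Z\<in>covball M. g Z * lap Re Z)"
    unfolding sum_negf[symmetric]
    by (rule sum.cong) (use assms lap_odd in \<open>simp_all add: covball_def\<close>)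
  finally show ?thesis by simp
qed

section \<open>Residuals of the continuum predictor\<close>

lemma sum_inj_le_suminf:
  fixes f :: "nat \<Rightarrow> real"
  assumes "summable f" "\<And>n. 0 \<le> f n" "finite A" "inj_on g A"
  shows "(\<Sum>x\<in>A. f (g x)) \<le> suminf f"
proof -
  have "(\<Sum>x\<in>A. f (g x)) = sum f (g ` A)" using assms(4) by (simp add: sum.reindex)
  also have "\<dots> \<le> suminf f" using assms by (intro sum_le_suminf) auto
  finally show ?thesis .
qed

lemma summable_shift_powr: "1 < q \<Longrightarrow> summable (\<lambda>n. (1 + real n) powr (- q))"
  using summable_Suc_iff[of "\<lambda>n. real n powr (- q)"] summable_real_powr_iff[of "- q"]
  by (simp add: add.commute)

text \<open>On either side of \<alpha> the integer parts of |j - \<alpha>| are distinct, so each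
  half is dominated by the unshifted series. The uniformity in \<alpha> is needed because \<alpha>
  will mark where a lattice path comes closest to a pole.\<close>

lemma sum_shift_bounded:
  assumes "1 < q"
  shows "\<exists>C>0. \<forall>n \<alpha>. (\<Sum>j<n. (1 + \<bar>real j - \<alpha>\<bar>) powr (- q)) \<le> C"
proof (intro exI conjI allI)
  define f where "f n = (1 + real n) powr (- q)" for n
  note f = summable_shift_powr[OF assms]
  have f0: "0 \<le> f n" for n by (simp add: f_def)
  show "0 < 2 * suminf f + 1" using suminf_nonneg[of f] f f0 by (simp add: f_def[abs_def])
  fix n :: nat and \<alpha> :: real
  have le: "(1 + \<bar>x\<bar>) powr (- q) \<le> f (nat \<lfloor>\<bar>x\<bar>\<rfloor>)" for x
    unfolding f_def using assms of_nat_floor[of "\<bar>x\<bar>"]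
    by (intro powr_mono2') (simp_all del: of_nat_nat add: add_pos_nonneg)
  have part: "(\<Sum>j\<in>A. (1 + \<bar>real j - \<alpha>\<bar>) powr (- q)) \<le> suminf f"
    if "finite A" "inj_on (\<lambda>j. nat \<lfloor>\<bar>real j - \<alpha>\<bar>\<rfloor>) A" for A
    using sum_inj_le_suminf[OF f[folded f_def] f0 that]
      sum_mono[of A "\<lambda>j. (1 + \<bar>real j - \<alpha>\<bar>) powr (- q)", OF le] by linarith
  have inj: "inj_on (\<lambda>j. nat \<lfloor>\<bar>real j - \<alpha>\<bar>\<rfloor>) {j\<in>{..<n}. real j \<ge> \<alpha>}"
    by (rule inj_onI) (auto simp: eq_nat_nat_iff, linarith)
  have inj': "inj_on (\<lambda>j. nat \<lfloor>\<bar>real j - \<alpha>\<bar>\<rfloor>) {j\<in>{..<n}. \<not> real j \<ge> \<alpha>}"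
    by (rule inj_onI) (auto simp: eq_nat_nat_iff, linarith)
  have "(\<Sum>j\<in>{j\<in>{..<n}. real j \<ge> \<alpha>}. (1 + \<bar>real j - \<alpha>\<bar>) powr (- q)) \<le> suminf f"
    "(\<Sum>j\<in>{j\<in>{..<n}. \<not> real j \<ge> \<alpha>}. (1 + \<bar>real j - \<alpha>\<bar>) powr (- q)) \<le> suminf f"
    by (rule part[OF _ inj] part[OF _ inj'], simp)+
  moreover have "(\<Sum>j<n. (1 + \<bar>real j - \<alpha>\<bar>) powr (- q)) =
    (\<Sum>j\<in>{j\<in>{..<n}. real j \<ge> \<alpha>}. (1 + \<bar>real j - \<alpha>\<bar>) powr (- q)) +
    (\<Sum>j\<in>{j\<in>{..<n}. \<not> real j \<ge> \<alpha>}. (1 + \<bar>real j - \<alpha>\<bar>) powr (- q))"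
    by (subst sum.union_disjoint[symmetric]) (auto intro!: sum.cong)
  ultimately show "(\<Sum>j<n. (1 + \<bar>real j - \<alpha>\<bar>) powr (- q)) \<le> 2 * suminf f + 1" by linarith
qed

lemma half_int_sum_bounded:
  "\<exists>C>0. \<forall>A. finite A \<longrightarrow> (\<Sum>a\<in>A. \<bar>real_of_int a - 1/2\<bar> powr (- 5/4)) \<le> C"
proof (intro exI conjI allI impI)
  define f where "f n = 4 * (1 + real n) powr (- 5/4)" for n
  have f: "summable f" unfolding f_def
    using summable_shift_powr[of "5/4"] by (intro summable_mult) simp
  have f0: "0 \<le> f n" for n by (simp add: f_def)
  show "0 < 2 * suminf f + 1" using suminf_nonneg[OF f f0] by simp
  have two: "(2::real) powr (5/4) \<le> 4"
    using powr_mono[of "5/4" 2 "2::real"] by simp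
  have le: "x powr (- 5/4) \<le> f n" if "(1 + real n) / 2 \<le> x" for x n
  proof -
    have "x powr (- 5/4) \<le> ((1 + real n) / 2) powr (- 5/4)"
      using that by (intro powr_mono2') auto
    also have "\<dots> = 2 powr (5/4) * (1 + real n) powr (- 5/4)"
      by (simp add: powr_divide powr_minus divide_simps)
    also have "\<dots> \<le> f n" unfolding f_def using two by (intro mult_right_mono) auto
    finally show ?thesis .
  qed
  fix A :: "int set" assume A: "finite A"
  have "(\<Sum>a\<in>{a\<in>A. 1 \<le> a}. \<bar>real_of_int a - 1/2\<bar> powr (- 5/4)) \<le> (\<Sum>a\<in>{a\<in>A. 1 \<le> a}. f (nat (a - 1)))"
    by (intro sum_mono le) auto
  also have "\<dots> \<le> suminf f"
    using A by (intro sum_inj_le_suminf f f0) (auto intro!: inj_onI)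
  finally have 1: "(\<Sum>a\<in>{a\<in>A. 1 \<le> a}. \<bar>real_of_int a - 1/2\<bar> powr (- 5/4)) \<le> suminf f" .
  have "(\<Sum>a\<in>{a\<in>A. \<not> 1 \<le> a}. \<bar>real_of_int a - 1/2\<bar> powr (- 5/4)) \<le> (\<Sum>a\<in>{a\<in>A. \<not> 1 \<le> a}. f (nat (- a)))"
    by (intro sum_mono le) auto
  also have "\<dots> \<le> suminf f"
    using A by (intro sum_inj_le_suminf f f0) (auto intro!: inj_onI)
  finally have 2: "(\<Sum>a\<in>{a\<in>A. \<not> 1 \<le> a}. \<bar>real_of_int a - 1/2\<bar> powr (- 5/4)) \<le> suminf f" .
  have "(\<Sum>a\<in>A. \<bar>real_of_int a - 1/2\<bar> powr (- 5/4)) =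
    (\<Sum>a\<in>{a\<in>A. 1 \<le> a}. \<bar>real_of_int a - 1/2\<bar> powr (- 5/4)) +
    (\<Sum>a\<in>{a\<in>A. \<not> 1 \<le> a}. \<bar>real_of_int a - 1/2\<bar> powr (- 5/4))"
    using A by (subst sum.union_disjoint[symmetric]) (auto intro!: sum.cong)
  with 1 2 show "(\<Sum>a\<in>A. \<bar>real_of_int a - 1/2\<bar> powr (- 5/4)) \<le> 2 * suminf f + 1" by linarith
qed

text \<open>Since |Re t| |Im t| <= |t|^2, the sum is dominated by the product of two one-dimensional
  sums with exponent 5/4 > 1.\<close>

lemma lattice_sum_bounded:
  "\<exists>S>0. \<forall>F. finite F \<longrightarrow> F \<subseteq> lattice \<longrightarrow> (\<Sum>t\<in>F. cmod t powr (- 5/2)) \<le> S"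
proof -
  define h where "h a = \<bar>real_of_int a - 1/2\<bar> powr (- 5/4)" for a
  obtain C where C: "0 < C" "\<And>A. finite A \<Longrightarrow> sum h A \<le> C"
    using half_int_sum_bounded unfolding h_def by blast
  have "(\<Sum>t\<in>F. cmod t powr (- 5/2)) \<le> C * C" if F: "finite F" "F \<subseteq> lattice" for F
  proof -
    define a where "a t = \<lfloor>Re t + 1/2\<rfloor>" for t
    define b where "b t = \<lfloor>Im t + 1/2\<rfloor>" for t
    have ab: "Re t = of_int (a t) - 1/2 \<and> Im t = of_int (b t) - 1/2" if "t \<in> lattice" for t
      using that by (auto simp: lattice_iff a_def b_def)
    have inj: "inj_on (\<lambda>t. (a t, b t)) F"
      using ab F(2) by (intro inj_onI) (auto simp: complex_eq_iff subset_iff)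
    have "(\<Sum>t\<in>F. cmod t powr (- 5/2)) \<le> (\<Sum>t\<in>F. h (a t) * h (b t))"
    proof (rule sum_mono)
      fix t assume "t \<in> F"
      then have t: "t \<in> lattice" using F by auto
      define x where "x = \<bar>Re t\<bar>" define y where "y = \<bar>Im t\<bar>"
      have xy: "0 < x" "0 < y" using lattice_nonzero[OF t] by (auto simp: x_def y_def)
      have "2 * (x * y) \<le> x\<^sup>2 + y\<^sup>2" using sum_squares_bound[of x y] by simp
      moreover have "0 < x * y" using xy by simp
      ultimately have "x * y \<le> x\<^sup>2 + y\<^sup>2" by linarith
      then have "x * y \<le> (cmod t)\<^sup>2" by (simp add: cmod_power2 x_def y_def)
      then have "((cmod t)\<^sup>2) powr (- 5/4) \<le> (x * y) powr (- 5/4)"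
        using xy by (intro powr_mono2') auto
      moreover have "((cmod t)\<^sup>2) powr (- 5/4) = cmod t powr (- 5/2)"
        using lattice_nonzero[OF t] by (simp add: powr_powr flip: powr_numeral)
      ultimately show "cmod t powr (- 5/2) \<le> h (a t) * h (b t)"
        using xy ab[OF t] by (simp add: h_def x_def y_def powr_mult)
    qed
    also have "\<dots> = (\<Sum>(i, j)\<in>(\<lambda>t. (a t, b t)) ` F. h i * h j)"
      by (simp add: sum.reindex[OF inj])
    also have "\<dots> \<le> (\<Sum>(i, j)\<in>a ` F \<times> b ` F. h i * h j)"
      using F by (intro sum_mono2) (auto simp: h_def)
    also have "\<dots> = sum h (a ` F) * sum h (b ` F)"
      by (simp add: sum_product sum.cartesian_product)
    also have "\<dots> \<le> C * C"
      using C F by (intro mult_mono) (auto simp: h_def intro!: sum_nonneg)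
    finally show ?thesis .
  qed
  with C show ?thesis by (intro exI[of _ "C * C"]) auto
qed

text \<open>As |Z|^2 is the modulus of the site below Z, this is exponent 5/2 on the lattice;
  squaring is injective on each of the half planes Re Z > 0 and Re Z < 0.\<close>

lemma cov_sum_bounded:
  "\<exists>S>0. \<forall>F. finite F \<longrightarrow> F \<subseteq> cov \<longrightarrow> (\<Sum>Z\<in>F. 1 / cmod Z ^ 5) \<le> S"
proof -
  obtain S where S: "0 < S" "\<And>F. finite F \<Longrightarrow> F \<subseteq> lattice \<Longrightarrow> (\<Sum>t\<in>F. cmod t powr (- 5/2)) \<le> S"
    using lattice_sum_bounded by blast
  have part: "(\<Sum>Z\<in>F. 1 / cmod Z ^ 5) \<le> S" if F: "finite F" "F \<subseteq> cov" "inj_on (\<lambda>Z. Z\<^sup>2) F" for F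
  proof -
    have "1 / cmod Z ^ 5 = cmod (Z\<^sup>2) powr (- 5/2)" if "Z \<in> F" for Z
    proof -
      have "Z \<noteq> 0" using that F cov_nonzero by auto
      have "cmod (Z\<^sup>2) powr (- 5/2) = (cmod Z powr 2) powr (- 5/2)"
        using \<open>Z \<noteq> 0\<close> by (simp add: norm_power)
      also have "\<dots> = cmod Z powr (- 5)" by (simp only: powr_powr) simp
      also have "\<dots> = 1 / cmod Z ^ 5"
        using \<open>Z \<noteq> 0\<close> by (simp add: powr_minus_divide)
      finally show ?thesis by simp
    qed
    then have "(\<Sum>Z\<in>F. 1 / cmod Z ^ 5) = (\<Sum>t\<in>(\<lambda>Z. Z\<^sup>2) ` F. cmod t powr (- 5/2))"
      by (simp add: sum.reindex[OF F(3)])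
    also have "\<dots> \<le> S" using F by (intro S) (auto simp: cov_def)
    finally show ?thesis .
  qed
  have "(\<Sum>Z\<in>F. 1 / cmod Z ^ 5) \<le> 2 * S" if F: "finite F" "F \<subseteq> cov" for F
  proof -
    have "(\<Sum>Z\<in>{Z\<in>F. 0 < Re Z}. 1 / cmod Z ^ 5) \<le> S"
    proof (intro part inj_onI)
      fix x y assume xy: "x \<in> {Z\<in>F. 0 < Re Z}" "y \<in> {Z\<in>F. 0 < Re Z}" "x\<^sup>2 = y\<^sup>2"
      then have "x = y \<or> x = - y" by (simp add: power2_eq_iff)
      moreover have "x \<noteq> - y" using xy by auto
      ultimately show "x = y" by blast
    qed (use F in auto)
    moreover have "(\<Sum>Z\<in>{Z\<in>F. \<not> 0 < Re Z}. 1 / cmod Z ^ 5) \<le> S"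
    proof (intro part inj_onI)
      fix x y assume xy: "x \<in> {Z\<in>F. \<not> 0 < Re Z}" "y \<in> {Z\<in>F. \<not> 0 < Re Z}" "x\<^sup>2 = y\<^sup>2"
      then have "Re x < 0" "Re y < 0" using F cov_nonzero(2)[of x] cov_nonzero(2)[of y] by fastforce+
      then have "x \<noteq> - y" by auto
      moreover have "x = y \<or> x = - y" using xy by (simp add: power2_eq_iff)
      ultimately show "x = y" by blast
    qed (use F in auto)
    moreover have "(\<Sum>Z\<in>F. 1 / cmod Z ^ 5) = (\<Sum>Z\<in>{Z\<in>F. 0 < Re Z}. 1 / cmod Z ^ 5)
        + (\<Sum>Z\<in>{Z\<in>F. \<not> 0 < Re Z}. 1 / cmod Z ^ 5)"
      using F by (subst sum.union_disjoint[symmetric]) (auto intro!: sum.cong)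
    ultimately show ?thesis by linarith
  qed
  with S show ?thesis by (intro exI[of _ "2 * S"]) auto
qed

section \<open>Stencil residuals of holomorphic functions on the cover\<close>

lemma step_diff:
  fixes y :: complex
  assumes "Z \<noteq> 0"
  shows "cmod (step y Z - Z) \<le> cmod y / cmod Z"
proof -
  have "step y Z - Z = Z * (csqrt (1 + y / Z\<^sup>2) - 1)" by (simp add: step_def algebra_simps)
  then have "cmod (step y Z - Z) \<le> cmod Z * cmod (y / Z\<^sup>2)"
    by (simp only: norm_mult) (intro mult_left_mono norm_csqrt_minus_1, simp)
  also have "\<dots> = cmod y / cmod Z" using assms by (simp add: norm_divide norm_mult power2_eq_square)
  finally show ?thesis .
qed

lemma step_0 [simp]: "step 0 Z = Z"
  by (simp add: step_def)

lemma holomorphic_step: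
  assumes "Z \<noteq> 0" "r \<le> (cmod Z)\<^sup>2"
  shows "(\<lambda>y. step y Z) holomorphic_on ball 0 r"
  unfolding step_def
proof (intro holomorphic_intros)
  fix y :: complex assume "y \<in> ball 0 r"
  then have "cmod (y / Z\<^sup>2) < 1" using assms by (simp add: norm_divide norm_power divide_simps)
  then show "1 + y / Z\<^sup>2 \<notin> \<real>\<^sub>\<le>\<^sub>0" by (rule one_plus_not_nonpos_Reals)
qed (use assms in auto)

text \<open>The increment \<rho> is replaced by a complex variable y. The composite
  \<open>f (step y Z)\<close> is holomorphic in discs of radius comparable to |Z|^2, so a fourth
  order Taylor estimate in y gains the factor |Z|^-8, and a first difference the factor
  |Z|^-2.\<close>

lemma lap_holomorphic:
  assumes Z: "Z \<noteq> 0" and f: "f holomorphic_on U" and U: "\<And>y. cmod y < r' \<Longrightarrow> step y Z \<in> U"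
    and r: "2 \<le> r" "r < r'" "r' \<le> (cmod Z)\<^sup>2"
    and M: "\<And>y. cmod y = r \<Longrightarrow> cmod (f (step y Z)) \<le> M"
    and u: "\<And>y. cmod y \<le> 1 \<Longrightarrow> u (step y Z) = c * Re (f (step y Z)) + d"
  shows "\<bar>lap u Z\<bar> \<le> \<bar>c\<bar> * (8 * M / r ^ 4)"
    and "\<rho> \<in> dirs \<Longrightarrow> \<bar>u (step \<rho> Z) - u Z\<bar> \<le> \<bar>c\<bar> * (2 * M / r)"
proof -
  define g where "g y = f (step y Z)" for y
  have hol: "g holomorphic_on ball 0 r'"
  proof -
    have "(\<lambda>y. step y Z) ` ball 0 r' \<subseteq> U" using U by (auto simp del: step_0)
    from holomorphic_on_compose_gen[OF holomorphic_step[OF Z r(3)] f this]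
    show ?thesis by (simp add: g_def[abs_def] o_def)
  qed
  have diff: "u (step \<rho> Z) - u Z = c * Re (g \<rho> - g 0)" if "\<rho> \<in> dirs" for \<rho>
  proof -
    have "u (step \<rho> Z) = c * Re (g \<rho>) + d" "u Z = c * Re (g 0) + d"
      using u[of \<rho>] u[of 0] norm_dirs[OF that] by (simp_all add: g_def)
    then show ?thesis by (simp add: right_diff_distrib)
  qed
  have M': "cmod (g y) \<le> M" if "cmod y = r" for y using M[OF that] by (simp add: g_def)
  note stencil = holomorphic_stencil[OF hol r(2,1) M']
  have "lap u Z = c * Re (\<Sum>\<rho>\<in>dirs. g \<rho> - g 0)"
    by (simp add: lap_def diff sum_distrib_left)
  moreover have "\<bar>Re (\<Sum>\<rho>\<in>dirs. g \<rho> - g 0)\<bar> \<le> 8 * M / r ^ 4"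
    using order_trans[OF abs_Re_le_cmod stencil(1)] .
  ultimately show "\<bar>lap u Z\<bar> \<le> \<bar>c\<bar> * (8 * M / r ^ 4)"
    by (simp only: abs_mult mult_left_mono abs_ge_zero)
  assume \<rho>: "\<rho> \<in> dirs"
  have "\<bar>Re (g \<rho> - g 0)\<bar> \<le> 2 * M / r"
    using order_trans[OF abs_Re_le_cmod stencil(2)[OF _ \<rho>]] by simp
  then show "\<bar>u (step \<rho> Z) - u Z\<bar> \<le> \<bar>c\<bar> * (2 * M / r)"
    by (simp only: diff[OF \<rho>] abs_mult mult_left_mono abs_ge_zero)
qed

section \<open>The source increment of the fundamental solution\<close>

definition dF :: "complex \<Rightarrow> complex \<Rightarrow> complex \<Rightarrow> real" where
  "dF z z' Z = Fundsol (z' - Z) - Fundsol (z - Z)"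

text \<open>Neither logarithm is single valued around its pole, but the quotient (z' - Z)/(z - Z)
  stays in a disc about 1 as long as Z is farther from z than z' is.\<close>

lemma dF_Ln:
  assumes "cmod (z' - z) < cmod (z - Z)"
  shows "dF z z' Z = - (1 / (4 * pi)) * Re (Ln (1 + (z' - z) / (z - Z)))"
    and "1 + (z' - z) / (z - Z) \<notin> \<real>\<^sub>\<le>\<^sub>0"
proof -
  define v where "v = (z' - z) / (z - Z)"
  have nz: "z - Z \<noteq> 0" using assms by auto
  then have "cmod v < 1" using assms by (simp add: v_def norm_divide divide_simps)
  then have v: "1 + v \<notin> \<real>\<^sub>\<le>\<^sub>0" by (rule one_plus_not_nonpos_Reals)
  then have v0: "1 + v \<noteq> 0" by auto
  have "(z - Z) * v = z' - z" using nz by (simp add: v_def)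
  then have "z' - Z = (z - Z) * (1 + v)" by (simp add: algebra_simps)
  then have "cmod (z' - Z) = cmod (z - Z) * cmod (1 + v)" by (metis norm_mult)
  then have "ln (cmod (z' - Z)) = ln (cmod (z - Z)) + Re (Ln (1 + v))"
    using nz v0 by (simp add: ln_mult)
  then show "dF z z' Z = - (1 / (4 * pi)) * Re (Ln (1 + (z' - z) / (z - Z)))"
    by (simp add: dF_def Fundsol_def v_def[symmetric] algebra_simps)
  show "1 + (z' - z) / (z - Z) \<notin> \<real>\<^sub>\<le>\<^sub>0" using v by (simp add: v_def)
qed

text \<open>A complex increment of size c |Z|^2/2 moves Z by at most c |Z|/2, hence by at most half
  its distance D to the pole. There the argument of the logarithm differs from 1 by at most 2/(|z|
  D), and this is the sup bound that enters the stencil estimate with radius c |Z|^2/4.\<close>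

lemma dF_bounds:
  assumes Z: "Z \<noteq> 0" and z: "z \<noteq> 0" "cmod (z' - z) \<le> 1 / cmod z"
    and c: "0 < c" "c \<le> 1" "c * cmod Z \<le> cmod (Z - z)"
    and big: "4 \<le> cmod z * cmod (Z - z)" "8 \<le> c * (cmod Z)\<^sup>2"
  shows "\<bar>lap (dF z z') Z\<bar> \<le> 1000 / (cmod z * cmod (Z - z) * (c * (cmod Z)\<^sup>2) ^ 4)"
    and "\<rho> \<in> dirs \<Longrightarrow> \<bar>dF z z' (step \<rho> Z) - dF z z' Z\<bar>
           \<le> 4 / (cmod z * cmod (Z - z) * (c * (cmod Z)\<^sup>2))"
    and "\<bar>dF z z' Z\<bar> \<le> 1 / (cmod z * cmod (Z - z))"
proof -
  define D where "D = cmod (Z - z)"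
  define f where "f W = Ln (1 + (z' - z) / (z - W))" for W
  define U where "U = {W. cmod (z' - z) < cmod (z - W)}"
  define r where "r = c * (cmod Z)\<^sup>2 / 4"
  have zpos: "0 < cmod z" using z by simp
  have Dpos: "0 < D" using big(1) zpos unfolding D_def[symmetric]
    by (metis less_eq_real_def linorder_not_le mult_zero_right not_numeral_le_zero norm_ge_zero D_def)
  have hol: "f holomorphic_on U"
    unfolding f_def U_def by (intro holomorphic_intros) (auto dest: dF_Ln(2))
  have far: "D / 2 \<le> cmod (z - step y Z)" if "cmod y \<le> c * (cmod Z)\<^sup>2 / 2" for y
  proof -
    have "cmod (step y Z - Z) \<le> cmod y / cmod Z" by (rule step_diff[OF Z])
    also have "\<dots> \<le> (c * (cmod Z)\<^sup>2 / 2) / cmod Z" using that by (intro divide_right_mono) auto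
    also have "\<dots> = c * cmod Z / 2" using Z by (simp add: power2_eq_square)
    also have "\<dots> \<le> D / 2" using c by (simp add: D_def)
    finally have "cmod (step y Z - Z) \<le> D / 2" .
    moreover have "D \<le> cmod (z - step y Z) + cmod (step y Z - Z)"
      unfolding D_def using norm_triangle_ineq[of "z - step y Z" "step y Z - Z"] by (simp add: norm_minus_commute)
    ultimately show ?thesis by linarith
  qed
  have zD: "4 \<le> cmod z * D" using big by (simp add: D_def)
  have small: "cmod ((z' - z) / (z - W)) \<le> 2 / (cmod z * D)" if "D / 2 \<le> cmod (z - W)" for W
  proof -
    have "cmod ((z' - z) / (z - W)) \<le> (1 / cmod z) / (D / 2)"
      unfolding norm_divide using z that Dpos by (intro frac_le) auto
    then show ?thesis by simp
  qed
  have half: "2 / (cmod z * D) \<le> 1 / 2"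
    using zD zpos Dpos by (simp add: divide_simps)
  have fb: "cmod (f W) \<le> 4 / (cmod z * D)" if "D / 2 \<le> cmod (z - W)" for W
    using norm_Ln_1p_le[of "(z' - z) / (z - W)"] small[OF that] half unfolding f_def by simp
  have inU: "W \<in> U" if "D / 2 \<le> cmod (z - W)" for W
  proof -
    have "cmod (z - W) > 0" using that Dpos by linarith
    moreover have "cmod ((z' - z) / (z - W)) \<le> 1/2" using small[OF that] half by linarith
    ultimately have "cmod (z' - z) * 2 \<le> cmod (z - W)" by (simp add: norm_divide divide_simps)
    then show ?thesis using \<open>0 < cmod (z - W)\<close> zero_le_power2 unfolding U_def mem_Collect_eq
      by linarith
  qed
  have dF: "dF z z' W = - (1 / (4 * pi)) * Re (f W) + 0" if "W \<in> U" for W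
    using dF_Ln(1) that by (simp add: U_def f_def)
  have r: "2 \<le> r" "r < c * (cmod Z)\<^sup>2 / 2" using big by (auto simp: r_def)
  have r': "c * (cmod Z)\<^sup>2 / 2 \<le> (cmod Z)\<^sup>2"
    using c mult_right_mono[of c 1 "(cmod Z)\<^sup>2"] zero_le_power2[of "cmod Z"] by linarith
  have U: "step y Z \<in> U" if "cmod y < c * (cmod Z)\<^sup>2 / 2" for y
    using inU far that by simp
  have M: "cmod (f (step y Z)) \<le> 4 / (cmod z * D)" if "cmod y = r" for y
    using fb far that r by simp
  have u: "dF z z' (step y Z) = - (1 / (4 * pi)) * Re (f (step y Z)) + 0" if "cmod y \<le> 1" for y
    using dF U that r by simp
  note L = lap_holomorphic[OF Z hol U r r' M u]
  have pi: "\<bar>- (1 / (4 * pi))\<bar> \<le> 1 / 12" using pi_gt3 by (simp add: divide_simps)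
  have P: "0 \<le> 4 / (cmod z * D)" using zpos Dpos by simp
  have "\<bar>lap (dF z z') Z\<bar> \<le> \<bar>- (1 / (4 * pi))\<bar> * (8 * (4 / (cmod z * D)) / r ^ 4)" by (rule L(1))
  also have "\<dots> \<le> 1/12 * (8 * (4 / (cmod z * D)) / r ^ 4)"
    using P r pi by (intro mult_right_mono) auto
  also have "\<dots> = (8/3 * 256) / (cmod z * D * (c * (cmod Z)\<^sup>2) ^ 4)"
    by (simp add: r_def power_divide)
  also have "\<dots> \<le> 1000 / (cmod z * D * (c * (cmod Z)\<^sup>2) ^ 4)"
    using zpos Dpos c by (intro divide_right_mono) auto
  finally show "\<bar>lap (dF z z') Z\<bar> \<le> 1000 / (cmod z * cmod (Z - z) * (c * (cmod Z)\<^sup>2) ^ 4)"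
    by (simp add: D_def)
  show "\<bar>dF z z' (step \<rho> Z) - dF z z' Z\<bar> \<le> 4 / (cmod z * cmod (Z - z) * (c * (cmod Z)\<^sup>2))"
    if \<rho>: "\<rho> \<in> dirs"
  proof -
    have "\<bar>dF z z' (step \<rho> Z) - dF z z' Z\<bar> \<le> \<bar>- (1 / (4 * pi))\<bar> * (2 * (4 / (cmod z * D)) / r)"
      using L(2)[OF _ _ _ \<rho>] by blast
    also have "\<dots> \<le> 1/12 * (2 * (4 / (cmod z * D)) / r)"
      using P r pi by (intro mult_right_mono) auto
    also have "\<dots> = (8/3) / (cmod z * D * (c * (cmod Z)\<^sup>2))" by (simp add: r_def)
    also have "\<dots> \<le> 4 / (cmod z * D * (c * (cmod Z)\<^sup>2))"
      using zpos Dpos c by (intro divide_right_mono) auto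
    finally show ?thesis by (simp add: D_def)
  qed
  have "\<bar>dF z z' Z\<bar> = \<bar>- (1 / (4 * pi))\<bar> * \<bar>Re (f Z)\<bar>" using u[of 0] by (simp add: abs_mult)
  also have "\<dots> \<le> 1/12 * (4 / (cmod z * D))"
  proof (intro mult_mono pi)
    have "D / 2 \<le> cmod (z - Z)" using Dpos by (simp add: D_def norm_minus_commute)
    then show "\<bar>Re (f Z)\<bar> \<le> 4 / (cmod z * D)" using fb abs_Re_le_cmod order_trans by blast
  qed auto
  also have "\<dots> \<le> 1 / (cmod z * D)" using zpos Dpos by (simp add: divide_simps)
  finally show "\<bar>dF z z' Z\<bar> \<le> 1 / (cmod z * cmod (Z - z))" by (simp add: D_def)
qed

text \<open>Removing the linear Taylor term leaves a function with derivative -x/(1 - x), which is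
  of order m on the disc of radius m; this gains a factor m over the Lipschitz bound of the
  logarithm.\<close>

lemma Ln_taylor_diff:
  assumes "cmod v \<le> m" "cmod w \<le> m" "m \<le> 3 / 4"
  shows "cmod ((Ln (1 - v) + v) - (Ln (1 - w) + w)) \<le> 4 * m * cmod (v - w)"
proof (rule field_differentiable_bound[where S = "cball 0 m"])
  fix x :: complex assume x: "x \<in> cball 0 m"
  then have xm: "cmod x \<le> m" by simp
  have nz: "1 - x \<notin> \<real>\<^sub>\<le>\<^sub>0" using one_plus_not_nonpos_Reals[of "- x"] xm assms by simp
  then have "1 - x \<noteq> 0" by auto
  have "((\<lambda>x. Ln (1 - x) + x) has_field_derivative (inverse (1 - x) * (0 - 1) + 1)) (at x within cball 0 m)"
    by (intro derivative_intros has_field_derivative_Ln[THEN DERIV_chain2] nz)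
  then show "((\<lambda>x. Ln (1 - x) + x) has_field_derivative (- x / (1 - x))) (at x within cball 0 m)"
    using \<open>1 - x \<noteq> 0\<close> by (elim DERIV_cong) (simp add: field_simps)
  have "1/4 \<le> cmod (1 - x)" using norm_triangle_ineq2[of 1 x] xm assms by simp
  then have "cmod x / cmod (1 - x) \<le> m / (1/4)" using xm by (intro frac_le) (auto intro: order_trans[OF norm_ge_zero])
  then show "cmod (- x / (1 - x)) \<le> 4 * m" by (simp add: norm_divide)
qed (use assms in auto)

text \<open>The added linear function cancels the first Taylor order of \<open>dF\<close> at the
  tip. What remains is of size |W|^2/|z|^4, and the stencil estimate in a disc of radius |Z|^2/4
  divides this by |Z|^8.\<close>

lemma lap_dF_tip:
  assumes Z: "Z \<in> cov" and z: "20 \<le> (cmod z)\<^sup>2" "cmod (z' - z) \<le> 1 / cmod z"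
    and tip: "5 * (cmod Z)\<^sup>2 \<le> (cmod z)\<^sup>2"
  shows "\<bar>lap (\<lambda>W. dF z z' W + (1 / (4 * pi)) * Re ((1 / z - 1 / z') * W)) Z\<bar>
     \<le> 100000 / (cmod z ^ 4 * cmod Z ^ 6)"
proof -
  define h where "h W = (Ln (1 - W / z') + W / z') - (Ln (1 - W / z) + W / z)" for W
  define u where "u W = dF z z' W + (1 / (4 * pi)) * Re ((1 / z - 1 / z') * W)" for W
  define d where "d = - (1 / (4 * pi)) * ln (cmod (z' / z))"
  have Z0: "Z \<noteq> 0" using cov_nonzero[OF Z] by simp
  have zpos: "0 < cmod z" using z(1) by (cases "z = 0") auto
  have zz: "1 / cmod z \<le> cmod z / 20"
    using z(1) zpos by (simp add: divide_simps power2_eq_square)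
  have z': "19 / 20 * cmod z \<le> cmod z'"
    using norm_triangle_ineq2[of z "z - z'"] z(2) zz by (simp add: norm_minus_commute)
  then have z'pos: "0 < cmod z'" using zpos by linarith
  have small: "cmod (W / z) \<le> 20/19 * (cmod W / cmod z) \<and> cmod (W / z') \<le> 20/19 * (cmod W / cmod z)
      \<and> 20/19 * (cmod W / cmod z) \<le> 3/4" if "cmod W \<le> 7/10 * cmod z" for W
  proof -
    define q where "q = cmod W / cmod z"
    have q: "q \<le> 7/10" "0 \<le> q" using that zpos by (simp_all add: q_def divide_simps)
    have "cmod W / cmod z' \<le> cmod W / (19/20 * cmod z)"
      using z' zpos z'pos by (intro divide_left_mono mult_pos_pos) auto
    also have "\<dots> = 20/19 * q" by (simp add: q_def)
    finally show ?thesis using q unfolding norm_divide q_def[symmetric] by simp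
  qed
  \<comment> \<open>One factor |W|/|z| comes from \<open>Ln_taylor_diff\<close>, and the distance
    between W/z' and W/z supplies |W|/|z|^3, because the two poles are at most 1/|z| apart.\<close>
  have hb: "cmod (h W) \<le> 5 * (cmod W)\<^sup>2 / cmod z ^ 4" if W: "cmod W \<le> 7/10 * cmod z" for W
  proof -
    define X where "X = 4 * (20/19 * (cmod W / cmod z))"
    have X: "0 \<le> X" by (simp add: X_def)
    have "cmod (h W) \<le> X * cmod (W / z' - W / z)"
      unfolding h_def X_def using small[OF W] by (intro Ln_taylor_diff) auto
    also have "\<dots> \<le> X * (cmod W * (20/19 / cmod z ^ 3))"
    proof (rule mult_left_mono[OF _ X])
      have "W / z' - W / z = W * ((z - z') / (z * z'))"
        using zpos z'pos by (auto simp: field_simps)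
      moreover have "cmod ((z - z') / (z * z')) \<le> (1 / cmod z) / (cmod z * (19/20 * cmod z))"
        unfolding norm_divide norm_mult using z z' zpos
        by (intro frac_le mult_left_mono mult_pos_pos) (auto simp: norm_minus_commute)
      moreover have "(1 / cmod z) / (cmod z * (19/20 * cmod z)) = 20/19 / cmod z ^ 3"
        using zpos by (simp add: power3_eq_cube)
      ultimately show "cmod (W / z' - W / z) \<le> cmod W * (20/19 / cmod z ^ 3)"
        by (simp only: norm_mult mult_left_mono norm_ge_zero)
    qed
    also have "\<dots> = (1600/361) * ((cmod W)\<^sup>2 / cmod z ^ 4)"
      using zpos by (simp add: X_def power2_eq_square power_numeral_reduce)
    also have "\<dots> \<le> 5 * ((cmod W)\<^sup>2 / cmod z ^ 4)" by (intro mult_right_mono) auto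
    finally show ?thesis by simp
  qed
  have nonpos: "1 - W / z \<notin> \<real>\<^sub>\<le>\<^sub>0 \<and> 1 - W / z' \<notin> \<real>\<^sub>\<le>\<^sub>0" if W: "cmod W \<le> 7/10 * cmod z" for W
    using one_plus_not_nonpos_Reals[of "- (W / z)"] one_plus_not_nonpos_Reals[of "- (W / z')"] small[OF W]
    by auto
  have u_eq: "u W = - (1 / (4 * pi)) * Re (h W) + d" if W: "cmod W \<le> 7/10 * cmod z" for W
  proof -
    have nz: "1 - W / z \<noteq> 0" "1 - W / z' \<noteq> 0" using nonpos[OF W] by auto
    have "z' - W = z' * (1 - W / z')" "z - W = z * (1 - W / z)"
      using zpos z'pos by (auto simp: algebra_simps)
    moreover have split: "ln (cmod (a * b)) = ln (cmod a) + Re (Ln b)" if "a \<noteq> 0" "b \<noteq> 0" for a b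
      using that by (simp add: norm_mult ln_mult)
    ultimately have "ln (cmod (z' - W)) = ln (cmod z') + Re (Ln (1 - W / z'))"
      "ln (cmod (z - W)) = ln (cmod z) + Re (Ln (1 - W / z))"
      using split nz zpos z'pos by simp_all
    moreover have lnq: "ln (cmod (z' / z)) = ln (cmod z') - ln (cmod z)"
      using zpos z'pos by (simp add: norm_divide ln_div)
    ultimately show ?thesis
      unfolding u_def dF_def Fundsol_def h_def d_def lnq
      by (simp add: algebra_simps diff_divide_distrib add_divide_distrib)
  qed
  have pi: "\<bar>- (1 / (4 * pi))\<bar> \<le> 1 / 12" using pi_gt3 by (simp add: divide_simps)
  have Zz: "cmod Z \<le> 9/20 * cmod z"
  proof -
    have "(9/20 * cmod z)\<^sup>2 = 81/400 * (cmod z)\<^sup>2" by (simp add: power2_eq_square)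
    then have "(cmod Z)\<^sup>2 \<le> (9/20 * cmod z)\<^sup>2"
      using tip zero_le_power2[of "cmod z"] by linarith
    then show ?thesis by (rule power2_le_imp_le) (use zpos in auto)
  qed
  have "\<bar>lap u Z\<bar> \<le> 100000 / (cmod z ^ 4 * cmod Z ^ 6)"
  \<comment> \<open>The stencil estimate needs a radius |Z|^2/4 of at least 2. Closer to the tip the
    powers of |Z| are bounded, and the pointwise bound for h suffices.\<close>
  proof (cases "8 \<le> (cmod Z)\<^sup>2")
    case True
    define U where "U = {W. cmod W \<le> 7/10 * cmod z}"
    define r where "r = (cmod Z)\<^sup>2 / 4"
    have W: "cmod (step y Z) \<le> 3/2 * cmod Z" if "cmod y \<le> (cmod Z)\<^sup>2 / 2" for y
    proof -
      have "cmod (step y Z - Z) \<le> ((cmod Z)\<^sup>2 / 2) / cmod Z"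
        using step_diff[OF Z0, of y] divide_right_mono[OF that, of "cmod Z"] by simp
      also have "\<dots> = cmod Z / 2" using Z0 by (simp add: power2_eq_square)
      finally show ?thesis using norm_triangle_ineq[of "step y Z - Z" Z] by simp
    qed
    have U: "step y Z \<in> U" if "cmod y < (cmod Z)\<^sup>2 / 2" for y
    proof -
      have "cmod (step y Z) \<le> 3/2 * cmod Z" using W that by simp
      then show ?thesis using Zz zpos unfolding U_def mem_Collect_eq by linarith
    qed
    have hol: "h holomorphic_on U"
      unfolding h_def U_def using zpos z'pos nonpos by (intro holomorphic_intros) auto
    have M: "cmod (h (step y Z)) \<le> 5 * (3/2 * cmod Z)\<^sup>2 / cmod z ^ 4" if "cmod y = r" for y
    proof -
      have y: "cmod y < (cmod Z)\<^sup>2 / 2" using that True by (simp add: r_def)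
      then have "cmod (h (step y Z)) \<le> 5 * (cmod (step y Z))\<^sup>2 / cmod z ^ 4"
        using U hb by (simp add: U_def)
      also have "\<dots> \<le> 5 * (3/2 * cmod Z)\<^sup>2 / cmod z ^ 4"
        using W y zpos by (intro divide_right_mono mult_left_mono power_mono) auto
      finally show ?thesis .
    qed
    have r: "2 \<le> r" "r < (cmod Z)\<^sup>2 / 2" "(cmod Z)\<^sup>2 / 2 \<le> (cmod Z)\<^sup>2" using True by (auto simp: r_def)
    have ueq: "u (step y Z) = - (1 / (4 * pi)) * Re (h (step y Z)) + d" if "cmod y \<le> 1" for y
      using u_eq U that True by (simp add: U_def)
    have "\<bar>lap u Z\<bar> \<le> \<bar>- (1 / (4 * pi))\<bar> * (8 * (5 * (3/2 * cmod Z)\<^sup>2 / cmod z ^ 4) / r ^ 4)"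
      by (rule lap_holomorphic(1)[OF Z0 hol U r M ueq])
    also have "\<dots> \<le> 1/12 * (8 * (5 * (3/2 * cmod Z)\<^sup>2 / cmod z ^ 4) / r ^ 4)"
      using r pi by (intro mult_right_mono) auto
    also have "\<dots> = 1920 / (cmod z ^ 4 * cmod Z ^ 6)"
      using Z0 zpos by (simp add: r_def power_divide power_mult_distrib field_simps flip: power_mult power_add)
    also have "\<dots> \<le> 100000 / (cmod z ^ 4 * cmod Z ^ 6)"
      by (intro divide_right_mono) auto
    finally show ?thesis .
  next
    case False
    have W: "\<bar>u W - d\<bar> \<le> 45 / (12 * cmod z ^ 4)" if "(cmod W)\<^sup>2 \<le> 9" for W
    proof -
      have "(7/10 * cmod z)\<^sup>2 = 49/100 * (cmod z)\<^sup>2" by (simp add: power2_eq_square)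
      then have "(cmod W)\<^sup>2 \<le> (7/10 * cmod z)\<^sup>2" using that z by linarith
      then have Wz: "cmod W \<le> 7/10 * cmod z" by (rule power2_le_imp_le) (use zpos in auto)
      have "\<bar>u W - d\<bar> = \<bar>- (1 / (4 * pi))\<bar> * \<bar>Re (h W)\<bar>" using u_eq[OF Wz] by (simp add: abs_mult)
      also have "\<dots> \<le> 1/12 * (5 * 9 / cmod z ^ 4)"
      proof (intro mult_mono pi)
        have "cmod (h W) \<le> 5 * (cmod W)\<^sup>2 / cmod z ^ 4" by (rule hb[OF Wz])
        also have "\<dots> \<le> 5 * 9 / cmod z ^ 4" using that by (intro divide_right_mono mult_left_mono) auto
        finally show "\<bar>Re (h W)\<bar> \<le> 5 * 9 / cmod z ^ 4" using abs_Re_le_cmod order_trans by blast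
      qed auto
      finally show ?thesis by simp
    qed
    have "\<bar>lap u Z\<bar> \<le> (\<Sum>\<rho>\<in>dirs. \<bar>u (step \<rho> Z) - u Z\<bar>)"
      unfolding lap_def by (rule sum_abs)
    also have "\<dots> \<le> (\<Sum>\<rho>\<in>dirs. 90 / (12 * cmod z ^ 4))"
    proof (rule sum_mono)
      fix \<rho> assume "\<rho> \<in> dirs"
      then have "(cmod (step \<rho> Z))\<^sup>2 \<le> 9" using step_norm[OF Z, of \<rho>] False by linarith
      then show "\<bar>u (step \<rho> Z) - u Z\<bar> \<le> 90 / (12 * cmod z ^ 4)"
        using W[of "step \<rho> Z"] W[of Z] False by linarith
    qed
    also have "\<dots> = 30 / cmod z ^ 4" by simp
    also have "\<dots> = 30 * cmod Z ^ 6 / (cmod z ^ 4 * cmod Z ^ 6)" using Z0 by simp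
    also have "\<dots> \<le> 100000 / (cmod z ^ 4 * cmod Z ^ 6)"
    proof (intro divide_right_mono)
      have "((cmod Z)\<^sup>2) ^ 3 \<le> 8 ^ 3" using False by (intro power_mono) auto
      then show "30 * cmod Z ^ 6 \<le> 100000" by (simp flip: power_mult)
    qed auto
    finally show ?thesis .
  qed
  then show ?thesis by (simp add: u_def[abs_def])
qed

section \<open>Discrete harmonic functions on the square lattice\<close>

definition gint :: "complex set" where
  "gint = {x. Re x \<in> \<int> \<and> Im x \<in> \<int>}"

definition gbox :: "nat \<Rightarrow> complex set" where
  "gbox n = {x \<in> gint. \<bar>Re x\<bar> \<le> real n \<and> \<bar>Im x\<bar> \<le> real n}"

definition flap :: "(complex \<Rightarrow> real) \<Rightarrow> complex \<Rightarrow> real" where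
  "flap f x = (\<Sum>\<rho>\<in>dirs. f (x + \<rho>) - f x)"

lemma gint_dirs: "\<rho> \<in> dirs \<Longrightarrow> \<rho> \<in> gint"
  by (auto simp: dirs_def gint_def)

lemma gint_add: "x \<in> gint \<Longrightarrow> y \<in> gint \<Longrightarrow> x + y \<in> gint"
  by (auto simp: gint_def)

lemma gint_norm_ge_1:
  assumes "x \<in> gint" "x \<noteq> 0"
  shows "1 \<le> cmod x"
proof -
  have "Re x \<noteq> 0 \<or> Im x \<noteq> 0" using assms(2) by (auto simp: complex_eq_iff)
  moreover have "1 \<le> \<bar>r\<bar>" if "r \<in> \<int>" "r \<noteq> 0" for r :: real
    using Ints_nonzero_abs_ge1 that by blast
  ultimately show ?thesis
    using assms abs_Re_le_cmod[of x] abs_Im_le_cmod[of x] unfolding gint_def by force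
qed

lemma box_image:
  "gbox n = (\<lambda>(a, b). Complex (of_int a) (of_int b)) ` ({- int n..int n} \<times> {- int n..int n})"
proof (intro equalityI subsetI)
  fix x assume "x \<in> gbox n"
  then obtain a b :: int where "Re x = of_int a" "Im x = of_int b" "\<bar>Re x\<bar> \<le> real n" "\<bar>Im x\<bar> \<le> real n"
    by (auto simp: gbox_def gint_def elim!: Ints_cases)
  then show "x \<in> (\<lambda>(a, b). Complex (of_int a) (of_int b)) ` ({- int n..int n} \<times> {- int n..int n})"
    by (intro image_eqI[of _ _ "(a, b)"]) (auto simp: complex_eq_iff)
next
  fix x assume "x \<in> (\<lambda>(a, b). Complex (of_int a) (of_int b)) ` ({- int n..int n} \<times> {- int n..int n})"
  then show "x \<in> gbox n" by (auto simp: gbox_def gint_def)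
qed

lemma finite_box [simp]: "finite (gbox n)"
  by (simp add: box_image)

lemma sum_box: "sum f (gbox n) = (\<Sum>a=-int n..int n. \<Sum>b=-int n..int n. f (Complex (of_int a) (of_int b)))"
  for f :: "complex \<Rightarrow> real"
  unfolding box_image sum.cartesian_product
  by (subst sum.reindex) (auto intro!: inj_onI simp: case_prod_unfold)

lemma card_box: "real (card (gbox n)) = (2 * real n + 1)\<^sup>2"
  using sum_box[of "\<lambda>_. 1" n] by (simp add: power2_eq_square)

lemma box_norm: "x \<in> gbox n \<Longrightarrow> cmod x \<le> 2 * real n"
  using cmod_le[of x] by (auto simp: gbox_def)

lemma not_box_norm: "x \<in> gint \<Longrightarrow> x \<notin> gbox n \<Longrightarrow> real n < cmod x"
  using abs_Re_le_cmod[of x] abs_Im_le_cmod[of x] by (auto simp: gbox_def)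

lemma box_add_dirs: "x \<in> gbox n \<Longrightarrow> \<rho> \<in> dirs \<Longrightarrow> x + \<rho> \<in> gbox (Suc n)"
  by (auto simp: gbox_def gint_def dirs_def)

lemma gint_sum_bounded:
  "\<exists>S>0. \<forall>F. finite F \<longrightarrow> F \<subseteq> gint \<longrightarrow> (\<Sum>x\<in>F. 1 / (1 + cmod x) ^ 3) \<le> S"
proof -
  obtain S where S: "0 < S" "\<And>F. finite F \<Longrightarrow> F \<subseteq> lattice \<Longrightarrow> (\<Sum>t\<in>F. cmod t powr (- 5/2)) \<le> S"
    using lattice_sum_bounded by blast
  define c where "c = Complex (1/2) (1/2)"
  have "(\<Sum>x\<in>F. 1 / (1 + cmod x) ^ 3) \<le> S" if F: "finite F" "F \<subseteq> gint" for F
  proof -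
    have lat: "x - c \<in> lattice" if "x \<in> gint" for x
      using that by (auto simp: lattice_iff gint_def c_def elim!: Ints_cases)
    have "1 / (1 + cmod x) ^ 3 \<le> cmod (x - c) powr (- 5/2)" if "x \<in> gint" for x
    proof -
      have "cmod c \<le> 1" using cmod_le[of c] by (simp add: c_def)
      then have "cmod (x - c) \<le> 1 + cmod x" using norm_triangle_ineq4[of x c] by linarith
      then have "(1 + cmod x) powr (- 5/2) \<le> cmod (x - c) powr (- 5/2)"
        using lattice_nonzero[OF lat[OF that]] by (intro powr_mono2') auto
      moreover have "(1 + cmod x) powr (- 3) \<le> (1 + cmod x) powr (- 5/2)"
        by (intro powr_mono) auto
      moreover have "(1 + cmod x) powr (- 3) = 1 / (1 + cmod x) ^ 3"
        by (simp add: powr_minus_divide add_pos_nonneg)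
      ultimately show ?thesis by linarith
    qed
    then have "(\<Sum>x\<in>F. 1 / (1 + cmod x) ^ 3) \<le> (\<Sum>x\<in>F. cmod (x - c) powr (- 5/2))"
      using F by (intro sum_mono) auto
    also have "\<dots> = (\<Sum>t\<in>(\<lambda>x. x - c) ` F. cmod t powr (- 5/2))"
      by (subst sum.reindex) (auto intro!: inj_onI)
    also have "\<dots> \<le> S" using F lat by (intro S) auto
    finally show ?thesis .
  qed
  with S show ?thesis by blast
qed

text \<open>\<open>- 2 Fundsol\<close> is only approximately a Green's function of the five-point Laplacian \<open>flap\<close> on
  the square lattice; \<open>psi\<close> is the defect.\<close>

definition psi :: "complex \<Rightarrow> real" where
  "psi x = (if x = 0 then 1 else 0) + 2 * flap Fundsol x"

text \<open>Away from the origin this is the stencil estimate for the logarithm in a disc of radius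
  |x|/2, where \<open>Ln (1 + y / x)\<close> is bounded by 1. For |x| < 4 a crude bound of the
  values is enough.\<close>

lemma psi_bound:
  assumes x: "x \<in> gint"
  shows "\<bar>psi x\<bar> \<le> 60000 / (1 + cmod x) ^ 4"
proof (cases "4 \<le> cmod x")
  case True
  define g where "g y = Ln (1 + y / x)" for y
  have x0: "x \<noteq> 0" using True by auto
  have small: "1 + y / x \<notin> \<real>\<^sub>\<le>\<^sub>0" if "cmod y < cmod x" for y
    using that x0 by (intro one_plus_not_nonpos_Reals) (simp add: norm_divide)
  have hol: "g holomorphic_on ball 0 (cmod x)"
    unfolding g_def using x0 small by (intro holomorphic_intros) auto
  have M: "cmod (g y) \<le> 1" if "cmod y = cmod x / 2" for y
    using norm_Ln_1p_le[of "y / x"] that x0 by (simp add: g_def norm_divide)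
  have F: "Fundsol (x + \<rho>) - Fundsol x = - (1 / (4 * pi)) * Re (g \<rho> - g 0)" if "\<rho> \<in> dirs" for \<rho>
  proof -
    have nz: "1 + \<rho> / x \<noteq> 0" using small[of \<rho>] norm_dirs[OF that] True by auto
    have "x + \<rho> = x * (1 + \<rho> / x)" using x0 by (simp add: algebra_simps)
    then have "ln (cmod (x + \<rho>)) = ln (cmod x) + Re (g \<rho>)"
      using nz x0 by (simp add: norm_mult ln_mult g_def)
    then show ?thesis by (simp add: Fundsol_def g_def algebra_simps)
  qed
  have "flap Fundsol x = (\<Sum>\<rho>\<in>dirs. - (1 / (4 * pi)) * Re (g \<rho> - g 0))"
    unfolding flap_def by (intro sum.cong refl F)
  also have "\<dots> = - (1 / (4 * pi)) * Re (\<Sum>\<rho>\<in>dirs. g \<rho> - g 0)"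
    by (simp only: sum_distrib_left[symmetric] Re_sum)
  finally have "psi x = - (1 / (2 * pi)) * Re (\<Sum>\<rho>\<in>dirs. g \<rho> - g 0)"
    using x0 by (simp add: psi_def)
  moreover have "cmod (\<Sum>\<rho>\<in>dirs. g \<rho> - g 0) \<le> 8 * 1 / (cmod x / 2) ^ 4"
    using True by (intro holomorphic_stencil(1)[OF hol _ _ M]) auto
  then have "\<bar>Re (\<Sum>\<rho>\<in>dirs. g \<rho> - g 0)\<bar> \<le> 128 / cmod x ^ 4"
    using abs_Re_le_cmod[of "\<Sum>\<rho>\<in>dirs. g \<rho> - g 0"] by (simp add: power_divide)
  moreover have "\<bar>- (1 / (2 * pi))\<bar> \<le> 1" using pi_gt3 by (simp add: divide_simps)
  ultimately have "\<bar>psi x\<bar> \<le> 1 * (128 / cmod x ^ 4)"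
    by (simp only: abs_mult) (intro mult_mono, auto)
  also have "\<dots> \<le> 128 / ((1 + cmod x) / 2) ^ 4"
    using True x0 by (simp only: mult_1) (intro divide_left_mono power_mono mult_pos_pos zero_less_power, auto)
  also have "\<dots> \<le> 60000 / (1 + cmod x) ^ 4"
    by (simp add: power_divide divide_right_mono)
  finally show ?thesis .
next
  case False
  \<comment> \<open>At y = 0 the default \<open>ln 0 = 0\<close> gives \<open>Fundsol 0 = 0\<close>,
    so the bound includes the pole.\<close>
  have F: "\<bar>Fundsol y\<bar> \<le> 5" if "y \<in> gint" "cmod y \<le> 5" for y
  proof (cases "y = 0")
    case False
    then have "1 \<le> cmod y" using gint_norm_ge_1 that by simp
    then have "0 \<le> ln (cmod y)" "ln (cmod y) \<le> 5" using ln_le_minus_one[of "cmod y"] that False by auto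
    moreover have "1 / (4 * pi) \<le> 1" using pi_gt3 by (simp add: divide_simps)
    ultimately have "1 / (4 * pi) * ln (cmod y) \<le> 1 * 5" by (intro mult_mono) auto
    then show ?thesis using \<open>0 \<le> ln (cmod y)\<close> by (simp add: Fundsol_def)
  qed (simp add: Fundsol_def)
  have "\<bar>flap Fundsol x\<bar> \<le> (\<Sum>\<rho>\<in>dirs. \<bar>Fundsol (x + \<rho>) - Fundsol x\<bar>)"
    unfolding flap_def by (rule sum_abs)
  also have "\<dots> \<le> (\<Sum>\<rho>\<in>dirs. 10)"
  proof (rule sum_mono)
    fix \<rho> assume \<rho>: "\<rho> \<in> dirs"
    then have "cmod (x + \<rho>) \<le> 5" using norm_triangle_ineq[of x \<rho>] norm_dirs[OF \<rho>] False by simp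
    then have "\<bar>Fundsol (x + \<rho>)\<bar> \<le> 5" using F gint_add x gint_dirs[OF \<rho>] by blast
    moreover have "\<bar>Fundsol x\<bar> \<le> 5" using F x False by simp
    ultimately show "\<bar>Fundsol (x + \<rho>) - Fundsol x\<bar> \<le> 10" by linarith
  qed
  finally have "\<bar>psi x\<bar> \<le> 81" by (auto simp: psi_def abs_le_iff)
  moreover have "(1 + cmod x) ^ 4 \<le> 5 ^ 4" using False by (intro power_mono) auto
  then have "60000 / 625 \<le> 60000 / (1 + cmod x) ^ 4"
    using norm_ge_zero[of x] by (intro divide_left_mono mult_pos_pos zero_less_power add_pos_nonneg) auto
  ultimately show ?thesis by simp
qed

text \<open>A discrete Cauchy-Riemann equation: the horizontal difference of log |w| and the
  vertical difference of arg w both have leading term Re (1/w). Subtracting h/w in \<open>q\<close>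
  leaves an error of order |w|^-2. It turns the flux through a side of a box into a telescoping sum
  of angles.\<close>

lemma Ln_cross_diff:
  assumes w: "1 \<le> Re w"
  shows "\<bar>Re (Ln (w + 1/2)) - Re (Ln (w - 1/2)) - (Im (Ln (w + \<i>/2)) - Im (Ln (w - \<i>/2)))\<bar> \<le> 2 / (cmod w)\<^sup>2"
proof -
  define q where "q h = Ln (w + h) - h / w" for h
  have w1: "1 \<le> cmod w" using w complex_Re_le_cmod[of w] by linarith
  have q: "cmod (q h - q h') \<le> 1 / (cmod w)\<^sup>2 * cmod (h - h')" if "cmod h \<le> 1/2" "cmod h' \<le> 1/2" for h h'
  proof (rule field_differentiable_bound[where S = "cball 0 (1/2)"])
    fix x :: complex assume "x \<in> cball 0 (1/2)"
    then have x: "cmod x \<le> 1/2" by simp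
    have Re: "0 < Re (w + x)" using w abs_Re_le_cmod[of x] x by simp
    have nz: "w + x \<noteq> 0" "w \<noteq> 0" using Re w by (metis less_irrefl zero_complex.simps(1), force)
    have np: "w + x \<notin> \<real>\<^sub>\<le>\<^sub>0" using Re by (auto simp: complex_nonpos_Reals_iff)
    have "(q has_field_derivative (inverse (w + x) * (0 + 1) - 1 / w)) (at x within cball 0 (1/2))"
      unfolding q_def by (intro DERIV_cdivide derivative_intros has_field_derivative_Ln[THEN DERIV_chain2] np)
    moreover have "inverse (w + x) * (0 + 1) - 1 / w = - x / (w * (w + x))"
      using nz by (simp add: field_simps)
    ultimately show "(q has_field_derivative (- x / (w * (w + x)))) (at x within cball 0 (1/2))" by simp
    have "cmod w / 2 \<le> cmod (w + x)" using norm_triangle_ineq4[of "w + x" x] x w1 by simp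
    then have "cmod x / (cmod w * cmod (w + x)) \<le> (1/2) / (cmod w * (cmod w / 2))"
      using x w1 by (intro frac_le mult_left_mono mult_pos_pos) auto
    then show "cmod (- x / (w * (w + x))) \<le> 1 / (cmod w)\<^sup>2"
      by (simp add: norm_divide norm_mult power2_eq_square)
  qed (use that in auto)
  have "\<bar>Re (q (1/2) - q (- 1/2))\<bar> \<le> 1 / (cmod w)\<^sup>2"
    using order_trans[OF abs_Re_le_cmod q[of "1/2" "- 1/2"]] by (simp add: norm_divide)
  moreover have "\<bar>Im (q (\<i>/2) - q (- \<i>/2))\<bar> \<le> 1 / (cmod w)\<^sup>2"
    using order_trans[OF abs_Im_le_cmod q[of "\<i>/2" "- \<i>/2"]] by (simp add: norm_divide)
  moreover have "Re (q (1/2) - q (- 1/2)) = Re (Ln (w + 1/2)) - Re (Ln (w - 1/2)) - Re (1 / w)"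
    by (simp add: q_def Re_divide)
  moreover have "Im (q (\<i>/2) - q (- \<i>/2)) = Im (Ln (w + \<i>/2)) - Im (Ln (w - \<i>/2)) - Re (1 / w)"
    by (simp add: q_def Re_divide Im_divide)
  ultimately show ?thesis by (simp add: abs_le_iff)
qed

lemma sum_telescope_int:
  fixes f :: "int \<Rightarrow> real"
  shows "(\<Sum>a=- int n..int n. f (a + 1) - f a) = f (int n + 1) - f (- int n)"
proof (induction n)
  case (Suc n)
  have "{- int (Suc n)..int (Suc n)} = insert (- 1 - int n) (insert (int n + 1) {- int n..int n})" by auto
  then show ?case using Suc by (simp add: algebra_simps)
qed simp

text \<open>The discrete divergence theorem: interior bonds cancel, and the reflection and diagonal
  symmetries of |x| identify the flux through the four sides.\<close>

lemma sum_flap_Fundsol_box: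
  "sum (flap Fundsol) (gbox n) =
     4 * (\<Sum>b=- int n..int n. Fundsol (Complex (real n + 1) (of_int b)) - Fundsol (Complex (real n) (of_int b)))"
proof -
  define F where "F a b = Fundsol (Complex (of_int a) (of_int b))" for a b :: int
  have sym: "F (- a) b = F a b" "F a b = F b a" for a b
    by (simp_all add: F_def Fundsol_def cmod_def add.commute)
  have E: "(\<Sum>a=- int n..int n. F (a + 1) b - F a b) = F (int n + 1) b - F (int n) b" for b
    using sum_telescope_int[of "\<lambda>a. F a b" n] sym by simp
  have W: "(\<Sum>a=- int n..int n. F (a - 1) b - F a b) = F (int n + 1) b - F (int n) b" for b
  proof -
    have "(\<Sum>a=- int n..int n. F (a - 1) b - F a b) = - (\<Sum>a=- int n..int n. F (a + 1 - 1) b - F (a - 1) b)"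
      by (simp add: sum_subtractf)
    also have "\<dots> = - (F (int n) b - F (- int n - 1) b)"
      using sum_telescope_int[of "\<lambda>a. F (a - 1) b" n] by simp
    finally show ?thesis using sym(1)[of "int n + 1" b] by simp
  qed
  have "flap Fundsol (Complex (of_int a) (of_int b)) =
    (F (a + 1) b - F a b) + (F (a - 1) b - F a b) + ((F (b + 1) a - F b a) + (F (b - 1) a - F b a))" for a b
  proof -
    have nb: "Complex (of_int a) (of_int b) + 1 = Complex (of_int (a + 1)) (of_int b)"
      "Complex (of_int a) (of_int b) + \<i> = Complex (of_int a) (of_int (b + 1))"
      "Complex (of_int a) (of_int b) + - 1 = Complex (of_int (a - 1)) (of_int b)"
      "Complex (of_int a) (of_int b) + - \<i> = Complex (of_int a) (of_int (b - 1))"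
      by (simp_all add: complex_eq_iff)
    have "flap Fundsol (Complex (of_int a) (of_int b)) =
      (F (a + 1) b - F a b) + (F a (b + 1) - F a b) + (F (a - 1) b - F a b) + (F a (b - 1) - F a b)"
      by (simp only: flap_def sum_dirs nb F_def)
    then show ?thesis using sym(2)[of a "b + 1"] sym(2)[of a "b - 1"] sym(2)[of a b] by simp
  qed
  then have "sum (flap Fundsol) (gbox n) =
     (\<Sum>b=- int n..int n. \<Sum>a=- int n..int n. (F (a + 1) b - F a b) + (F (a - 1) b - F a b)) +
     (\<Sum>a=- int n..int n. \<Sum>b=- int n..int n. (F (b + 1) a - F b a) + (F (b - 1) a - F b a))"
    by (simp only: sum_box sum.distrib[of "\<lambda>b. _ b + _ b"] sum.distrib)
       (subst sum.swap, subst (2) sum.swap, simp)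
  also have "\<dots> = 4 * (\<Sum>b=- int n..int n. F (int n + 1) b - F (int n) b)"
    by (simp only: sum.distrib E W)
  finally show ?thesis by (simp add: F_def)
qed

text \<open>Seen from the origin each side of the box spans the angle pi/2. The total flux is thus 4
  times -(1/(4 pi)) (pi/2) = -1/2, twice which cancels the unit mass of \<open>psi\<close>. The 2n +
  1 errors of size 2/n^2 give the rate 1/n.\<close>

lemma psi_box_sum:
  assumes n: "1 \<le> n"
  shows "\<bar>sum psi (gbox n)\<bar> \<le> 24 / real n"
proof -
  \<comment> \<open>The midpoints of the bonds that leave the box through its right side.\<close>
  define w where "w b = Complex (real n + 1/2) (of_int b)" for b :: int
  define A where "A b = Im (Ln (w b - \<i>/2))" for b
  have w_norm: "real n \<le> cmod (w b)" for b
    using complex_Re_le_cmod[of "w b"] by (simp add: w_def)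
  have w_shift: "w b + \<i>/2 = w (b + 1) - \<i>/2" for b by (simp add: w_def complex_eq_iff)
  have F: "Fundsol (Complex (real n + 1) (of_int b)) - Fundsol (Complex (real n) (of_int b))
    = - (1 / (4 * pi)) * (Re (Ln (w b + 1/2)) - Re (Ln (w b - 1/2)))" for b
  proof -
    have "w b + 1/2 = Complex (real n + 1) (of_int b)" "w b - 1/2 = Complex (real n) (of_int b)"
      by (simp_all add: w_def complex_eq_iff)
    moreover have "Complex (real n + 1) (of_int b) \<noteq> 0" "Complex (real n) (of_int b) \<noteq> 0"
      using n by (simp_all add: complex_eq_iff)
    ultimately show ?thesis by (simp add: Fundsol_def algebra_simps)
  qed
  define d where "d b = (Re (Ln (w b + 1/2)) - Re (Ln (w b - 1/2))) - (A (b + 1) - A b)" for b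
  have d: "\<bar>d b\<bar> \<le> 2 / (real n)\<^sup>2" for b
  proof -
    have "\<bar>d b\<bar> \<le> 2 / (cmod (w b))\<^sup>2"
    proof -
      have "1 \<le> Re (w b)" using n by (simp add: w_def)
      from Ln_cross_diff[OF this] show ?thesis unfolding d_def A_def w_shift .
    qed
    also have "\<dots> \<le> 2 / (real n)\<^sup>2"
      using w_norm[of b] n by (intro divide_left_mono power_mono mult_pos_pos) auto
    finally show ?thesis .
  qed
  have "(\<Sum>b=- int n..int n. A (b + 1) - A b) = A (int n + 1) - A (- int n)"
    by (rule sum_telescope_int)
  also have "\<dots> = pi / 2"
  proof -
    have eqs: "w (int n + 1) - \<i>/2 = Complex (real n + 1/2) (real n + 1/2)"
      "w (- int n) - \<i>/2 = Complex (real n + 1/2) (- (real n + 1/2))"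
      by (simp_all add: w_def complex_eq_iff)
    have lnP: "Im (Ln (Complex x x)) = pi / 4" "Im (Ln (Complex x (- x))) = - (pi / 4)" if "0 < x" for x
      using that by (simp_all add: Arg_eq_Im_Ln[symmetric] arg_conv_arctan complex_eq_iff arctan_minus arctan_one)
    have pos: "0 < real n + 1/2" by simp
    show ?thesis by (simp only: A_def eqs lnP[OF pos])
  qed
  finally have sumA: "(\<Sum>b=- int n..int n. A (b + 1) - A b) = pi / 2" .
  have "(\<Sum>b=- int n..int n. Re (Ln (w b + 1/2)) - Re (Ln (w b - 1/2))) = pi / 2 + (\<Sum>b=- int n..int n. d b)"
    unfolding sumA[symmetric] by (simp add: d_def sum.distrib[symmetric])
  then have "sum (flap Fundsol) (gbox n) = 4 * (- (1 / (4 * pi)) * (pi / 2 + (\<Sum>b=- int n..int n. d b)))"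
    unfolding sum_flap_Fundsol_box F by (simp only: sum_distrib_left[symmetric])
  moreover have "0 \<in> gbox n" by (simp add: gbox_def gint_def)
  then have "sum psi (gbox n) = 1 + 2 * sum (flap Fundsol) (gbox n)"
    by (simp add: psi_def sum.distrib sum_distrib_left)
  ultimately have "sum psi (gbox n) = - (2 / pi) * (\<Sum>b=- int n..int n. d b)"
    by (simp add: field_simps)
  moreover have "\<bar>\<Sum>b=- int n..int n. d b\<bar> \<le> 6 / real n"
  proof -
    have "\<bar>\<Sum>b=- int n..int n. d b\<bar> \<le> (\<Sum>b=- int n..int n. 2 / (real n)\<^sup>2)"
      using d by (intro order_trans[OF sum_abs sum_mono]) auto
    also have "\<dots> = (2 * real n + 1) * 2 / (real n)\<^sup>2" by simp
    also have "\<dots> \<le> 6 * real n / (real n)\<^sup>2" using n by (intro divide_right_mono) auto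
    also have "\<dots> = 6 / real n" by (simp add: power2_eq_square)
    finally show ?thesis .
  qed
  moreover have "\<bar>- (2 / pi)\<bar> \<le> 1" using pi_gt3 by (simp add: divide_simps)
  ultimately have "\<bar>sum psi (gbox n)\<bar> \<le> 1 * (6 / real n)"
    by (simp only: abs_mult) (intro mult_mono, auto)
  also have "\<dots> \<le> 24 / real n" by (simp add: divide_right_mono)
  finally show ?thesis .
qed

text \<open>A barrier argument. Antisymmetrising k about the line Re x = 1/2 yields a discrete
  harmonic function w with \<open>w 1 = k 1 - k 0\<close> that changes sign under reflection. A
  superharmonic b dominating w on the boundary of a half box then dominates it at 1, where b is of
  order M/n.\<close>

lemma harmonic_gradient_1:
  assumes n: "1 \<le> n" and M: "0 < M"
    and harm: "\<And>x. x \<in> gbox n \<Longrightarrow> flap k x = 0"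
    and bound: "\<And>x. x \<in> gbox (Suc n) \<Longrightarrow> \<bar>k x\<bar> \<le> M"
  shows "k 1 - k 0 \<le> 6 * M / real n"
proof -
  define w where "w x = k x - k (1 - cnj x)" for x
  \<comment> \<open>The linear term is large on the right side and the \<open>Im\<close> term on the
    top and bottom sides. The quadratic term in \<open>Re\<close> makes b strictly superharmonic and
    keeps 4u - 2u^2 = 2u(2 - u) above 1 for 1 <= u <= 3/2. The term 1/n compensates the quadratic
    term next to the reflection line.\<close>
  define b where "b x = 2 * M * (4 * (Re x - 1/2) / real n - 2 * (Re x - 1/2)\<^sup>2 / (real n)\<^sup>2
      + (Im x)\<^sup>2 / (real n)\<^sup>2 + 1 / real n)" for x
  define \<Omega> where "\<Omega> = {x \<in> gbox n. 1 \<le> Re x}"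
  have n0: "0 < real n" using n by simp
  have fin: "finite \<Omega>" by (simp add: \<Omega>_def)
  have one: "1 \<in> \<Omega>" using n by (simp add: \<Omega>_def gbox_def gint_def)
  have refl: "1 - cnj x \<in> gbox n" if "x \<in> \<Omega>" for x
    using that by (auto simp: \<Omega>_def gbox_def gint_def)
  have flap_w: "flap w x = 0" if "x \<in> \<Omega>" for x
  proof -
    have "flap k (1 - cnj x) = (\<Sum>\<rho>\<in>dirs. k (1 - cnj x + \<rho>) - k (1 - cnj x))" by (simp add: flap_def)
    also have "\<dots> = (\<Sum>\<rho>\<in>dirs. k (1 - cnj (x + \<rho>)) - k (1 - cnj x))"
      by (simp add: sum_dirs algebra_simps)
    finally have "flap w x = flap k x - flap k (1 - cnj x)"
      by (simp add: flap_def w_def sum_subtractf)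
    then show ?thesis using harm refl[OF that] that by (simp add: \<Omega>_def)
  qed
  have flap_b: "flap b x < 0" for x
  proof -
    have "flap b x = 2 * M * (- 4 / (real n)\<^sup>2 + 2 / (real n)\<^sup>2)"
      using n0 by (simp add: flap_def sum_dirs b_def power2_eq_square field_simps)
    also have "\<dots> < 0" using M n0 by (intro mult_pos_neg) (auto simp: divide_simps)
    finally show ?thesis .
  qed
  define d where "d x = w x - b x" for x
  obtain p where p: "p \<in> \<Omega>" "\<And>x. x \<in> \<Omega> \<Longrightarrow> d x \<le> d p"
  proof -
    have "Max (d ` \<Omega>) \<in> d ` \<Omega>" using fin one by (intro Max_in) auto
    then obtain p where "p \<in> \<Omega>" "Max (d ` \<Omega>) = d p" by blast
    moreover have "d x \<le> Max (d ` \<Omega>)" if "x \<in> \<Omega>" for x using fin that by simp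
    ultimately show ?thesis using that by simp
  qed
  have w_le: "w x \<le> 2 * M" if "x \<in> gbox (Suc n)" "1 - cnj x \<in> gbox (Suc n)" for x
    using bound[OF that(1)] bound[OF that(2)] by (simp add: w_def)
  have "d p \<le> 0"
  proof (rule ccontr)
    assume pos: "\<not> d p \<le> 0"
    have "d (p + \<rho>) \<le> d p" if \<rho>: "\<rho> \<in> dirs" for \<rho>
    proof (cases "p + \<rho> \<in> \<Omega>")
      case True then show ?thesis using p by simp
    next
      case out: False
      define q where "q = p + \<rho>"
      have pO: "p \<in> gbox n" "1 \<le> Re p" using p by (auto simp: \<Omega>_def)
      have qg: "q \<in> gbox (Suc n)" unfolding q_def using box_add_dirs[OF pO(1) \<rho>] .
      show ?thesis
      proof (cases "1 \<le> Re q")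
        case True
        then have qb: "q \<notin> gbox n" using out by (simp add: \<Omega>_def q_def)
        have q2: "1 - cnj q \<in> gbox (Suc n)"
          using qg True by (auto simp: gbox_def gint_def)
        define u where "u = (Re q - 1/2) / real n"
        define v where "v = (Im q)\<^sup>2 / (real n)\<^sup>2"
        have b_eq: "b q = 2 * M * (4 * u - 2 * u\<^sup>2 + v + 1 / real n)"
          by (simp add: b_def u_def v_def power_divide)
        have u: "0 \<le> u" "u \<le> 3/2"
          using True qg n n0 by (auto simp: u_def gbox_def divide_simps)
        have "1 \<le> u \<or> 1 \<le> v"
        proof -
          have "real n < \<bar>Re q\<bar> \<or> real n < \<bar>Im q\<bar>" using qb qg by (auto simp: gbox_def)
          moreover have int: "real n + 1 \<le> \<bar>r\<bar>" if "r \<in> \<int>" "real n < \<bar>r\<bar>" for r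
          proof -
            obtain i :: int where "r = of_int i" using \<open>r \<in> \<int>\<close> by (auto elim: Ints_cases)
            then have "int n < \<bar>i\<bar>" using that(2) by linarith
            then show ?thesis using \<open>r = of_int i\<close> by linarith
          qed
          ultimately have "real n + 1 \<le> Re q \<or> real n \<le> \<bar>Im q\<bar>"
            using qg True int[of "Re q"] by (auto simp: gbox_def gint_def)
          then show ?thesis
          proof
            assume "real n + 1 \<le> Re q" then show ?thesis using n0 by (simp add: u_def divide_simps)
          next
            assume "real n \<le> \<bar>Im q\<bar>"
            then have "(real n)\<^sup>2 \<le> (Im q)\<^sup>2" by (metis power2_abs power_mono of_nat_0_le_iff)
            then show ?thesis using n0 by (simp add: v_def divide_simps)
          qed
        qed
        moreover have "0 \<le> v" "0 \<le> 1 / real n" by (auto simp: v_def)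
        moreover have "4 * u - 2 * u\<^sup>2 = 2 * u * (2 - u)" by (simp add: power2_eq_square algebra_simps)
        moreover have "0 \<le> 2 * u * (2 - u)" using u by (intro mult_nonneg_nonneg) auto
        moreover have "1 \<le> u \<Longrightarrow> 2 * 1 * (1/2) \<le> 2 * u * (2 - u)" using u by (intro mult_mono) auto
        ultimately have "1 \<le> 4 * u - 2 * u\<^sup>2 + v + 1 / real n" by linarith
        then have "2 * M * 1 \<le> b q" unfolding b_eq using M by (intro mult_left_mono) auto
        then have "d q \<le> 0" using w_le[OF qg q2] by (simp add: d_def)
        then show ?thesis using pos by (simp add: q_def)
      next
        case False
        have "Re p = 1 \<and> \<rho> = - 1"
        proof -
          have "\<rho> = - 1" using False pO \<rho> by (auto simp: q_def dirs_def)
          moreover obtain i :: int where "Re p = of_int i"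
            using pO by (auto simp: gbox_def gint_def elim: Ints_cases)
          ultimately show ?thesis using False pO by (auto simp: q_def)
        qed
        then have q: "1 - cnj q = p" "1 - cnj p = q" "Re p = 1" "Re q = 0" "Im q = Im p"
          by (auto simp: q_def complex_eq_iff)
        \<comment> \<open>A neighbour across the line is the mirror image of p itself, so only the
          sum of b over the mirror pair matters. The linear terms cancel there, and 2/n outweighs
          1/n^2.\<close>
        have bpq: "b p + b q = 2 * M * (2 * ((Im p)\<^sup>2 / (real n)\<^sup>2) + (2 / real n - 1 / (real n)\<^sup>2))"
          by (simp add: b_def q algebra_simps power2_eq_square)
        have "1 / (real n)\<^sup>2 \<le> 1 / real n"
          using n by (intro divide_left_mono) (auto simp: power2_eq_square)
        moreover have "0 \<le> 1 / real n" "2 / real n = 1 / real n + 1 / real n" by simp_all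
        ultimately have nn: "0 \<le> 2 / real n - 1 / (real n)\<^sup>2" by linarith
        have "0 \<le> b p + b q"
          unfolding bpq using M nn by (intro mult_nonneg_nonneg add_nonneg_nonneg) auto
        moreover have "w q = - w p" by (simp add: w_def q)
        ultimately have "d q \<le> - d p" by (simp add: d_def)
        then show ?thesis using pos by (simp add: q_def)
      qed
    qed
    then have "flap d p \<le> 0" unfolding flap_def by (intro sum_nonpos) simp
    moreover have "flap d p = flap w p - flap b p" by (simp add: flap_def d_def sum_subtractf)
    ultimately show False using flap_w[OF p(1)] flap_b[of p] by simp
  qed
  then have "d 1 \<le> 0" using p(2)[OF one] by linarith
  then have "k 1 - k 0 \<le> b 1" by (simp add: d_def w_def)
  also have "b 1 \<le> 6 * M / real n"
  proof -
    have "b 1 = 6 * M / real n - 2 * M * (1/2 / (real n)\<^sup>2)" by (simp add: b_def power2_eq_square field_simps)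
    then show ?thesis using M by simp
  qed
  finally show ?thesis .
qed

text \<open>Multiplication by \<rho> is a rotation of the lattice that preserves the box and the
  Laplacian, and changing the sign of k gives the opposite inequality.\<close>

lemma harmonic_gradient:
  assumes n: "1 \<le> n" and M: "0 < M"
    and harm: "\<And>x. x \<in> gbox n \<Longrightarrow> flap k x = 0"
    and bound: "\<And>x. x \<in> gbox (Suc n) \<Longrightarrow> \<bar>k x\<bar> \<le> M"
    and \<rho>: "\<rho> \<in> dirs"
  shows "\<bar>k \<rho> - k 0\<bar> \<le> 6 * M / real n"
proof -
  have rot: "\<rho> * x \<in> gbox m" if "x \<in> gbox m" for x m
    using that \<rho> by (auto simp: gbox_def gint_def dirs_def)
  have flap_rot: "flap (\<lambda>x. c * k (\<rho> * x)) x = c * flap k (\<rho> * x)" for c x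
  proof -
    have "(\<Sum>\<sigma>\<in>dirs. k (\<rho> * x + \<rho> * \<sigma>)) = (\<Sum>\<sigma>\<in>dirs. k (\<rho> * x + \<sigma>))"
    proof (rule sum.reindex_bij_witness[of _ "\<lambda>\<sigma>. cnj \<rho> * \<sigma>" "\<lambda>\<sigma>. \<rho> * \<sigma>"])
      have "cnj \<rho> * \<rho> = 1" using \<rho> by (auto simp: dirs_def)
      then show "cnj \<rho> * (\<rho> * \<sigma>) = \<sigma>" "\<rho> * (cnj \<rho> * \<sigma>) = \<sigma>" for \<sigma>
        by (metis mult.assoc mult.commute mult_1)+
    qed (use \<rho> in \<open>auto simp: dirs_def\<close>)
    then show ?thesis by (simp add: flap_def sum_subtractf sum_distrib_left[symmetric] distrib_left right_diff_distrib)
  qed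
  have "c * k (\<rho> * 1) - c * k (\<rho> * 0) \<le> 6 * M / real n" if "\<bar>c\<bar> = 1" for c
  proof (rule harmonic_gradient_1[OF n M])
    show "flap (\<lambda>x. c * k (\<rho> * x)) x = 0" if "x \<in> gbox n" for x
      using harm rot[OF that] by (simp add: flap_rot)
    show "\<bar>c * k (\<rho> * x)\<bar> \<le> M" if "x \<in> gbox (Suc n)" for x
      using bound[OF rot[OF that]] \<open>\<bar>c\<bar> = 1\<close> by (simp add: abs_mult)
  qed
  from this[of 1] this[of "-1"] show ?thesis by simp
qed

section \<open>Testing with the truncated predictor\<close>

definition cutN :: "real \<Rightarrow> complex \<Rightarrow> real" where
  "cutN N Z = max 0 (min 1 (2 - (cmod Z)\<^sup>2 / N))"

lemma cutN_range: "0 \<le> cutN N Z" "cutN N Z \<le> 1"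
  by (simp_all add: cutN_def)

lemma cutN_eq_1: "0 < N \<Longrightarrow> (cmod Z)\<^sup>2 \<le> N \<Longrightarrow> cutN N Z = 1"
  by (simp add: cutN_def divide_simps)

lemma cutN_eq_0: "0 < N \<Longrightarrow> 2 * N \<le> (cmod Z)\<^sup>2 \<Longrightarrow> cutN N Z = 0"
  by (simp add: cutN_def divide_simps)

lemma cutN_sheet: "cutN N (sheet Z) = cutN N Z"
  by (simp add: cutN_def)

text \<open>The ramp is linear in |Z|^2 and not in |Z|, because |Z|^2 is what a step changes by at
  most 1.\<close>

lemma cutN_step:
  assumes "0 < N" "Z \<in> cov" "\<rho> \<in> dirs"
  shows "\<bar>cutN N (step \<rho> Z) - cutN N Z\<bar> \<le> 1 / N"
proof -
  define a b where "a = (cmod (step \<rho> Z))\<^sup>2 / N" and "b = (cmod Z)\<^sup>2 / N"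
  have "\<bar>a - b\<bar> = \<bar>(cmod (step \<rho> Z))\<^sup>2 - (cmod Z)\<^sup>2\<bar> / N"
    using assms(1) by (simp add: a_def b_def diff_divide_distrib[symmetric])
  also have "\<dots> \<le> 1 / N"
    using step_norm[OF assms(2,3)] assms(1) by (intro divide_right_mono) auto
  finally have "\<bar>a - b\<bar> \<le> 1 / N" .
  moreover have "cutN N (step \<rho> Z) = max 0 (min 1 (2 - a))" "cutN N Z = max 0 (min 1 (2 - b))"
    by (simp_all add: cutN_def a_def b_def)
  moreover have "\<bar>max 0 (min 1 (2 - a)) - max 0 (min 1 (2 - b))\<bar> \<le> \<bar>a - b\<bar>"
    by (auto simp: max_def min_def)
  ultimately show ?thesis by simp
qed

lemma cutN_step_zero:
  assumes N: "0 < N" and Z: "Z \<in> cov" and \<rho>: "\<rho> \<in> dirs"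
    and out: "(cmod Z)\<^sup>2 < N - 1 \<or> 2 * N + 1 < (cmod Z)\<^sup>2"
  shows "cutN N (step \<rho> Z) - cutN N Z = 0"
  using step_norm[OF Z \<rho>] out N cutN_eq_0[OF N, of Z] cutN_eq_0[OF N, of "step \<rho> Z"]
    cutN_eq_1[OF N, of Z] cutN_eq_1[OF N, of "step \<rho> Z"] by linarith

lemma covball_subset: "covball M \<subseteq> cov"
  by (auto simp: covball_def)

text \<open>After symmetrisation each bond carries 1/N times a quantity of order u v |Z|^-4. To
  reach the summable exponent 5 one factor |Z| is bounded by B on the ramp, so the commutator costs
  B/N in total.\<close>

lemma cutN_commutator:
  fixes f k :: "complex \<Rightarrow> real"
  assumes N: "0 < N" and M: "2 * N + 1 \<le> M" and B: "0 \<le> B" "2 * N + 1 \<le> B\<^sup>2"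
    and S: "\<And>F. finite F \<Longrightarrow> F \<subseteq> cov \<Longrightarrow> (\<Sum>Z\<in>F. 1 / cmod Z ^ 5) \<le> S"
    and uv: "0 \<le> u" "0 \<le> v"
    and f: "\<And>Z. Z \<in> cov \<Longrightarrow> N - 1 \<le> (cmod Z)\<^sup>2 \<Longrightarrow> (cmod Z)\<^sup>2 \<le> 2 * N + 1 \<Longrightarrow> \<bar>f Z\<bar> \<le> u / cmod Z"
    and f': "\<And>Z \<rho>. Z \<in> cov \<Longrightarrow> \<rho> \<in> dirs \<Longrightarrow> N - 1 \<le> (cmod Z)\<^sup>2 \<Longrightarrow> (cmod Z)\<^sup>2 \<le> 2 * N + 1
      \<Longrightarrow> \<bar>f (step \<rho> Z) - f Z\<bar> \<le> u / cmod Z ^ 3"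
    and k: "\<And>Z. Z \<in> cov \<Longrightarrow> N - 1 \<le> (cmod Z)\<^sup>2 \<Longrightarrow> (cmod Z)\<^sup>2 \<le> 2 * N + 1 \<Longrightarrow> \<bar>k Z\<bar> \<le> v / cmod Z"
    and k': "\<And>Z \<rho>. Z \<in> cov \<Longrightarrow> \<rho> \<in> dirs \<Longrightarrow> N - 1 \<le> (cmod Z)\<^sup>2 \<Longrightarrow> (cmod Z)\<^sup>2 \<le> 2 * N + 1
      \<Longrightarrow> \<bar>k (step \<rho> Z) - k Z\<bar> \<le> v / cmod Z ^ 3"
  shows "\<bar>\<Sum>Z\<in>covball M. k Z * (lap (\<lambda>Z. cutN N Z * f Z) Z - cutN N Z * lap f Z)\<bar>
    \<le> 4 * u * v * B * S / N"
proof -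
  define t where "t Z \<rho> = (cutN N (step \<rho> Z) - cutN N Z) *
      (k Z * (f (step \<rho> Z) - f Z) - f Z * (k (step \<rho> Z) - k Z))" for Z \<rho>
  have t: "\<bar>t Z \<rho>\<bar> \<le> (2 * u * v * B / N) * (1 / cmod Z ^ 5)" if Z: "Z \<in> cov" and \<rho>: "\<rho> \<in> dirs" for Z \<rho>
  proof (cases "N - 1 \<le> (cmod Z)\<^sup>2 \<and> (cmod Z)\<^sup>2 \<le> 2 * N + 1")
    case True
    have Z0: "0 < cmod Z" using cov_nonzero[OF Z] by simp
    have "\<bar>k Z * (f (step \<rho> Z) - f Z) - f Z * (k (step \<rho> Z) - k Z)\<bar>
        \<le> \<bar>k Z\<bar> * \<bar>f (step \<rho> Z) - f Z\<bar> + \<bar>f Z\<bar> * \<bar>k (step \<rho> Z) - k Z\<bar>"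
      by (metis abs_mult abs_triangle_ineq4)
    also have "\<dots> \<le> (v / cmod Z) * (u / cmod Z ^ 3) + (u / cmod Z) * (v / cmod Z ^ 3)"
      using f f' k k' Z \<rho> True uv by (intro add_mono mult_mono) auto
    also have "\<dots> = 2 * u * v * cmod Z * (1 / cmod Z ^ 5)"
      using Z0 by (simp add: power_numeral_reduce)
    also have "\<dots> \<le> 2 * u * v * B * (1 / cmod Z ^ 5)"
    proof -
      have "(cmod Z)\<^sup>2 \<le> B\<^sup>2" using True B by linarith
      then have "cmod Z \<le> B" using B(1) power2_le_imp_le by blast
      then show ?thesis using uv by (intro mult_right_mono mult_left_mono) auto
    qed
    finally have A: "\<bar>k Z * (f (step \<rho> Z) - f Z) - f Z * (k (step \<rho> Z) - k Z)\<bar>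
      \<le> 2 * u * v * B * (1 / cmod Z ^ 5)" .
    have "\<bar>t Z \<rho>\<bar> \<le> (1 / N) * (2 * u * v * B * (1 / cmod Z ^ 5))"
      unfolding t_def abs_mult using A cutN_step[OF N Z \<rho>] N by (intro mult_mono) auto
    then show ?thesis by simp
  next
    case False
    then have "t Z \<rho> = 0" using cutN_step_zero[OF N Z \<rho>] by (auto simp: t_def)
    then show ?thesis using uv B N by simp
  qed
  have supp: "cutN N Z = 0" if "M - 1 < (cmod Z)\<^sup>2" for Z
    using that M by (intro cutN_eq_0[OF N]) auto
  have "\<bar>\<Sum>Z\<in>covball M. k Z * (lap (\<lambda>Z. cutN N Z * f Z) Z - cutN N Z * lap f Z)\<bar>
      = \<bar>\<Sum>Z\<in>covball M. \<Sum>\<rho>\<in>dirs. t Z \<rho>\<bar> / 2"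
    using supp by (subst sum_commutator) (simp_all add: t_def)
  also have "\<dots> \<le> (\<Sum>Z\<in>covball M. \<Sum>\<rho>\<in>dirs. (2 * u * v * B / N) * (1 / cmod Z ^ 5)) / 2"
    using t by (intro divide_right_mono order_trans[OF sum_abs sum_mono] order_trans[OF sum_abs]) (auto simp: covball_def)
  also have "\<dots> = (4 * u * v * B / N) * (\<Sum>Z\<in>covball M. 1 / cmod Z ^ 5)"
    by (simp only: sum_constant card_dirs sum_distrib_left[symmetric]) simp
  also have "\<dots> \<le> (4 * u * v * B / N) * S"
    using S[OF finite_covball covball_subset] uv B N by (intro mult_left_mono) auto
  finally show ?thesis by simp
qed

lemma box_path:
  fixes h :: "complex \<Rightarrow> real"
  assumes h: "\<And>x \<rho>. x \<in> gbox n \<Longrightarrow> \<rho> \<in> dirs \<Longrightarrow> \<bar>h (x + \<rho>) - h x\<bar> \<le> e"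
    and x: "x \<in> gbox n"
  shows "\<bar>h x - h 0\<bar> \<le> e * (\<bar>Re x\<bar> + \<bar>Im x\<bar>)"
proof -
  have "\<forall>x\<in>gbox n. \<bar>Re x\<bar> + \<bar>Im x\<bar> = real m \<longrightarrow> \<bar>h x - h 0\<bar> \<le> e * real m" for m
  proof (induction m)
    case 0
    have "x = 0" if "\<bar>Re x\<bar> + \<bar>Im x\<bar> = 0" for x
      using that abs_ge_zero[of "Re x"] abs_ge_zero[of "Im x"] by (simp add: complex_eq_iff)
    then show ?case by auto
  next
    case (Suc m)
    show ?case
    proof (intro ballI impI)
      fix x assume x: "x \<in> gbox n" "\<bar>Re x\<bar> + \<bar>Im x\<bar> = real (Suc m)"
      have ge1: "1 \<le> \<bar>r\<bar>" if "r \<in> \<int>" "r \<noteq> 0" for r :: real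
        using Ints_nonzero_abs_ge1 that by blast
      have "\<exists>\<rho>\<in>dirs. x - \<rho> \<in> gbox n \<and> \<bar>Re (x - \<rho>)\<bar> + \<bar>Im (x - \<rho>)\<bar> = real m"
      proof (cases "Re x = 0")
        case False
        then have "1 \<le> \<bar>Re x\<bar>" using x ge1[of "Re x"] by (auto simp: gbox_def gint_def)
        then show ?thesis
          using x by (intro bexI[of _ "if 0 < Re x then 1 else - 1"]) (auto simp: gbox_def gint_def)
      next
        case True
        then have "1 \<le> \<bar>Im x\<bar>" using x ge1[of "Im x"] by (auto simp: gbox_def gint_def)
        then show ?thesis
          using x True by (intro bexI[of _ "if 0 < Im x then \<i> else - \<i>"]) (auto simp: gbox_def gint_def)
      qed
      then obtain \<rho> where \<rho>: "\<rho> \<in> dirs" "x - \<rho> \<in> gbox n" "\<bar>Re (x - \<rho>)\<bar> + \<bar>Im (x - \<rho>)\<bar> = real m"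
        by blast
      then have "\<bar>h (x - \<rho>) - h 0\<bar> \<le> e * real m" using Suc by blast
      moreover have "\<bar>h x - h (x - \<rho>)\<bar> \<le> e" using h[OF \<rho>(2,1)] by simp
      ultimately show "\<bar>h x - h 0\<bar> \<le> e * real (Suc m)" by (simp add: algebra_simps)
    qed
  qed
  moreover obtain a b :: int where "Re x = of_int a" "Im x = of_int b"
    using x by (auto simp: gbox_def gint_def elim!: Ints_cases)
  then have "\<bar>Re x\<bar> + \<bar>Im x\<bar> = real (nat (\<bar>a\<bar> + \<bar>b\<bar>))" by simp
  ultimately show ?thesis using x by metis
qed

lemma Fundsol_minus: "Fundsol (- x) = Fundsol x"
  by (simp add: Fundsol_def)

lemma Fundsol_mult: "a \<noteq> 0 \<Longrightarrow> b \<noteq> 0 \<Longrightarrow> Fundsol (a * b) = Fundsol a + Fundsol b"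
  by (simp add: Fundsol_def norm_mult ln_mult algebra_simps add_divide_distrib)

lemma lap_cong:
  assumes "u Z = v Z" "\<And>\<rho>. \<rho> \<in> dirs \<Longrightarrow> u (step \<rho> Z) = v (step \<rho> Z)"
  shows "lap u Z = lap v Z"
  using assms by (simp add: lap_def)

lemma gint_lattice: "t \<in> lattice \<Longrightarrow> x \<in> gint \<Longrightarrow> t + x \<in> lattice"
proof -
  assume t: "t \<in> lattice" and x: "x \<in> gint"
  obtain a b :: int where ab: "Re t = of_int a - 1/2" "Im t = of_int b - 1/2"
    using t by (auto simp: lattice_iff)
  obtain c d :: int where cd: "Re x = of_int c" "Im x = of_int d"
    using x by (auto simp: gint_def elim!: Ints_cases)
  show "t + x \<in> lattice"
    unfolding lattice_iff using ab cd by (intro exI[of _ "a + c"] exI[of _ "b + d"]) simp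
qed

lemma lattice_gint: "t \<in> lattice \<Longrightarrow> u \<in> lattice \<Longrightarrow> t - u \<in> gint"
  by (auto simp: lattice_iff gint_def)

text \<open>Here \<open>z = \<omega>(s)\<close> is the source, \<open>k\<close> is the lift to the cover of \<open>t \<mapsto> G(t, l + \<tau>) - G(t, l)\<close>
  minus a constant, \<open>lam = \<bar>\<omega>(l)\<bar>\<close>, and \<open>g\<close> is the lift of the tip corrector.\<close>

locale crack_core =
  fixes k g :: "complex \<Rightarrow> real" and z z' \<sigma> :: complex and \<kappa> lam A S S' :: real
  assumes z: "z \<in> cov" and \<sigma>: "\<sigma> \<in> dirs" and z'_def: "z' = step \<sigma> z"
    and big: "100000 \<le> (cmod z)\<^sup>2"
    and lam: "0 < lam" "16 * lam\<^sup>2 \<le> (cmod z)\<^sup>2"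
    and \<kappa>: "0 < \<kappa>" and A: "0 \<le> A"
    and S: "\<And>F. finite F \<Longrightarrow> F \<subseteq> cov \<Longrightarrow> (\<Sum>Z\<in>F. 1 / cmod Z ^ 5) \<le> S"
    and S': "\<And>F. finite F \<Longrightarrow> F \<subseteq> gint \<Longrightarrow> (\<Sum>x\<in>F. 1 / (1 + cmod x) ^ 3) \<le> S'"
    and k_even: "\<And>Z. Z \<in> cov \<Longrightarrow> k (sheet Z) = k Z"
    and k_harm: "\<And>Z. Z \<in> cov \<Longrightarrow> (cmod z)\<^sup>2 / 2 \<le> (cmod Z)\<^sup>2 \<Longrightarrow> lap k Z = 0"
    and k_tip: "\<And>Z. Z \<in> cov \<Longrightarrow> (cmod Z)\<^sup>2 \<le> (cmod z)\<^sup>2 \<Longrightarrow> \<bar>k Z\<bar> \<le> \<kappa> / lam * cmod Z"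
    and k_far: "\<And>Z. Z \<in> cov \<Longrightarrow> 5/4 * lam\<^sup>2 \<le> (cmod Z)\<^sup>2 \<Longrightarrow> (cmod Z)\<^sup>2 \<le> 2 * cmod z ^ 6 + 1 \<Longrightarrow>
      \<bar>k Z\<bar> \<le> \<kappa> / lam / cmod Z"
    and k_diff: "\<And>Z \<rho>. Z \<in> cov \<Longrightarrow> \<rho> \<in> dirs \<Longrightarrow> 5/4 * lam\<^sup>2 \<le> (cmod Z)\<^sup>2 \<Longrightarrow> (cmod Z)\<^sup>2 \<le> 2 * cmod z ^ 6 + 1 \<Longrightarrow>
      \<bar>k (step \<rho> Z) - k Z\<bar> \<le> \<kappa> / lam / cmod Z ^ 3"
    and g: "\<And>Z. Z \<in> cov \<Longrightarrow> (cmod Z)\<^sup>2 \<le> (cmod z)\<^sup>2 \<Longrightarrow> \<bar>g Z\<bar> \<le> A / cmod Z"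
    and g_diff: "\<And>Z \<rho>. Z \<in> cov \<Longrightarrow> \<rho> \<in> dirs \<Longrightarrow> (cmod Z)\<^sup>2 \<le> (cmod z)\<^sup>2 \<Longrightarrow> \<bar>g (step \<rho> Z) - g Z\<bar> \<le> A / cmod Z ^ 3"
    and g_lap: "\<And>Z. Z \<in> cov \<Longrightarrow> lap g Z = - lap Im Z"
begin

lemma z0: "z \<noteq> 0" "0 < cmod z"
  using cov_nonzero[OF z] by auto

lemma S_pos: "0 \<le> S" "0 \<le> S'"
  using S[of "{}"] S'[of "{}"] by simp_all

lemma zeta: "100 \<le> cmod z"
proof -
  have "(100::real)\<^sup>2 \<le> (cmod z)\<^sup>2" using big by simp
  then show ?thesis by (rule power2_le_imp_le) simp
qed

lemma z'_diff: "cmod (z' - z) \<le> 1 / cmod z"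
  unfolding z'_def using step_diff[OF z0(1), of \<sigma>] norm_dirs[OF \<sigma>] by simp

text \<open>Half-width of the box around the source. Gradients at its points are estimated in boxes
  of the same size around them, so twice this width still has to fit into the disc |x| <= |z|^2/4 of
  \<open>chart\<close>.\<close>

definition n :: nat where "n = nat \<lfloor>(cmod z)\<^sup>2 / 40\<rfloor>"

lemma n_bounds: "real n \<le> (cmod z)\<^sup>2 / 40" "(cmod z)\<^sup>2 / 41 \<le> real n" "1000 \<le> real n"
proof -
  show 1: "real n \<le> (cmod z)\<^sup>2 / 40" unfolding n_def by (rule of_nat_floor) simp
  have "(cmod z)\<^sup>2 / 40 - 1 < real n" unfolding n_def by linarith
  then show "(cmod z)\<^sup>2 / 41 \<le> real n" "1000 \<le> real n" using big by simp_all
qed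

text \<open>The two summands of the source increment of \<open>Ghat0\<close> are the values of \<open>E\<close> at \<open>\<omega>(t)\<close> and at its
  mirror image. At the poles the singular part of \<open>Fundsol (z - Z) = Fundsol (z\<^sup>2 - Z\<^sup>2) - Fundsol (z + Z)\<close>
  is given the lattice value \<open>Fundsol 0 = 0\<close>.\<close>

definition E :: "complex \<Rightarrow> real" where
  "E Z = (if Z = z \<or> Z = z' then Fundsol (z'\<^sup>2 - Z\<^sup>2) - Fundsol (z\<^sup>2 - Z\<^sup>2) - dF (- z) (- z') Z
          else dF z z' Z)"

lemma E_eq_dF: "1 / cmod z < cmod (Z - z) \<Longrightarrow> E Z = dF z z' Z"
  using z'_diff z0 by (auto simp: E_def)

definition near :: "complex set" where
  "near = (\<lambda>x. step x z) ` gbox n"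

text \<open>On this disc x is a coordinate for the sheet through z, inverse to
  \<open>Z\<^sup>2 - z\<^sup>2\<close>: both relative factors have positive real part, so their
  roots multiply and steps compose. The cover thus looks like the flat square lattice near
  z.\<close>

lemma chart:
  assumes x: "x \<in> gint" "cmod x \<le> (cmod z)\<^sup>2 / 4"
  shows "step x z \<in> cov" "(step x z)\<^sup>2 = z\<^sup>2 + x"
    "3/4 * (cmod z)\<^sup>2 \<le> (cmod (step x z))\<^sup>2" "(cmod (step x z))\<^sup>2 \<le> 5/4 * (cmod z)\<^sup>2"
    "\<rho> \<in> dirs \<Longrightarrow> step \<rho> (step x z) = step (x + \<rho>) z" "0 < Re (step x z / z)"
proof -
  show sq: "(step x z)\<^sup>2 = z\<^sup>2 + x" by (rule step_square[OF z])
  show cov: "step x z \<in> cov" using gint_lattice[of "z\<^sup>2" x] x z by (simp add: cov_def sq)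
  have nrm: "(cmod (step x z))\<^sup>2 = cmod (z\<^sup>2 + x)" by (metis sq norm_power)
  have z2: "cmod (z\<^sup>2) = (cmod z)\<^sup>2" by (simp add: norm_power)
  show lo: "3/4 * (cmod z)\<^sup>2 \<le> (cmod (step x z))\<^sup>2"
    using norm_triangle_ineq4[of "z\<^sup>2 + x" x] x unfolding nrm by (simp add: z2)
  show "(cmod (step x z))\<^sup>2 \<le> 5/4 * (cmod z)\<^sup>2"
    using norm_triangle_ineq[of "z\<^sup>2" x] x unfolding nrm by (simp add: z2)
  have x1: "cmod (x / z\<^sup>2) \<le> 1/4" using x z0 by (simp add: norm_divide z2 divide_simps)
  have Re1: "0 < Re (1 + x / z\<^sup>2)" using abs_Re_le_cmod[of "x / z\<^sup>2"] x1 by simp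
  then have "1 + x / z\<^sup>2 \<notin> \<real>\<^sub>\<le>\<^sub>0" by (auto simp: complex_nonpos_Reals_iff)
  then show "0 < Re (step x z / z)" using z0 Re_csqrt_pos by (simp add: step_def)
  assume \<rho>: "\<rho> \<in> dirs"
  have nz: "z\<^sup>2 + x \<noteq> 0" using lo z0 unfolding nrm by force
  have "cmod (\<rho> / (z\<^sup>2 + x)) < 1"
    using lo big norm_dirs[OF \<rho>] unfolding nrm by (simp add: norm_divide divide_simps)
  then have Re2: "0 < Re (1 + \<rho> / (z\<^sup>2 + x))" using abs_Re_le_cmod[of "\<rho> / (z\<^sup>2 + x)"] by simp
  have prod: "(1 + x / z\<^sup>2) * (1 + \<rho> / (z\<^sup>2 + x)) = 1 + (x + \<rho>) / z\<^sup>2"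
  proof -
    have "(1 + x / z\<^sup>2) = (z\<^sup>2 + x) / z\<^sup>2" using z0 by (simp add: field_simps)
    moreover have "(1 + \<rho> / (z\<^sup>2 + x)) = (z\<^sup>2 + x + \<rho>) / (z\<^sup>2 + x)" using nz by (simp add: field_simps)
    ultimately have "(1 + x / z\<^sup>2) * (1 + \<rho> / (z\<^sup>2 + x)) = (z\<^sup>2 + x + \<rho>) / z\<^sup>2" using nz by simp
    also have "\<dots> = 1 + (x + \<rho>) / z\<^sup>2" using z0 by (simp add: add_divide_distrib)
    finally show ?thesis .
  qed
  have "step \<rho> (step x z) = z * (csqrt (1 + x / z\<^sup>2) * csqrt (1 + \<rho> / (z\<^sup>2 + x)))"
    by (simp add: step_def[of \<rho>] sq) (simp add: step_def)
  then show "step \<rho> (step x z) = step (x + \<rho>) z"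
    unfolding csqrt_mult_halfplane[OF Re1 Re2] prod by (simp add: step_def)
qed

lemma chart_box: "x \<in> gbox (2 * n + 2) \<Longrightarrow> x \<in> gint \<and> cmod x \<le> (cmod z)\<^sup>2 / 4"
proof -
  assume x: "x \<in> gbox (2 * n + 2)"
  have "cmod x \<le> 4 * real n + 4" using box_norm[OF x] by simp
  also have "\<dots> \<le> (cmod z)\<^sup>2 / 4" using n_bounds big by linarith
  finally show ?thesis using x by (simp add: gbox_def)
qed

lemma box_mono: "a \<le> b \<Longrightarrow> x \<in> gbox a \<Longrightarrow> x \<in> gbox b"
  by (auto simp: gbox_def)

lemma z_power_mono: "2 * (cmod z)\<^sup>2 \<le> 2 * cmod z ^ 6 + 1"
proof -
  have "cmod z ^ 2 \<le> cmod z ^ 6" using zeta by (intro power_increasing) auto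
  then show ?thesis by simp
qed

text \<open>If Re (Z/z) <= 0, then Z is at least as close to -z as to z. Otherwise Z is
  \<open>step (Z\<^sup>2 - z\<^sup>2) z\<close> with increment outside the box, so |Z - z| |Z + z|
  exceeds n >= |z|^2/41. For |Z| <= 2|z| this gives |Z - z| >= |z|/123, and 250 exceeds twice
  123.\<close>

lemma far_from_z:
  assumes Z: "Z \<in> cov" "Z \<notin> near"
  shows "cmod Z / 250 \<le> cmod (Z - z)" "cmod z / 250 \<le> cmod (Z - z)"
proof -
  have "cmod Z / 250 \<le> cmod (Z - z) \<and> cmod z / 250 \<le> cmod (Z - z)"
  proof (cases "0 < Re (Z / z)")
    case False
    define v where "v = Z / z"
    have Zv: "Z = v * z" using z0 by (simp add: v_def)
    have Re: "Re v \<le> 0" using False by (simp add: v_def)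
    have "1 \<le> cmod (v - 1)" using abs_Re_le_cmod[of "v - 1"] Re by simp
    moreover have "cmod v \<le> cmod (v - 1)"
    proof (rule power2_le_imp_le)
      show "(cmod v)\<^sup>2 \<le> (cmod (v - 1))\<^sup>2"
        using Re unfolding cmod_power2 by (simp add: power2_eq_square algebra_simps)
    qed simp
    moreover have "Z - z = (v - 1) * z" by (simp add: Zv algebra_simps)
    ultimately have "cmod z \<le> cmod (Z - z)" "cmod Z \<le> cmod (Z - z)"
      using mult_right_mono[of 1 "cmod (v - 1)" "cmod z"] mult_right_mono[of "cmod v" "cmod (v - 1)" "cmod z"]
      by (simp_all add: Zv norm_mult)
    then show ?thesis using norm_ge_zero[of Z] norm_ge_zero[of z] by linarith
  next
    case True
    have "Z\<^sup>2 - z\<^sup>2 \<notin> gbox n"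
    proof
      assume "Z\<^sup>2 - z\<^sup>2 \<in> gbox n"
      moreover have "Z = step (Z\<^sup>2 - z\<^sup>2) z"
      proof -
        have "1 + (Z\<^sup>2 - z\<^sup>2) / z\<^sup>2 = (Z / z)\<^sup>2" using z0 by (simp add: diff_divide_distrib power_divide)
        then show ?thesis using z0 csqrt_square[of "Z / z"] True by (simp add: step_def)
      qed
      ultimately show False using Z by (auto simp: near_def)
    qed
    moreover have "Z\<^sup>2 - z\<^sup>2 \<in> gint" using Z z lattice_gint by (simp add: cov_def)
    ultimately have "real n < cmod (Z\<^sup>2 - z\<^sup>2)" by (rule not_box_norm[rotated])
    moreover have "Z\<^sup>2 - z\<^sup>2 = (Z - z) * (Z + z)" by (simp add: power2_eq_square algebra_simps)
    ultimately have "(cmod z)\<^sup>2 / 41 \<le> cmod (Z - z) * cmod (Z + z)"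
      using n_bounds by (simp add: norm_mult)
    also have "\<dots> \<le> cmod (Z - z) * (cmod Z + cmod z)"
      by (intro mult_left_mono norm_triangle_ineq) auto
    finally have D: "(cmod z)\<^sup>2 / 41 \<le> cmod (Z - z) * (cmod Z + cmod z)" .
    show ?thesis
    proof (cases "cmod Z \<le> 2 * cmod z")
      case True
      then have "cmod (Z - z) * (cmod Z + cmod z) \<le> cmod (Z - z) * (3 * cmod z)"
        by (intro mult_left_mono) auto
      with D have "(cmod z)\<^sup>2 / 41 \<le> cmod (Z - z) * (3 * cmod z)" by (rule order_trans)
      then have "cmod z * (cmod z / 41) \<le> cmod z * (3 * cmod (Z - z))"
        by (simp add: power2_eq_square mult_ac)
      then have "cmod z / 41 \<le> 3 * cmod (Z - z)" using z0 mult_le_cancel_left_pos by blast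
      then show ?thesis using True z0 by linarith
    next
      case False
      then show ?thesis using norm_triangle_ineq2[of Z z] z0 by linarith
    qed
  qed
  then show "cmod Z / 250 \<le> cmod (Z - z)" "cmod z / 250 \<le> cmod (Z - z)" by auto
qed

text \<open>A step moves Z by at most 4/|z| and the poles are at most 1/|z| apart, both far less
  than |z|/250, so the exceptional values of \<open>E\<close> are out of reach.\<close>

lemma E_step_eq_dF:
  assumes Z: "Z \<in> cov" "(cmod z)\<^sup>2 / 16 \<le> (cmod Z)\<^sup>2" and far: "cmod z / 250 \<le> cmod (Z - z)" and \<rho>: "\<rho> \<in> dirs"
  shows "E (step \<rho> Z) = dF z z' (step \<rho> Z)" "E Z = dF z z' Z"
proof -
  have Z0: "Z \<noteq> 0" using cov_nonzero[OF Z(1)] by simp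
  have "(cmod z / 4)\<^sup>2 \<le> (cmod Z)\<^sup>2" using Z(2) by (simp add: power_divide)
  then have "cmod z / 4 \<le> cmod Z" by (rule power2_le_imp_le) simp
  then have "1 / cmod Z \<le> 1 / (cmod z / 4)" using z0 Z0 by (intro divide_left_mono mult_pos_pos) auto
  then have st: "cmod (step \<rho> Z - Z) \<le> 4 / cmod z"
    using step_diff[OF Z0, of \<rho>] norm_dirs[OF \<rho>] by simp
  have "250 * 5 < cmod z * cmod z" using big by (simp add: power2_eq_square)
  then have "5 / cmod z < cmod z / 250" using z0 by (simp add: divide_simps)
  then have fz: "1 / cmod z + 4 / cmod z < cmod z / 250" by (simp add: add_divide_distrib[symmetric])
  have "cmod (Z - z) \<le> cmod (step \<rho> Z - z) + cmod (step \<rho> Z - Z)"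
    using norm_triangle_ineq4[of "step \<rho> Z - z" "step \<rho> Z - Z"] by simp
  then have "1 / cmod z < cmod (step \<rho> Z - z)" using far st fz by linarith
  then show "E (step \<rho> Z) = dF z z' (step \<rho> Z)" by (rule E_eq_dF)
  have "0 \<le> 4 / cmod z" by simp
  then have "1 / cmod z < cmod (Z - z)" using far fz by linarith
  then show "E Z = dF z z' Z" by (rule E_eq_dF)
qed

lemma E_lap_eq_dF:
  assumes "Z \<in> cov" "(cmod z)\<^sup>2 / 16 \<le> (cmod Z)\<^sup>2" "cmod z / 250 \<le> cmod (Z - z)"
  shows "lap E Z = lap (dF z z') Z"
  using E_step_eq_dF[OF assms] E_step_eq_dF(2)[OF assms, of 1] by (intro lap_cong) auto

lemma lap_E_away:
  assumes Z: "Z \<in> cov" "Z \<notin> near" "(cmod z)\<^sup>2 / 12 \<le> (cmod Z)\<^sup>2"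
  shows "\<bar>lap E Z\<bar> \<le> 10^15 / ((cmod z)\<^sup>2 * cmod Z ^ 8)"
proof -
  note far = far_from_z[OF Z(1,2)]
  have Z16: "(cmod z)\<^sup>2 / 16 \<le> (cmod Z)\<^sup>2" using Z(3) zero_le_power2[of "cmod z"] by linarith
  have Z0: "Z \<noteq> 0" using cov_nonzero[OF Z(1)] by simp
  have "4 \<le> cmod z * (cmod z / 250)" using big by (simp add: power2_eq_square)
  also have "\<dots> \<le> cmod z * cmod (Z - z)" using far by (intro mult_left_mono) auto
  finally have b1: "4 \<le> cmod z * cmod (Z - z)" .
  have b2: "8 \<le> 1/250 * (cmod Z)\<^sup>2" using Z(3) big by linarith
  have "\<bar>lap E Z\<bar> = \<bar>lap (dF z z') Z\<bar>" using E_lap_eq_dF[OF Z(1) Z16 far(2)] by simp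
  also have "\<dots> \<le> 1000 / (cmod z * cmod (Z - z) * (1/250 * (cmod Z)\<^sup>2) ^ 4)"
    using far z'_diff by (intro dF_bounds(1)[OF Z0 z0(1)] b1 b2) auto
  also have "\<dots> \<le> 1000 / (cmod z * (cmod z / 250) * (1/250 * (cmod Z)\<^sup>2) ^ 4)"
    using far z0 Z0 by (intro divide_left_mono mult_right_mono mult_left_mono mult_pos_pos zero_less_power) auto
  \<comment> \<open>One factor 250 comes from the distance to the pole, four from c = 1/250 in
    \<open>dF_bounds\<close>.\<close>
  also have "\<dots> = 1000 * 250 ^ 5 / ((cmod z)\<^sup>2 * cmod Z ^ 8)"
    using z0 Z0 by (simp add: power_mult_distrib power2_eq_square[of "cmod z"] power_divide flip: power_mult)
  also have "\<dots> \<le> 10^15 / ((cmod z)\<^sup>2 * cmod Z ^ 8)"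
    by (intro divide_right_mono) auto
  finally show ?thesis .
qed

text \<open>In the chart the singularity of \<open>E\<close> is measured by
  \<open>z\<^sup>2 - Z\<^sup>2 = (z - Z) (z + Z)\<close>. The second factor has its pole at -z, at
  distance at least |z| from every Z in \<open>near\<close>, so it contributes like a regular
  term.\<close>

lemma lap_mirror_near:
  assumes Z: "Z \<in> near"
  shows "\<bar>lap (dF (- z) (- z')) Z\<bar> \<le> 10^15 / ((cmod z)\<^sup>2 * cmod Z ^ 8)"
proof -
  obtain x where x: "x \<in> gbox n" "Z = step x z" using Z by (auto simp: near_def)
  have xb: "x \<in> gint" "cmod x \<le> (cmod z)\<^sup>2 / 4" using chart_box[OF box_mono[OF _ x(1)]] by auto
  note c = chart[OF xb, folded x(2)]
  have Z0: "Z \<noteq> 0" using cov_nonzero[OF c(1)] by simp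
  define v where "v = Z / z"
  have Zv: "Z = v * z" using z0 by (simp add: v_def)
  have Re: "0 < Re v" using c(6) by (simp add: v_def)
  have "1 \<le> cmod (v + 1)" using abs_Re_le_cmod[of "v + 1"] Re by simp
  moreover have "cmod v \<le> cmod (v + 1)"
  proof (rule power2_le_imp_le)
    show "(cmod v)\<^sup>2 \<le> (cmod (v + 1))\<^sup>2"
      using Re unfolding cmod_power2 by (simp add: power2_eq_square algebra_simps)
  qed simp
  moreover have "Z + z = (v + 1) * z" by (simp add: Zv algebra_simps)
  ultimately have far: "cmod z \<le> cmod (Z + z)" "cmod Z \<le> cmod (Z + z)"
    using mult_right_mono[of 1 "cmod (v + 1)" "cmod z"] mult_right_mono[of "cmod v" "cmod (v + 1)" "cmod z"]
    by (simp_all add: Zv norm_mult)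
  have d: "cmod (- z' - - z) \<le> 1 / cmod (- z)"
    using z'_diff by (simp add: norm_minus_commute)
  have "cmod z * cmod z \<le> cmod z * cmod (Z + z)" using far by (intro mult_left_mono) auto
  then have b1: "4 \<le> cmod (- z) * cmod (Z - - z)" using big by (simp add: power2_eq_square)
  have b2: "8 \<le> 1 * (cmod Z)\<^sup>2" using c(3) big by linarith
  have "\<bar>lap (dF (- z) (- z')) Z\<bar> \<le> 1000 / (cmod (- z) * cmod (Z - - z) * (1 * (cmod Z)\<^sup>2) ^ 4)"
    using z0 far by (intro dF_bounds(1)[OF Z0 _ d _ _ _ b1 b2]) auto
  also have "\<dots> \<le> 1000 / (cmod z * cmod z * (1 * (cmod Z)\<^sup>2) ^ 4)"
    using far z0 Z0 by (simp only: norm_minus_cancel diff_minus_eq_add)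
      (intro divide_left_mono mult_right_mono mult_left_mono mult_pos_pos zero_less_power, auto)
  also have "\<dots> = 1000 / ((cmod z)\<^sup>2 * cmod Z ^ 8)"
    by (simp add: power2_eq_square[of "cmod z"] flip: power_mult)
  also have "\<dots> \<le> 10^15 / ((cmod z)\<^sup>2 * cmod Z ^ 8)"
    by (intro divide_right_mono) auto
  finally show ?thesis .
qed

text \<open>In the lattice coordinate the singular part of \<open>E\<close> is the difference of two
  translates of \<open>Fundsol\<close>, whose stencil is governed by \<open>psi\<close>. The values
  of \<open>E\<close> at its poles are chosen so that this formula holds there as well.\<close>

lemma E_chart:
  assumes x: "x \<in> gint" "cmod x \<le> (cmod z)\<^sup>2 / 4"
  shows "E (step x z) = Fundsol (x - \<sigma>) - Fundsol x - dF (- z) (- z') (step x z)"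
proof -
  define Z where "Z = step x z"
  note c = chart[OF x, folded Z_def]
  have z'2: "z'\<^sup>2 = z\<^sup>2 + \<sigma>" unfolding z'_def by (rule step_square[OF z])
  have e: "z'\<^sup>2 - Z\<^sup>2 = - (x - \<sigma>)" "z\<^sup>2 - Z\<^sup>2 = - x" by (simp_all add: c(2) z'2)
  have Re: "0 < Re (Z / z)" by (rule c(6))
  have Re': "0 < Re (z' / z)"
    using chart(6)[of \<sigma>] gint_dirs[OF \<sigma>] norm_dirs[OF \<sigma>] big by (simp add: z'_def)
  have E: "E Z = Fundsol (z'\<^sup>2 - Z\<^sup>2) - Fundsol (z\<^sup>2 - Z\<^sup>2) - dF (- z) (- z') Z"
  proof (cases "Z = z \<or> Z = z'")
    case False
    have "z + Z \<noteq> 0"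
    proof
      assume "z + Z = 0"
      then have "Z = - z" by (simp add: add_eq_0_iff)
      then have "Z / z = - 1" using z0 by simp
      then show False using Re by simp
    qed
    moreover have "z' + Z \<noteq> 0"
    proof
      assume "z' + Z = 0"
      then have "Z / z = - (z' / z)" by (simp add: add_eq_0_iff)
      then show False using Re Re' by simp
    qed
    moreover have "z'\<^sup>2 - Z\<^sup>2 = (z' - Z) * (z' + Z)" "z\<^sup>2 - Z\<^sup>2 = (z - Z) * (z + Z)"
      by (simp_all add: power2_eq_square algebra_simps)
    moreover have "z' - Z \<noteq> 0" "z - Z \<noteq> 0" using False by auto
    ultimately have "Fundsol (z'\<^sup>2 - Z\<^sup>2) = Fundsol (z' - Z) + Fundsol (z' + Z)"
      "Fundsol (z\<^sup>2 - Z\<^sup>2) = Fundsol (z - Z) + Fundsol (z + Z)"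
      by (simp_all add: Fundsol_mult)
    moreover have "dF (- z) (- z') Z = Fundsol (z' + Z) - Fundsol (z + Z)"
      using Fundsol_minus[of "z' + Z"] Fundsol_minus[of "z + Z"] by (simp add: dF_def)
    ultimately show ?thesis using False by (simp add: E_def dF_def)
  qed (simp add: E_def)
  show ?thesis using E[unfolded e Fundsol_minus] by (simp only: Z_def)
qed

end

context crack_core
begin

section \<open>The kernel near the source\<close>

definition kx :: "complex \<Rightarrow> real" where
  "kx x = k (step x z)"

lemma chart_box':
  assumes "x \<in> gbox (2 * n + 1)"
  shows "x \<in> gint" "cmod x \<le> (cmod z)\<^sup>2 / 4"
  using chart_box[OF box_mono[OF _ assms]] by auto

lemma near_norm:
  assumes "x \<in> gbox (2 * n + 1)"
  shows "cmod z / 2 \<le> cmod (step x z)" "5/4 * lam\<^sup>2 \<le> (cmod (step x z))\<^sup>2"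
    "(cmod (step x z))\<^sup>2 \<le> 2 * cmod z ^ 6 + 1"
proof -
  note c = chart[OF chart_box'[OF assms]]
  have "(cmod z / 2)\<^sup>2 = (cmod z)\<^sup>2 / 4" by (simp add: power_divide)
  then have "(cmod z / 2)\<^sup>2 \<le> (cmod (step x z))\<^sup>2"
    using c(3) zero_le_power2[of "cmod z"] by linarith
  then show "cmod z / 2 \<le> cmod (step x z)" by (rule power2_le_imp_le) simp
  show "5/4 * lam\<^sup>2 \<le> (cmod (step x z))\<^sup>2"
    using c(3) lam(2) zero_le_power2[of lam] by linarith
  show "(cmod (step x z))\<^sup>2 \<le> 2 * cmod z ^ 6 + 1"
    using c(4) z_power_mono zero_le_power2[of "cmod z"] by linarith
qed

lemma kl_pos: "0 < \<kappa> / lam"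
  using \<kappa> lam by simp

lemma kx_bound:
  assumes "x \<in> gbox (2 * n + 1)"
  shows "\<bar>kx x\<bar> \<le> \<kappa> / lam / (cmod z / 2)"
proof -
  have "\<bar>kx x\<bar> \<le> \<kappa> / lam / cmod (step x z)"
    unfolding kx_def using chart(1)[OF chart_box'[OF assms]] near_norm[OF assms] by (intro k_far)
  also have "\<dots> \<le> \<kappa> / lam / (cmod z / 2)"
    using near_norm(1)[OF assms] z0 kl_pos by (intro divide_left_mono mult_pos_pos) auto
  finally show ?thesis .
qed

lemma kx_diff:
  assumes x: "x \<in> gbox (2 * n + 1)" and \<rho>: "\<rho> \<in> dirs"
  shows "\<bar>kx (x + \<rho>) - kx x\<bar> \<le> \<kappa> / lam / (cmod z / 2) ^ 3"
proof -
  note c = chart[OF chart_box'[OF x]]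
  have "\<bar>k (step \<rho> (step x z)) - k (step x z)\<bar> \<le> \<kappa> / lam / cmod (step x z) ^ 3"
    using c(1) near_norm[OF x] by (intro k_diff \<rho>)
  also have "\<dots> \<le> \<kappa> / lam / (cmod z / 2) ^ 3"
    using near_norm(1)[OF x] z0 kl_pos
    by (intro divide_left_mono mult_pos_pos zero_less_power power_mono) auto
  finally show ?thesis by (simp add: kx_def c(5)[OF \<rho>])
qed

lemma kx_harmonic:
  assumes x: "x \<in> gbox (2 * n + 1)"
  shows "flap kx x = 0"
proof -
  note c = chart[OF chart_box'[OF x]]
  have "(cmod z)\<^sup>2 / 2 \<le> (cmod (step x z))\<^sup>2" using c(3) zero_le_power2[of "cmod z"] by linarith
  then have "lap k (step x z) = 0" using k_harm c(1) by blast
  then show ?thesis by (simp add: flap_def lap_def kx_def c(5))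
qed

lemma gbox_add: "x \<in> gbox a \<Longrightarrow> y \<in> gbox b \<Longrightarrow> x + y \<in> gbox (a + b)"
  by (auto simp: gbox_def gint_def)

text \<open>The mass of \<open>psi\<close> vanishes in the limit, so the convolution only sees second
  differences of \<open>kx\<close>, which the gradient estimate for discrete harmonic functions controls.\<close>

lemma sum_psi_convolution:
  "\<bar>\<Sum>x\<in>gbox n. kx x * (psi (x - \<sigma>) - psi x)\<bar> \<le> 10^11 * (1 + S') * (\<kappa> / lam / cmod z ^ 4)"
proof -
  \<comment> \<open>Translating the summation variable by \<sigma> moves the difference from
    \<open>psi\<close> to \<open>kx\<close>, up to boundary terms of the box. The gradient estimate
    is then applied to h, itself a first difference of a harmonic function.\<close>
  define h where "h x = kx (x + \<sigma>) - kx x" for x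
  define M0 where "M0 = \<kappa> / lam / (cmod z / 2) ^ 3"
  have M0: "0 < M0" using \<kappa> lam z0 by (simp add: M0_def)
  have n1: "1 \<le> n" "0 < real n" using n_bounds(3) by simp_all
  have h_diff: "\<bar>h (x + \<rho>) - h x\<bar> \<le> 6 * M0 / real n" if x: "x \<in> gbox n" and \<rho>: "\<rho> \<in> dirs" for x \<rho>
  proof -
    have "\<bar>h (x + \<rho>) - h (x + 0)\<bar> \<le> 6 * M0 / real n"
    proof (rule harmonic_gradient[OF n1(1) M0 _ _ \<rho>, of "\<lambda>y. h (x + y)"])
      fix y assume y: "y \<in> gbox n"
      have 1: "x + y \<in> gbox (2 * n + 1)"
        using box_mono[OF _ gbox_add[OF x y], of "2 * n + 1"] by simp
      have 2: "x + y + \<sigma> \<in> gbox (2 * n + 1)"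
        using box_add_dirs[OF gbox_add[OF x y] \<sigma>] by (simp add: mult_2)
      have "flap (\<lambda>y. h (x + y)) y = flap kx (x + y + \<sigma>) - flap kx (x + y)"
        by (simp add: flap_def h_def sum_subtractf ac_simps)
      then show "flap (\<lambda>y. h (x + y)) y = 0" using kx_harmonic 1 2 by simp
    next
      fix y assume y: "y \<in> gbox (Suc n)"
      have "x + y \<in> gbox (2 * n + 1)" using gbox_add[OF x y] by (simp add: mult_2)
      then show "\<bar>h (x + y)\<bar> \<le> M0" using kx_diff[OF _ \<sigma>] by (simp add: h_def M0_def)
    qed
    then show ?thesis by simp
  qed
  have h_lip: "\<bar>h x - h 0\<bar> \<le> 12 * M0 / real n * cmod x" if x: "x \<in> gbox n" for x
  proof -
    have "\<bar>h x - h 0\<bar> \<le> 6 * M0 / real n * (\<bar>Re x\<bar> + \<bar>Im x\<bar>)" by (rule box_path[OF h_diff x])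
    also have "\<dots> \<le> 6 * M0 / real n * (2 * cmod x)"
      using M0 abs_Re_le_cmod[of x] abs_Im_le_cmod[of x] by (intro mult_left_mono) auto
    finally show ?thesis by simp
  qed
  have zero: "0 \<in> gbox n" by (simp add: gbox_def gint_def)
  have h0: "\<bar>h 0\<bar> \<le> M0"
    using kx_diff[OF box_mono[OF _ zero] \<sigma>] by (simp add: h_def M0_def)
  define T1 where "T1 = (\<Sum>x\<in>gbox n. h x * psi x)"
  have T1: "\<bar>T1\<bar> \<le> M0 / real n * (24 + 720000 * S')"
  proof -
    \<comment> \<open>The constant h 0 meets the small mass of \<open>psi\<close>. The rest grows at
      most linearly with slope of order M0/n, which lowers the decay of \<open>psi\<close> from
      exponent 4 to the still summable exponent 3.\<close>
    have "T1 = h 0 * sum psi (gbox n) + (\<Sum>x\<in>gbox n. (h x - h 0) * psi x)"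
      by (simp add: T1_def sum_distrib_left sum.distrib[symmetric] algebra_simps)
    moreover have "\<bar>h 0 * sum psi (gbox n)\<bar> \<le> M0 * (24 / real n)"
      unfolding abs_mult using h0 psi_box_sum[OF n1(1)] M0 by (intro mult_mono) auto
    moreover have "\<bar>\<Sum>x\<in>gbox n. (h x - h 0) * psi x\<bar> \<le> (720000 * M0 / real n) * S'"
    proof -
      have "\<bar>(h x - h 0) * psi x\<bar> \<le> (720000 * M0 / real n) * (1 / (1 + cmod x) ^ 3)" if x: "x \<in> gbox n" for x
      proof -
        have "x \<in> gint" using x by (simp add: gbox_def)
        then have "\<bar>(h x - h 0) * psi x\<bar> \<le> (12 * M0 / real n * cmod x) * (60000 / (1 + cmod x) ^ 4)"
          unfolding abs_mult using h_lip[OF x] psi_bound M0 by (intro mult_mono) auto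
        also have "\<dots> \<le> (12 * M0 / real n * (1 + cmod x)) * (60000 / (1 + cmod x) ^ 4)"
          using M0 by (intro mult_right_mono mult_left_mono) auto
        also have "\<dots> = (720000 * M0 / real n) * (1 / (1 + cmod x) ^ 3)"
        proof -
          have "1 + cmod x \<noteq> 0" using norm_ge_zero[of x] by linarith
          then show ?thesis by (simp add: power_numeral_reduce)
        qed
        finally show ?thesis .
      qed
      then have "\<bar>\<Sum>x\<in>gbox n. (h x - h 0) * psi x\<bar>
          \<le> (\<Sum>x\<in>gbox n. (720000 * M0 / real n) * (1 / (1 + cmod x) ^ 3))"
        by (intro order_trans[OF sum_abs sum_mono])
      also have "\<dots> = (720000 * M0 / real n) * (\<Sum>x\<in>gbox n. 1 / (1 + cmod x) ^ 3)"
        by (simp only: sum_distrib_left)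
      also have "\<dots> \<le> (720000 * M0 / real n) * S'"
      proof (intro mult_left_mono S' finite_box)
        show "gbox n \<subseteq> gint" by (auto simp: gbox_def)
      qed (use M0 in simp)
      finally show ?thesis .
    qed
    ultimately have "\<bar>T1\<bar> \<le> M0 * (24 / real n) + (720000 * M0 / real n) * S'" by linarith
    then show ?thesis by (simp add: algebra_simps)
  qed
  define K0 where "K0 = \<kappa> / lam / (cmod z / 2)"
  have K0: "0 < K0" using \<kappa> lam z0 by (simp add: K0_def)
  \<comment> \<open>The box and its translate differ only inside this layer, where
    \<open>psi\<close> is of order n^-4.\<close>
  define D where "D = gbox (n + 1) - gbox (n - 1)"
  define q where "q y = kx (y + \<sigma>) * psi y" for y
  have q: "\<bar>q y\<bar> \<le> K0 * (60000 / real n ^ 4)" if y: "y \<in> D" for y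
  proof -
    have "y + \<sigma> \<in> gbox (2 * n + 1)"
      using box_mono[OF _ box_add_dirs[OF _ \<sigma>, of y "n + 1"], of "2 * n + 1"] y n1 n_bounds(3) by (simp add: D_def)
    then have "\<bar>kx (y + \<sigma>)\<bar> \<le> K0" unfolding K0_def by (rule kx_bound)
    moreover have "\<bar>psi y\<bar> \<le> 60000 / real n ^ 4"
    proof -
      have yg: "y \<in> gint" using y by (simp add: D_def gbox_def)
      then have "real (n - 1) < cmod y" using y by (intro not_box_norm) (auto simp: D_def)
      then have "real n \<le> 1 + cmod y" using n1 by (simp add: of_nat_diff)
      then have "60000 / (1 + cmod y) ^ 4 \<le> 60000 / real n ^ 4"
        using n1 by (intro divide_left_mono power_mono mult_pos_pos zero_less_power) auto
      then show ?thesis using psi_bound[OF yg] by linarith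
    qed
    ultimately show ?thesis unfolding q_def abs_mult using K0 by (intro mult_mono) auto
  qed
  have qD: "\<bar>sum q F\<bar> \<le> 9 * 60000 * K0 / (real n)\<^sup>2" if F: "F \<subseteq> D" for F
  proof -
    have "finite D" by (simp add: D_def)
    have "\<bar>sum q F\<bar> \<le> (\<Sum>y\<in>F. K0 * (60000 / real n ^ 4))"
      using q F by (intro order_trans[OF sum_abs sum_mono]) auto
    also have "\<dots> = real (card F) * (K0 * (60000 / real n ^ 4))" by simp
    \<comment> \<open>Counting the whole box instead of the layer leaves n^-2, of order |z|^-4; with
      the size K0 of \<open>kx\<close>, of order 1/(lam |z|), even |z|^-5 is reached.\<close>
    also have "\<dots> \<le> (9 * (real n)\<^sup>2) * (K0 * (60000 / real n ^ 4))"
    proof (intro mult_right_mono)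
      have "F \<subseteq> gbox (n + 1)" using F by (auto simp: D_def)
      then have "real (card F) \<le> real (card (gbox (n + 1)))" by (simp add: card_mono)
      also have "\<dots> = (2 * real n + 3)\<^sup>2" by (simp add: card_box algebra_simps)
      also have "\<dots> \<le> (3 * real n)\<^sup>2" using n_bounds(3) by (intro power_mono) auto
      finally show "real (card F) \<le> 9 * (real n)\<^sup>2" by (simp add: power_mult_distrib)
    qed (use K0 in auto)
    also have "\<dots> = 9 * 60000 * K0 / (real n)\<^sup>2"
      using n1 by (simp add: power2_eq_square power_numeral_reduce)
    finally show ?thesis .
  qed
  define G where "G = (\<lambda>x. x - \<sigma>) ` gbox n"
  have "(\<Sum>x\<in>gbox n. kx x * psi (x - \<sigma>)) = sum q G"
    unfolding G_def by (subst sum.reindex) (auto simp: q_def intro!: inj_onI)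
  moreover have "sum q G = sum q (G \<inter> gbox n) + sum q (G - gbox n)"
    by (rule sum.Int_Diff) (simp add: G_def)
  moreover have "sum q (gbox n) = sum q (gbox n \<inter> G) + sum q (gbox n - G)"
    by (rule sum.Int_Diff) simp
  moreover have "T1 = sum q (gbox n) - (\<Sum>x\<in>gbox n. kx x * psi x)"
    by (simp add: T1_def q_def h_def sum_subtractf[symmetric] algebra_simps)
  ultimately have decomp: "(\<Sum>x\<in>gbox n. kx x * (psi (x - \<sigma>) - psi x))
      = T1 + sum q (G - gbox n) - sum q (gbox n - G)"
    by (simp add: right_diff_distrib sum_subtractf Int_commute)
  have "G - gbox n \<subseteq> D"
  proof
    fix y assume y: "y \<in> G - gbox n"
    then obtain x where x: "x \<in> gbox n" "y = x + (- \<sigma>)" by (auto simp: G_def)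
    have "y \<in> gbox (n + 1)" using box_add_dirs[OF x(1) minus_dirs[OF \<sigma>]] x(2) by simp
    moreover have "y \<notin> gbox (n - 1)" using y box_mono[of "n - 1" n y] by auto
    ultimately show "y \<in> D" by (simp add: D_def)
  qed
  then have 1: "\<bar>sum q (G - gbox n)\<bar> \<le> 9 * 60000 * K0 / (real n)\<^sup>2" by (rule qD)
  have "gbox n - G \<subseteq> D"
  proof
    fix y assume y: "y \<in> gbox n - G"
    have "y + \<sigma> \<notin> gbox n"
    proof
      assume "y + \<sigma> \<in> gbox n"
      then have "y + \<sigma> - \<sigma> \<in> G" unfolding G_def by (rule imageI)
      then show False using y by simp
    qed
    moreover have "y + \<sigma> \<in> gbox (Suc (n - 1))" if "y \<in> gbox (n - 1)"
      using box_add_dirs[OF that \<sigma>] .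
    ultimately have "y \<notin> gbox (n - 1)" using n1 by auto
    moreover have "y \<in> gbox (n + 1)" using y box_mono[of n "n + 1" y] by simp
    ultimately show "y \<in> D" by (simp add: D_def)
  qed
  then have 2: "\<bar>sum q (gbox n - G)\<bar> \<le> 9 * 60000 * K0 / (real n)\<^sup>2" by (rule qD)
  have inv_n: "1 / real n \<le> 41 / (cmod z)\<^sup>2"
  proof -
    have "1 / real n \<le> 1 / ((cmod z)\<^sup>2 / 41)"
      using n_bounds(2) z0 n1 by (intro divide_left_mono mult_pos_pos) auto
    then show ?thesis by simp
  qed
  define Q where "Q = \<kappa> / lam / cmod z ^ 4"
  have Q: "0 \<le> Q" using \<kappa> lam by (simp add: Q_def)
  have z45: "\<kappa> / lam / cmod z ^ 5 \<le> Q"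
    unfolding Q_def using zeta kl_pos by (intro divide_left_mono mult_pos_pos power_increasing) auto
  have "M0 / real n = M0 * (1 / real n)" by simp
  also have "\<dots> \<le> M0 * (41 / (cmod z)\<^sup>2)" using inv_n M0 by (intro mult_left_mono) auto
  also have "\<dots> = 328 * (\<kappa> / lam / cmod z ^ 5)"
    using z0 by (simp add: M0_def power_divide power_numeral_reduce)
  also have "\<dots> \<le> 328 * Q" using z45 by simp
  finally have M0n: "M0 / real n \<le> 328 * Q" .
  have "K0 / (real n)\<^sup>2 = K0 * (1 / real n)\<^sup>2" by (simp add: power_divide)
  also have "\<dots> \<le> K0 * (41 / (cmod z)\<^sup>2)\<^sup>2" using inv_n K0 by (intro mult_left_mono power_mono) auto
  also have "\<dots> = 3362 * (\<kappa> / lam / cmod z ^ 5)"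
    using z0 by (simp add: K0_def power_divide power_numeral_reduce)
  also have "\<dots> \<le> 3362 * Q" using z45 by simp
  finally have K0n: "K0 / (real n)\<^sup>2 \<le> 3362 * Q" .
  have "M0 / real n * (24 + 720000 * S') \<le> 328 * Q * (24 + 720000 * S')"
    using M0n S_pos by (intro mult_right_mono) auto
  moreover have "9 * 60000 * K0 / (real n)\<^sup>2 = 540000 * (K0 / (real n)\<^sup>2)" by simp
  ultimately have "\<bar>\<Sum>x\<in>gbox n. kx x * (psi (x - \<sigma>) - psi x)\<bar>
      \<le> 328 * Q * (24 + 720000 * S') + 2 * (540000 * (3362 * Q))"
    unfolding decomp using T1 1 2 K0n by linarith
  also have "\<dots> = 3630967872 * Q + 236160000 * (Q * S')" by (simp add: algebra_simps)
  also have "\<dots> \<le> 10^11 * Q + 10^11 * (Q * S')"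
    using Q S_pos mult_nonneg_nonneg[of Q S'] by (intro add_mono mult_right_mono) auto
  also have "\<dots> = 10^11 * (1 + S') * Q" by (simp add: algebra_simps)
  finally show ?thesis by (simp add: Q_def)
qed

section \<open>The truncated predictor and its residuals\<close>

definition c1 :: complex where "c1 = 1 / z - 1 / z'"

text \<open>\<open>slope\<close> is the source increment of \<open>Ghat1s\<close>: the imaginary linear term of \<open>E\<close> at the tip is
  \<open>- slope / 2 * Im Z\<close>, and \<open>w\<close> contains the corrector that makes it discretely harmonic.\<close>

definition slope :: real where "slope = 1 / (2 * pi) * Im c1"

definition w :: "complex \<Rightarrow> real" where
  "w Z = cutN (cmod z ^ 6) Z * E Z + cutN ((cmod z)\<^sup>2 / 12) Z * (slope / 2 * g Z)"

lemma slope_bound: "\<bar>slope\<bar> \<le> 1 / cmod z ^ 3"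
proof -
  have zz: "1 / cmod z \<le> cmod z / 2" using big z0 by (simp add: divide_simps power2_eq_square)
  have z': "cmod z / 2 \<le> cmod z'"
    using norm_triangle_ineq2[of z "z - z'"] z'_diff zz by (simp add: norm_minus_commute)
  then have "z' \<noteq> 0" using z0 by auto
  then have "c1 = (z' - z) / (z * z')" using z0 by (simp add: c1_def field_simps)
  then have "cmod c1 \<le> (1 / cmod z) / (cmod z * (cmod z / 2))"
    using z'_diff z' z0 by (simp only: norm_divide norm_mult) (intro frac_le mult_left_mono mult_pos_pos, auto)
  also have "\<dots> = 2 / cmod z ^ 3" using z0 by (simp add: power3_eq_cube)
  finally have "\<bar>Im c1\<bar> \<le> 2 / cmod z ^ 3" using abs_Im_le_cmod[of c1] by linarith
  moreover have "\<bar>1 / (2 * pi)\<bar> \<le> 1 / 2" using pi_gt3 by (simp add: divide_simps)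
  ultimately have "\<bar>slope\<bar> \<le> 1 / 2 * (2 / cmod z ^ 3)"
    unfolding slope_def abs_mult by (intro mult_mono) auto
  then show ?thesis by simp
qed

text \<open>Here \<open>E\<close> is of order 1/(|z| |Z|), and the commutator costs B/N with B of
  order |z|^3. The choice N = |z|^6 is what brings the product 1/|z| times |z|^3/N down to
  |z|^-4.\<close>

lemma commutator_outer:
  assumes M: "2 * cmod z ^ 6 + 3 \<le> M"
  shows "\<bar>\<Sum>Z\<in>covball M. k Z * (lap (\<lambda>Z. cutN (cmod z ^ 6) Z * E Z) Z - cutN (cmod z ^ 6) Z * lap E Z)\<bar>
    \<le> 128 * S * (\<kappa> / lam / cmod z ^ 4)"
proof -
  define N where "N = cmod z ^ 6"
  have z6: "10000000000 * (cmod z)\<^sup>2 \<le> N"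
  proof -
    have "(100000::real) ^ 2 \<le> ((cmod z)\<^sup>2) ^ 2" using big by (intro power_mono) auto
    then have "(cmod z)\<^sup>2 * 10^10 \<le> (cmod z)\<^sup>2 * ((cmod z)\<^sup>2) ^ 2" by (intro mult_left_mono) auto
    then show ?thesis by (simp add: N_def flip: power_mult power_add)
  qed
  have N1: "1 \<le> N" using z6 big by simp
  have far: "2 * cmod z \<le> cmod Z" if "N - 1 \<le> (cmod Z)\<^sup>2" for Z
  proof (rule power2_le_imp_le)
    show "(2 * cmod z)\<^sup>2 \<le> (cmod Z)\<^sup>2" using that z6 big by (simp add: power_mult_distrib)
  qed simp
  have E: "\<bar>E Z\<bar> \<le> 16 / cmod z / cmod Z"
    "\<rho> \<in> dirs \<Longrightarrow> \<bar>E (step \<rho> Z) - E Z\<bar> \<le> 16 / cmod z / cmod Z ^ 3"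
    if Z: "Z \<in> cov" "N - 1 \<le> (cmod Z)\<^sup>2" for Z \<rho>
  proof -
    have Z0: "Z \<noteq> 0" "0 < cmod Z" using cov_nonzero[OF Z(1)] by auto
    note Z2 = far[OF Z(2)]
    have D: "cmod Z / 2 \<le> cmod (Z - z)" using norm_triangle_ineq2[of Z z] Z2 by linarith
    have Z16: "(cmod z)\<^sup>2 / 16 \<le> (cmod Z)\<^sup>2" using Z(2) z6 big by linarith
    have D': "cmod z / 250 \<le> cmod (Z - z)" using D Z2 z0 by linarith
    have "cmod z * cmod z \<le> cmod z * cmod (Z - z)" using D Z2 by (intro mult_left_mono) auto
    then have b1: "4 \<le> cmod z * cmod (Z - z)" using big by (simp add: power2_eq_square)
    have b2: "8 \<le> 1/2 * (cmod Z)\<^sup>2" using Z(2) z6 big by linarith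
    have b3: "1/2 * cmod Z \<le> cmod (Z - z)" using D by simp
    note b = dF_bounds[OF Z0(1) z0(1) z'_diff _ _ b3 b1 b2]
    have "\<bar>E Z\<bar> \<le> 1 / (cmod z * cmod (Z - z))"
      using b(3) E_step_eq_dF(2)[OF Z(1) Z16 D', of 1] by simp
    also have "\<dots> \<le> 1 / (cmod z * (cmod Z / 2))"
      using D z0 Z0 by (intro divide_left_mono mult_left_mono mult_pos_pos) auto
    also have "\<dots> = 2 / cmod z / cmod Z" by simp
    also have "\<dots> \<le> 16 / cmod z / cmod Z" by (intro divide_right_mono) auto
    finally show "\<bar>E Z\<bar> \<le> 16 / cmod z / cmod Z" .
    assume \<rho>: "\<rho> \<in> dirs"
    have "\<bar>E (step \<rho> Z) - E Z\<bar> \<le> 4 / (cmod z * cmod (Z - z) * (1/2 * (cmod Z)\<^sup>2))"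
      using b(2)[OF _ _ \<rho>] E_step_eq_dF[OF Z(1) Z16 D' \<rho>] by simp
    also have "\<dots> \<le> 4 / (cmod z * (cmod Z / 2) * (1/2 * (cmod Z)\<^sup>2))"
      using D z0 Z0 by (intro divide_left_mono mult_right_mono mult_left_mono mult_pos_pos) auto
    also have "\<dots> = 16 / cmod z / cmod Z ^ 3" by (simp add: power2_eq_square power3_eq_cube)
    finally show "\<bar>E (step \<rho> Z) - E Z\<bar> \<le> 16 / cmod z / cmod Z ^ 3" .
  qed
  have lamN: "5/4 * lam\<^sup>2 \<le> N - 1" using lam z6 big zero_le_power2[of lam] by linarith
  have "\<bar>\<Sum>Z\<in>covball M. k Z * (lap (\<lambda>Z. cutN N Z * E Z) Z - cutN N Z * lap E Z)\<bar>
    \<le> 4 * (16 / cmod z) * (\<kappa> / lam) * (2 * cmod z ^ 3) * S / N"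
  proof (rule cutN_commutator)
    show "0 < N" using N1 by linarith
    show "2 * N + 1 \<le> M" using M by (simp add: N_def)
    show "2 * N + 1 \<le> (2 * cmod z ^ 3)\<^sup>2" using N1 by (simp add: N_def power_mult_distrib flip: power_mult)
    show "0 \<le> \<kappa> / lam" using kl_pos by simp
    fix Z assume Z: "Z \<in> cov" "N - 1 \<le> (cmod Z)\<^sup>2" "(cmod Z)\<^sup>2 \<le> 2 * N + 1"
    show "\<bar>E Z\<bar> \<le> 16 / cmod z / cmod Z" by (rule E(1)[OF Z(1,2)])
    show "\<bar>k Z\<bar> \<le> \<kappa> / lam / cmod Z" using Z lamN by (intro k_far) (auto simp: N_def)
    fix \<rho> assume \<rho>: "\<rho> \<in> dirs"
    show "\<bar>E (step \<rho> Z) - E Z\<bar> \<le> 16 / cmod z / cmod Z ^ 3" by (rule E(2)[OF Z(1,2) \<rho>])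
    show "\<bar>k (step \<rho> Z) - k Z\<bar> \<le> \<kappa> / lam / cmod Z ^ 3"
      using Z lamN by (intro k_diff \<rho>) (auto simp: N_def)
  qed (use S in auto)
  also have "\<dots> = 128 * S * (\<kappa> / lam / cmod z ^ 4)"
    using z0 by (simp add: N_def power_numeral_reduce)
  finally show ?thesis by (simp add: N_def)
qed

text \<open>The corrector can be cut off already at |Z|^2 of order |z|^2: \<open>slope\<close>
  supplies |z|^-3, and B/N is of order 1/|z|.\<close>

lemma commutator_inner:
  assumes M: "2 * cmod z ^ 6 + 3 \<le> M"
  shows "\<bar>\<Sum>Z\<in>covball M. k Z * (lap (\<lambda>Z. cutN ((cmod z)\<^sup>2 / 12) Z * (slope / 2 * g Z)) Z
      - cutN ((cmod z)\<^sup>2 / 12) Z * lap (\<lambda>Z. slope / 2 * g Z) Z)\<bar>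
    \<le> 48 * A * S * (\<kappa> / lam / cmod z ^ 4)"
proof -
  define N where "N = (cmod z)\<^sup>2 / 12"
  have N1: "1 \<le> N" using big by (simp add: N_def)
  have NM: "2 * N + 1 \<le> (cmod z)\<^sup>2" using big by (simp add: N_def)
  have lamN: "5/4 * lam\<^sup>2 \<le> N - 1" using lam big unfolding N_def by linarith
  have s: "\<bar>slope / 2 * x\<bar> \<le> A / cmod z ^ 3 / y" if "\<bar>x\<bar> \<le> A / y" "0 < y" for x y
  proof -
    have "\<bar>slope / 2 * x\<bar> \<le> (1 / cmod z ^ 3) * (A / y)"
      unfolding abs_mult using that slope_bound A by (intro mult_mono) auto
    then show ?thesis by (simp add: mult_ac)
  qed
  have "\<bar>\<Sum>Z\<in>covball M. k Z * (lap (\<lambda>Z. cutN N Z * (slope / 2 * g Z)) Z - cutN N Z * lap (\<lambda>Z. slope / 2 * g Z) Z)\<bar>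
    \<le> 4 * (A / cmod z ^ 3) * (\<kappa> / lam) * cmod z * S / N"
  proof (rule cutN_commutator)
    show "0 < N" "2 * N + 1 \<le> (cmod z)\<^sup>2" using N1 NM by simp_all
    show "2 * N + 1 \<le> M" using NM M z_power_mono zero_le_power2[of "cmod z"] by linarith
    show "0 \<le> \<kappa> / lam" "0 \<le> A / cmod z ^ 3" using kl_pos A by simp_all
    fix Z assume Z: "Z \<in> cov" "N - 1 \<le> (cmod Z)\<^sup>2" "(cmod Z)\<^sup>2 \<le> 2 * N + 1"
    have Z0: "0 < cmod Z" using cov_nonzero[OF Z(1)] by simp
    have Zz: "(cmod Z)\<^sup>2 \<le> (cmod z)\<^sup>2" "(cmod Z)\<^sup>2 \<le> 2 * cmod z ^ 6 + 1"
      using Z NM z_power_mono zero_le_power2[of "cmod z"] by linarith+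
    show "\<bar>slope / 2 * g Z\<bar> \<le> A / cmod z ^ 3 / cmod Z" using g[OF Z(1) Zz(1)] Z0 by (rule s)
    show "\<bar>k Z\<bar> \<le> \<kappa> / lam / cmod Z" using Z lamN Zz by (intro k_far) auto
    fix \<rho> assume \<rho>: "\<rho> \<in> dirs"
    have "\<bar>slope / 2 * (g (step \<rho> Z) - g Z)\<bar> \<le> A / cmod z ^ 3 / cmod Z ^ 3"
      using g_diff[OF Z(1) \<rho> Zz(1)] Z0 by (intro s) auto
    then show "\<bar>slope / 2 * g (step \<rho> Z) - slope / 2 * g Z\<bar> \<le> A / cmod z ^ 3 / cmod Z ^ 3"
      by (simp only: right_diff_distrib)
    show "\<bar>k (step \<rho> Z) - k Z\<bar> \<le> \<kappa> / lam / cmod Z ^ 3"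
      using Z lamN Zz by (intro k_diff \<rho>) auto
  qed (use S in auto)
  also have "\<dots> = 48 * A * S * (\<kappa> / lam / cmod z ^ 4)"
    using z0 by (simp add: N_def power_numeral_reduce mult_ac)
  finally show ?thesis by (simp add: N_def)
qed

lemma lap_add: "lap (\<lambda>Z. f Z + h Z) Z = lap f Z + lap h Z"
  by (simp add: lap_def sum.distrib[symmetric] algebra_simps)

lemma lap_cmult: "lap (\<lambda>Z. c * f Z) Z = c * lap f Z"
  by (simp add: lap_def sum_distrib_left right_diff_distrib)

lemma tip_sum:
  assumes M: "2 * cmod z ^ 6 + 3 \<le> M"
  shows "\<bar>\<Sum>Z\<in>covball M. k Z * (cutN ((cmod z)\<^sup>2 / 12) Z * (lap E Z + slope / 2 * lap g Z))\<bar>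
    \<le> 100000 * S * (\<kappa> / lam / cmod z ^ 4)"
proof -
  define N where "N = (cmod z)\<^sup>2 / 12"
  define u where "u W = dF z z' W + (1 / (4 * pi)) * Re ((1 / z - 1 / z') * W)" for W
  define c where "c = Re c1 / (4 * pi)"
  have N0: "0 < N" using z0 by (simp add: N_def)
  have eq: "lap E Z + slope / 2 * lap g Z = lap u Z - c * lap Re Z"
    if Z: "Z \<in> cov" "(cmod Z)\<^sup>2 \<le> 2 * N" for Z
  proof -
    have E: "E W = dF z z' W" if "(cmod W)\<^sup>2 \<le> 2 * N + 1" for W
    proof (rule E_eq_dF)
      have "(cmod W)\<^sup>2 \<le> (cmod z / 2)\<^sup>2" using that big by (simp add: N_def power_divide)
      then have "cmod W \<le> cmod z / 2" by (rule power2_le_imp_le) simp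
      moreover have "1 / cmod z < cmod z / 2" using big z0 by (simp add: divide_simps power2_eq_square)
      ultimately show "1 / cmod z < cmod (W - z)"
        using norm_triangle_ineq2[of z W] by (simp add: norm_minus_commute)
    qed
    have lE: "lap E Z = lap (dF z z') Z"
    proof (rule lap_cong)
      show "E Z = dF z z' Z" using Z by (intro E) auto
      show "E (step \<rho> Z) = dF z z' (step \<rho> Z)" if "\<rho> \<in> dirs" for \<rho>
        using Z step_norm[OF Z(1) that] by (intro E) auto
    qed
    have "u = (\<lambda>W. dF z z' W + (c * Re W + (- (slope / 2)) * Im W))"
      by (auto simp: u_def c_def slope_def c1_def[symmetric] field_simps)
    then have "lap u Z = lap (dF z z') Z + (c * lap Re Z + (- (slope / 2)) * lap Im Z)"
      by (simp only: lap_add lap_cmult)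
    then show ?thesis using lE g_lap[OF Z(1)] by simp
  qed
  have even: "(\<Sum>Z\<in>covball M. (k Z * cutN N Z) * lap Re Z) = 0"
    by (rule sum_even_lap_Re) (simp add: k_even cutN_sheet)
  have "(\<Sum>Z\<in>covball M. k Z * (cutN N Z * (lap E Z + slope / 2 * lap g Z)))
      = (\<Sum>Z\<in>covball M. k Z * cutN N Z * lap u Z - c * ((k Z * cutN N Z) * lap Re Z))"
  proof (rule sum.cong[OF refl])
    fix Z assume Z: "Z \<in> covball M"
    show "k Z * (cutN N Z * (lap E Z + slope / 2 * lap g Z))
      = k Z * cutN N Z * lap u Z - c * ((k Z * cutN N Z) * lap Re Z)"
    proof (cases "(cmod Z)\<^sup>2 \<le> 2 * N")
      case True
      have "Z \<in> cov" using Z by (simp add: covball_def)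
      from eq[OF this True] show ?thesis by (simp only:) (simp add: algebra_simps)
    next
      case False
      then show ?thesis using cutN_eq_0[OF N0, of Z] by simp
    qed
  qed
  also have "\<dots> = (\<Sum>Z\<in>covball M. k Z * cutN N Z * lap u Z)"
    by (simp add: sum_subtractf sum_distrib_left[symmetric] even)
  finally have "\<bar>\<Sum>Z\<in>covball M. k Z * (cutN N Z * (lap E Z + slope / 2 * lap g Z))\<bar>
      \<le> (\<Sum>Z\<in>covball M. \<bar>k Z * cutN N Z * lap u Z\<bar>)" by simp
  also have "\<dots> \<le> (\<Sum>Z\<in>covball M. 100000 * (\<kappa> / lam / cmod z ^ 4) * (1 / cmod Z ^ 5))"
  proof (rule sum_mono)
    fix Z assume "Z \<in> covball M"
    then have Z: "Z \<in> cov" by (simp add: covball_def)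
    have Z0: "0 < cmod Z" using cov_nonzero[OF Z] by simp
    show "\<bar>k Z * cutN N Z * lap u Z\<bar> \<le> 100000 * (\<kappa> / lam / cmod z ^ 4) * (1 / cmod Z ^ 5)"
    proof (cases "(cmod Z)\<^sup>2 \<le> 2 * N")
      case True
      \<comment> \<open>The residual |Z|^-6 absorbs the growth |Z| allowed for \<open>k\<close> near
        the tip and leaves exactly the summable |Z|^-5.\<close>
      have "\<bar>lap u Z\<bar> \<le> 100000 / (cmod z ^ 4 * cmod Z ^ 6)"
        unfolding u_def using True big zero_le_power2[of "cmod z"]
        by (intro lap_dF_tip[OF Z _ z'_diff]) (auto simp: N_def)
      moreover have "(cmod Z)\<^sup>2 \<le> (cmod z)\<^sup>2" using True big unfolding N_def by linarith
      then have "\<bar>k Z\<bar> \<le> \<kappa> / lam * cmod Z" by (rule k_tip[OF Z])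
      ultimately have "\<bar>k Z * cutN N Z * lap u Z\<bar>
          \<le> (\<kappa> / lam * cmod Z) * 1 * (100000 / (cmod z ^ 4 * cmod Z ^ 6))"
        unfolding abs_mult using cutN_range[of N Z] kl_pos by (intro mult_mono) auto
      also have "\<dots> = 100000 * (\<kappa> / lam / cmod z ^ 4) * (1 / cmod Z ^ 5)"
        using Z0 by (simp add: power_numeral_reduce mult_ac)
      finally show ?thesis .
    next
      case False
      then have "cutN N Z = 0" using cutN_eq_0[OF N0, of Z] by simp
      then show ?thesis using \<kappa> lam by simp
    qed
  qed
  also have "\<dots> = 100000 * (\<kappa> / lam / cmod z ^ 4) * (\<Sum>Z\<in>covball M. 1 / cmod Z ^ 5)"
    by (simp only: sum_distrib_left)
  also have "\<dots> \<le> 100000 * (\<kappa> / lam / cmod z ^ 4) * S"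
    using \<kappa> lam S[OF finite_covball covball_subset] by (intro mult_left_mono) auto
  finally show ?thesis by (simp add: N_def mult_ac)
qed

text \<open>The kernel and the residual together decay like |Z|^-9. Since |Z| is at least of order
  |z| here, four of these powers become |z|^-4 and five remain for the summation.\<close>

lemma sum_smooth:
  assumes F: "finite F" "F \<subseteq> cov"
    and f: "\<And>Z. Z \<in> F \<Longrightarrow> f Z \<noteq> 0 \<Longrightarrow> (cmod z)\<^sup>2 / 12 \<le> (cmod Z)\<^sup>2 \<and> (cmod Z)\<^sup>2 \<le> 2 * cmod z ^ 6 + 1
      \<and> \<bar>f Z\<bar> \<le> 10^15 / ((cmod z)\<^sup>2 * cmod Z ^ 8)"
  shows "\<bar>\<Sum>Z\<in>F. k Z * f Z\<bar> \<le> 10^18 * S * (\<kappa> / lam / cmod z ^ 4)"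
proof -
  have "\<bar>k Z * f Z\<bar> \<le> 10^18 * (\<kappa> / lam / cmod z ^ 4) * (1 / cmod Z ^ 5)" if Z: "Z \<in> F" for Z
  proof (cases "f Z = 0")
    case True
    then show ?thesis using \<kappa> lam by simp
  next
    case False
    note fZ = f[OF Z False]
    have Zc: "Z \<in> cov" using Z F by auto
    have Z0: "0 < cmod Z" using cov_nonzero[OF Zc] by simp
    have "5/4 * lam\<^sup>2 \<le> (cmod Z)\<^sup>2" using conjunct1[OF fZ] lam(2) zero_le_power2[of lam] by linarith
    then have "\<bar>k Z\<bar> \<le> \<kappa> / lam / cmod Z" using fZ by (intro k_far[OF Zc]) auto
    then have "\<bar>k Z * f Z\<bar> \<le> (\<kappa> / lam / cmod Z) * (10^15 / ((cmod z)\<^sup>2 * cmod Z ^ 8))"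
      unfolding abs_mult using fZ kl_pos by (intro mult_mono) auto
    also have "\<dots> = (10^15 * (\<kappa> / lam) / (cmod z)\<^sup>2 * (1 / cmod Z ^ 5)) * (1 / ((cmod Z)\<^sup>2)\<^sup>2)"
      using Z0 by (simp add: power_numeral_reduce mult_ac)
    also have "\<dots> \<le> (10^15 * (\<kappa> / lam) / (cmod z)\<^sup>2 * (1 / cmod Z ^ 5)) * (1 / ((cmod z)\<^sup>2 / 12)\<^sup>2)"
      using fZ z0 Z0 \<kappa> lam
      by (intro mult_left_mono divide_left_mono power_mono mult_pos_pos mult_nonneg_nonneg divide_nonneg_nonneg) auto
    also have "\<dots> = 144 * 10^15 * (\<kappa> / lam / cmod z ^ 6) * (1 / cmod Z ^ 5)"
      using z0 by (simp add: power_divide power_numeral_reduce)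
    also have "\<dots> \<le> 10^18 * (\<kappa> / lam / cmod z ^ 4) * (1 / cmod Z ^ 5)"
    proof (intro mult_right_mono[OF mult_mono])
      show "\<kappa> / lam / cmod z ^ 6 \<le> \<kappa> / lam / cmod z ^ 4"
        using zeta kl_pos by (intro divide_left_mono mult_pos_pos power_increasing) auto
    qed (use \<kappa> lam in auto)
    finally show ?thesis .
  qed
  then have "\<bar>\<Sum>Z\<in>F. k Z * f Z\<bar> \<le> (\<Sum>Z\<in>F. 10^18 * (\<kappa> / lam / cmod z ^ 4) * (1 / cmod Z ^ 5))"
    by (intro order_trans[OF sum_abs sum_mono])
  also have "\<dots> = 10^18 * (\<kappa> / lam / cmod z ^ 4) * (\<Sum>Z\<in>F. 1 / cmod Z ^ 5)"
    by (simp only: sum_distrib_left)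
  also have "\<dots> \<le> 10^18 * (\<kappa> / lam / cmod z ^ 4) * S"
    using \<kappa> lam F by (intro mult_left_mono S) auto
  finally show ?thesis by (simp add: mult_ac)
qed

lemma near_subset:
  assumes "Z \<in> near"
  shows "Z \<in> cov" "3/4 * (cmod z)\<^sup>2 \<le> (cmod Z)\<^sup>2" "(cmod Z)\<^sup>2 \<le> 5/4 * (cmod z)\<^sup>2"
proof -
  obtain x where x: "x \<in> gbox n" "Z = step x z" using assms by (auto simp: near_def)
  have "x \<in> gbox (2 * n + 1)" using box_mono[OF _ x(1)] by simp
  note c = chart[OF chart_box'[OF this]]
  show "Z \<in> cov" "3/4 * (cmod z)\<^sup>2 \<le> (cmod Z)\<^sup>2" "(cmod Z)\<^sup>2 \<le> 5/4 * (cmod z)\<^sup>2"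
    using c(1,3,4) x(2) by simp_all
qed

text \<open>The unit masses contained in the two translates of \<open>psi\<close> yield the
  increment of \<open>k\<close> from z to z', which in the end is the mixed difference of G. The
  convolution with \<open>psi\<close> and the contribution of the mirror pole remain.\<close>

lemma near_sum:
  "\<bar>2 * (\<Sum>Z\<in>near. k Z * lap E Z) + (k z' - k z)\<bar>
    \<le> (2 * 10^18 * S + 10^11 * (1 + S')) * (\<kappa> / lam / cmod z ^ 4)"
proof -
  have inj: "inj_on (\<lambda>x. step x z) (gbox n)"
  proof (rule inj_onI)
    fix x y assume "step x z = step y z"
    then have "z\<^sup>2 + x = z\<^sup>2 + y" using step_square[OF z] by metis
    then show "x = y" by simp
  qed
  have lapE: "lap E (step x z) = flap Fundsol (x - \<sigma>) - flap Fundsol x - lap (dF (- z) (- z')) (step x z)"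
    if x: "x \<in> gbox n" for x
  proof -
    have b: "x \<in> gbox (2 * n + 1)" using box_mono[OF _ x] by simp
    have b': "x + \<rho> \<in> gbox (2 * n + 1)" if "\<rho> \<in> dirs" for \<rho>
      using box_mono[OF _ box_add_dirs[OF x that], of "2 * n + 1"] by simp
    have "lap E (step x z) = (\<Sum>\<rho>\<in>dirs. (Fundsol (x + \<rho> - \<sigma>) - Fundsol (x + \<rho>) - dF (- z) (- z') (step \<rho> (step x z)))
       - (Fundsol (x - \<sigma>) - Fundsol x - dF (- z) (- z') (step x z)))"
      unfolding lap_def
    proof (rule sum.cong[OF refl])
      fix \<rho> assume \<rho>: "\<rho> \<in> dirs"
      show "E (step \<rho> (step x z)) - E (step x z) =
        (Fundsol (x + \<rho> - \<sigma>) - Fundsol (x + \<rho>) - dF (- z) (- z') (step \<rho> (step x z)))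
         - (Fundsol (x - \<sigma>) - Fundsol x - dF (- z) (- z') (step x z))"
        using E_chart[OF chart_box'[OF b]] E_chart[OF chart_box'[OF b'[OF \<rho>]]]
          chart(5)[OF chart_box'[OF b] \<rho>] by simp
    qed
    also have "\<dots> = flap Fundsol (x - \<sigma>) - flap Fundsol x - lap (dF (- z) (- z')) (step x z)"
      by (simp add: lap_def flap_def sum_subtractf diff_add_eq add_diff_eq)
    finally show ?thesis .
  qed
  have psi2: "2 * flap Fundsol x = psi x - (if x = 0 then 1 else 0)" for x
    by (simp add: psi_def)
  have zero: "0 \<in> gbox n" by (simp add: gbox_def gint_def)
  have \<sigma>_box: "\<sigma> \<in> gbox n"
    using box_mono[OF _ box_add_dirs[of 0 0 \<sigma>], of n] n_bounds(3) \<sigma> by (simp add: gbox_def gint_def)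
  have delta: "(\<Sum>x\<in>gbox n. kx x * (if x = y then 1 else 0)) = kx y" if "y \<in> gbox n" for y
  proof -
    have "(\<Sum>x\<in>gbox n. kx x * (if x = y then 1 else 0)) = (\<Sum>x\<in>gbox n. if x = y then kx y else 0)"
      by (intro sum.cong) auto
    then show ?thesis using that by simp
  qed
  have "2 * (\<Sum>Z\<in>near. k Z * lap E Z) = (\<Sum>x\<in>gbox n. 2 * (kx x * lap E (step x z)))"
    unfolding near_def by (simp add: sum.reindex[OF inj] kx_def sum_distrib_left)
  also have "\<dots> = (\<Sum>x\<in>gbox n. kx x * (psi (x - \<sigma>) - psi x)
      - (kx x * (if x = \<sigma> then 1 else 0) - kx x * (if x = 0 then 1 else 0))
      - 2 * (kx x * lap (dF (- z) (- z')) (step x z)))"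
  proof (rule sum.cong[OF refl])
    fix x assume x: "x \<in> gbox n"
    have "2 * (kx x * lap E (step x z)) = kx x * (2 * flap Fundsol (x - \<sigma>) - 2 * flap Fundsol x)
       - 2 * (kx x * lap (dF (- z) (- z')) (step x z))"
      unfolding lapE[OF x] by (simp add: algebra_simps)
    then show "2 * (kx x * lap E (step x z)) = kx x * (psi (x - \<sigma>) - psi x)
      - (kx x * (if x = \<sigma> then 1 else 0) - kx x * (if x = 0 then 1 else 0))
      - 2 * (kx x * lap (dF (- z) (- z')) (step x z))"
      unfolding psi2 by (simp add: algebra_simps)
  qed
  also have "\<dots> = (\<Sum>x\<in>gbox n. kx x * (psi (x - \<sigma>) - psi x)) - (kx \<sigma> - kx 0)
      - 2 * (\<Sum>x\<in>gbox n. kx x * lap (dF (- z) (- z')) (step x z))"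
    by (simp only: sum_subtractf sum_distrib_left delta[OF zero] delta[OF \<sigma>_box])
  also have "(\<Sum>x\<in>gbox n. kx x * lap (dF (- z) (- z')) (step x z)) = (\<Sum>Z\<in>near. k Z * lap (dF (- z) (- z')) Z)"
    unfolding near_def by (simp add: sum.reindex[OF inj] kx_def)
  finally have eq: "2 * (\<Sum>Z\<in>near. k Z * lap E Z) + (k z' - k z)
      = (\<Sum>x\<in>gbox n. kx x * (psi (x - \<sigma>) - psi x)) - 2 * (\<Sum>Z\<in>near. k Z * lap (dF (- z) (- z')) Z)"
    by (simp add: kx_def z'_def)
  have "\<bar>\<Sum>Z\<in>near. k Z * lap (dF (- z) (- z')) Z\<bar> \<le> 10^18 * S * (\<kappa> / lam / cmod z ^ 4)"
  proof (rule sum_smooth)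
    show "finite near" "near \<subseteq> cov" using near_subset(1) by (auto simp: near_def)
    fix Z assume Z: "Z \<in> near"
    show "(cmod z)\<^sup>2 / 12 \<le> (cmod Z)\<^sup>2 \<and> (cmod Z)\<^sup>2 \<le> 2 * cmod z ^ 6 + 1
      \<and> \<bar>lap (dF (- z) (- z')) Z\<bar> \<le> 10^15 / ((cmod z)\<^sup>2 * cmod Z ^ 8)"
      using near_subset[OF Z] lap_mirror_near[OF Z] z_power_mono zero_le_power2[of "cmod z"]
      by (intro conjI) linarith+
  qed
  then have "\<bar>2 * (\<Sum>Z\<in>near. k Z * lap E Z) + (k z' - k z)\<bar>
      \<le> 10^11 * (1 + S') * (\<kappa> / lam / cmod z ^ 4) + 2 * (10^18 * S * (\<kappa> / lam / cmod z ^ 4))"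
    unfolding eq using sum_psi_convolution by linarith
  then show ?thesis by (simp add: algebra_simps)
qed

text \<open>\<open>lap w\<close> splits into the commutators of the two cut-offs (\<open>X1\<close>,
  \<open>X2\<close>), the tip region, where \<open>E\<close> and the corrector are combined
  (\<open>X3\<close>), and the residual of \<open>E\<close> in between, away from the source
  (\<open>X4\<close>) and near it (\<open>X5\<close>). Only \<open>X5\<close> is not small, and its
  main part is cancelled by \<open>k z' - k z\<close>.\<close>

lemma core_bound:
  assumes M: "2 * cmod z ^ 6 + 3 \<le> M"
  shows "\<bar>2 * (\<Sum>Z\<in>covball M. k Z * lap w Z) + (k z' - k z)\<bar>
    \<le> 10^20 * (1 + A) * (1 + S + S') * (\<kappa> / lam / cmod z ^ 4)"
proof -
  define N N' where "N = cmod z ^ 6" and "N' = (cmod z)\<^sup>2 / 12"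
  define Q where "Q = \<kappa> / lam / cmod z ^ 4"
  have Q: "0 \<le> Q" using \<kappa> lam by (simp add: Q_def)
  have N0: "0 < N" "0 < N'" using z0 by (simp_all add: N_def N'_def)
  define X1 where "X1 = (\<Sum>Z\<in>covball M. k Z * (lap (\<lambda>Z. cutN N Z * E Z) Z - cutN N Z * lap E Z))"
  define X2 where "X2 = (\<Sum>Z\<in>covball M. k Z * (lap (\<lambda>Z. cutN N' Z * (slope / 2 * g Z)) Z
      - cutN N' Z * lap (\<lambda>Z. slope / 2 * g Z) Z))"
  define X3 where "X3 = (\<Sum>Z\<in>covball M. k Z * (cutN N' Z * (lap E Z + slope / 2 * lap g Z)))"
  define X4 where "X4 = (\<Sum>Z\<in>covball M - near. k Z * ((cutN N Z - cutN N' Z) * lap E Z))"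
  define X5 where "X5 = (\<Sum>Z\<in>near. k Z * lap E Z)"
  have near_sub: "near \<subseteq> covball M"
  proof
    fix Z assume Z: "Z \<in> near"
    show "Z \<in> covball M"
      using near_subset[OF Z] M z_power_mono zero_le_power2[of "cmod z"] by (simp add: covball_def)
  qed
  have one: "cutN N Z - cutN N' Z = 1" if Z: "Z \<in> near" for Z
  proof -
    have "2 * N' \<le> (cmod Z)\<^sup>2" using near_subset(2)[OF Z] zero_le_power2[of "cmod z"] unfolding N'_def by linarith
    then have "cutN N' Z = 0" by (rule cutN_eq_0[OF N0(2)])
    moreover have "cmod z ^ 6 = (cmod z)\<^sup>2 * cmod z ^ 4" by (simp flip: power_add)
    moreover have "(cmod z)\<^sup>2 * 2 \<le> (cmod z)\<^sup>2 * cmod z ^ 4"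
      using power_mono[of 100 "cmod z" 4] zeta by (intro mult_left_mono) auto
    ultimately show ?thesis
      using near_subset(3)[OF Z] cutN_eq_1[OF N0(1), of Z] zero_le_power2[of "cmod z"] by (simp add: N_def)
  qed
  have "lap w Z = (lap (\<lambda>Z. cutN N Z * E Z) Z - cutN N Z * lap E Z)
     + (lap (\<lambda>Z. cutN N' Z * (slope / 2 * g Z)) Z - cutN N' Z * lap (\<lambda>Z. slope / 2 * g Z) Z)
     + cutN N' Z * (lap E Z + slope / 2 * lap g Z) + (cutN N Z - cutN N' Z) * lap E Z" for Z
    unfolding w_def[abs_def] N_def[symmetric] N'_def[symmetric] lap_add lap_cmult[of "slope / 2"]
    by (simp add: algebra_simps)
  then have "(\<Sum>Z\<in>covball M. k Z * lap w Z) = X1 + X2 + X3 + (\<Sum>Z\<in>covball M. k Z * ((cutN N Z - cutN N' Z) * lap E Z))"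
    unfolding X1_def X2_def X3_def by (simp only: distrib_left sum.distrib)
  also have "(\<Sum>Z\<in>covball M. k Z * ((cutN N Z - cutN N' Z) * lap E Z)) = X4 + X5"
    unfolding X4_def X5_def sum.subset_diff[OF near_sub finite_covball] using one by simp
  finally have eq: "(\<Sum>Z\<in>covball M. k Z * lap w Z) = X1 + X2 + X3 + (X4 + X5)" .
  have X1: "\<bar>X1\<bar> \<le> 128 * S * Q" unfolding X1_def Q_def N_def by (rule commutator_outer[OF M])
  have X2: "\<bar>X2\<bar> \<le> 48 * A * S * Q" unfolding X2_def Q_def N'_def by (rule commutator_inner[OF M])
  have X3: "\<bar>X3\<bar> \<le> 100000 * S * Q" unfolding X3_def Q_def N'_def by (rule tip_sum[OF M])
  have X4: "\<bar>X4\<bar> \<le> 10^18 * S * Q"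
    unfolding X4_def Q_def
  proof (rule sum_smooth)
    show "finite (covball M - near)" by simp
    show "covball M - near \<subseteq> cov" by (auto simp: covball_def)
    fix Z assume Z: "Z \<in> covball M - near" and nz: "(cutN N Z - cutN N' Z) * lap E Z \<noteq> 0"
    have Zc: "Z \<in> cov" "Z \<notin> near" using Z by (auto simp: covball_def)
    have "cmod z ^ 2 \<le> cmod z ^ 6" using zeta by (intro power_increasing) auto
    then have N'N: "N' \<le> N" using zero_le_power2[of "cmod z"] unfolding N_def N'_def by linarith
    have lo: "N' \<le> (cmod Z)\<^sup>2"
      using nz cutN_eq_1[OF N0(1), of Z] cutN_eq_1[OF N0(2), of Z] N'N by fastforce
    have hi: "(cmod Z)\<^sup>2 \<le> 2 * N"
      using nz cutN_eq_0[OF N0(1), of Z] cutN_eq_0[OF N0(2), of Z] N'N by fastforce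
    have "\<bar>(cutN N Z - cutN N' Z) * lap E Z\<bar> \<le> 1 * (10^15 / ((cmod z)\<^sup>2 * cmod Z ^ 8))"
      unfolding abs_mult using lap_E_away[OF Zc] lo cutN_range[of N Z] cutN_range[of N' Z]
      by (intro mult_mono) (auto simp: N'_def)
    then show "(cmod z)\<^sup>2 / 12 \<le> (cmod Z)\<^sup>2 \<and> (cmod Z)\<^sup>2 \<le> 2 * cmod z ^ 6 + 1 \<and>
      \<bar>(cutN N Z - cutN N' Z) * lap E Z\<bar> \<le> 10^15 / ((cmod z)\<^sup>2 * cmod Z ^ 8)"
      using lo hi by (simp add: N_def N'_def)
  qed
  have X5: "\<bar>2 * X5 + (k z' - k z)\<bar> \<le> (2 * 10^18 * S + 10^11 * (1 + S')) * Q"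
    unfolding X5_def Q_def by (rule near_sum)
  have "\<bar>2 * (\<Sum>Z\<in>covball M. k Z * lap w Z) + (k z' - k z)\<bar>
    \<le> 2 * \<bar>X1\<bar> + 2 * \<bar>X2\<bar> + 2 * \<bar>X3\<bar> + 2 * \<bar>X4\<bar> + \<bar>2 * X5 + (k z' - k z)\<bar>"
  proof -
    define Y where "Y = 2 * X5 + (k z' - k z)"
    have "2 * (X1 + X2 + X3 + (X4 + X5)) + (k z' - k z) = 2 * X1 + 2 * X2 + 2 * X3 + 2 * X4 + Y"
      by (simp add: Y_def)
    then show ?thesis
      unfolding eq Y_def[symmetric]
      using abs_triangle_ineq[of "2 * X1 + 2 * X2 + 2 * X3 + 2 * X4" Y]
        abs_triangle_ineq[of "2 * X1 + 2 * X2 + 2 * X3" "2 * X4"]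
        abs_triangle_ineq[of "2 * X1 + 2 * X2" "2 * X3"] abs_triangle_ineq[of "2 * X1" "2 * X2"]
      by (simp only: abs_mult abs_numeral)
  qed
  also have "\<dots> \<le> 2 * (128 * S * Q) + 2 * (48 * A * S * Q) + 2 * (100000 * S * Q) + 2 * (10^18 * S * Q)
     + (2 * 10^18 * S + 10^11 * (1 + S')) * Q"
    using X1 X2 X3 X4 X5 by linarith
  also have "\<dots> = (4 * 10^18 + 200256) * (S * Q) + 96 * (A * (S * Q)) + 10^11 * Q + 10^11 * (S' * Q)"
    by (simp add: algebra_simps)
  also have "\<dots> \<le> 10^20 * (S * Q) + 10^20 * (A * (S * Q)) + 10^20 * Q + 10^20 * (S' * Q)
     + 10^20 * (A * Q) + 10^20 * (A * (S' * Q))"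
  proof -
    have "0 \<le> S * Q" "0 \<le> A * (S * Q)" "0 \<le> S' * Q" "0 \<le> A * Q" "0 \<le> A * (S' * Q)"
      using S_pos Q A by simp_all
    moreover have "(4 * 10^18 + 200256) * a + 96 * b + 10^11 * q + 10^11 * c
        \<le> 10^20 * a + 10^20 * b + 10^20 * q + 10^20 * c + 10^20 * d + 10^20 * e"
      if "0 \<le> a" "0 \<le> b" "0 \<le> c" "0 \<le> d" "0 \<le> e" "0 \<le> q" for a b c d e q :: real
      using that by simp
    ultimately show ?thesis using Q by blast
  qed
  also have "\<dots> = 10^20 * (1 + A) * (1 + S + S') * Q"
    by (simp add: algebra_simps)
  finally show ?thesis by (simp add: Q_def)
qed

end

section \<open>Bounds for the kernel along lattice paths\<close>

lemma mixed_norm_ge: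
  assumes "\<rho> \<in> dirs" "\<tau> \<in> dirs"
  shows "\<bar>v \<rho> \<tau>\<bar> \<le> mixed_norm v"
proof -
  have "(v \<rho> \<tau>)\<^sup>2 \<le> (\<Sum>\<tau>\<in>dirs. (v \<rho> \<tau>)\<^sup>2)"
    using assms by (intro member_le_sum) auto
  also have "\<dots> \<le> (\<Sum>\<rho>\<in>dirs. \<Sum>\<tau>\<in>dirs. (v \<rho> \<tau>)\<^sup>2)"
    using assms by (intro member_le_sum[of \<rho> dirs "\<lambda>\<rho>. \<Sum>\<tau>\<in>dirs. (v \<rho> \<tau>)\<^sup>2"] sum_nonneg) (auto intro: sum_nonneg)
  finally show ?thesis unfolding mixed_norm_def by (intro real_le_rsqrt) simp
qed

lemma mixed_norm_le:
  assumes "\<And>\<rho> \<tau>. \<rho> \<in> dirs \<Longrightarrow> \<tau> \<in> dirs \<Longrightarrow> \<bar>v \<rho> \<tau>\<bar> \<le> b" "0 \<le> b"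
  shows "mixed_norm v \<le> 4 * b"
proof -
  have "(\<Sum>\<rho>\<in>dirs. \<Sum>\<tau>\<in>dirs. (v \<rho> \<tau>)\<^sup>2) \<le> (\<Sum>\<rho>\<in>dirs. \<Sum>\<tau>\<in>dirs. b\<^sup>2)"
  proof (intro sum_mono)
    fix \<rho> \<tau> assume "\<rho> \<in> dirs" "\<tau> \<in> dirs"
    then have "\<bar>v \<rho> \<tau>\<bar>\<^sup>2 \<le> b\<^sup>2" using assms by (intro power_mono) auto
    then show "(v \<rho> \<tau>)\<^sup>2 \<le> b\<^sup>2" by simp
  qed
  also have "\<dots> = (4 * b)\<^sup>2" by (simp add: power_mult_distrib)
  finally show ?thesis unfolding mixed_norm_def using assms(2) by (intro real_le_lsqrt) auto
qed

lemma omega_dist: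
  "cmod (p - l) \<le> cmod (omega p - omega l) * (cmod (omega p) + cmod (omega l))"
proof -
  have "p - l = (omega p - omega l) * (omega p + omega l)"
  proof -
    have "(a - b) * (a + b) = a\<^sup>2 - b\<^sup>2" for a b :: complex by (simp add: power2_eq_square algebra_simps)
    from this[of "omega p" "omega l"] show ?thesis by simp
  qed
  then have "cmod (p - l) = cmod (omega p - omega l) * cmod (omega p + omega l)"
    by (metis norm_mult)
  also have "\<dots> \<le> cmod (omega p - omega l) * (cmod (omega p) + cmod (omega l))"
    by (intro mult_left_mono norm_triangle_ineq) auto
  finally show ?thesis .
qed

text \<open>The denominator of the decay estimate with exponent 2, after |omega(p) - omega(l)| has
  been replaced by its lower bound |p - l| / (|omega(p)| + |omega(l)|) from
  \<open>omega_dist\<close>.\<close>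

definition sepn :: "complex \<Rightarrow> complex \<Rightarrow> real" where
  "sepn p l = cmod (omega p) * cmod (omega l) * (cmod (p - l))\<^sup>2 / (cmod (omega p) + cmod (omega l))\<^sup>2"

lemma sepn_nonneg: "0 \<le> sepn p l"
  by (simp add: sepn_def)

text \<open>For T <= 2Y the exponent 2 - d differs from 2 by a factor of at most
  \<open>(2 * Y) powr d\<close>, which costs little as long as Y is polynomial in |s|.\<close>

lemma min_powr_ge:
  fixes T Y d :: real
  assumes T: "0 \<le> T" "T \<le> 2 * Y" and Y: "1 \<le> Y" and d: "0 < d"
  shows "T\<^sup>2 \<le> (2 * Y) powr d * min (T\<^sup>2) (T powr (2 - d))"
proof (cases "T = 0")
  case False
  then have T0: "0 < T" using T by simp
  have "1 \<le> (2 * Y) powr d" using Y d by (intro ge_one_powr_ge_zero) auto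
  then have "1 * T\<^sup>2 \<le> (2 * Y) powr d * T\<^sup>2" by (intro mult_right_mono) auto
  moreover have "T powr d * T powr (2 - d) \<le> (2 * Y) powr d * T powr (2 - d)"
    using T0 T d by (intro mult_right_mono powr_mono2) auto
  moreover have "T powr d * T powr (2 - d) = T\<^sup>2"
    using T0 by (simp flip: powr_add)
  ultimately show ?thesis by (simp add: min_def)
qed simp

lemma green_kernel_step:
  assumes G: "crack_green G" and d: "0 < d"
  shows "\<exists>C>0. \<forall>l\<in>lattice. \<forall>\<tau>\<in>dirs_at l. \<forall>p\<in>lattice. \<forall>\<rho>\<in>dirs_at p. \<forall>Y\<ge>1.
    cmod l \<le> Y \<longrightarrow> cmod p \<le> Y \<longrightarrow>
    \<bar>(G (p + \<rho>) (l + \<tau>) - G (p + \<rho>) l) - (G p (l + \<tau>) - G p l)\<bar> \<le> C * (2 * Y) powr d / (1 + sepn p l)"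
proof -
  obtain C where C: "C > 0" "\<And>m s. m \<in> lattice \<Longrightarrow> s \<in> lattice \<Longrightarrow>
    mixed_norm (mixed_grad G m s)
      \<le> C / (1 + cmod (omega m) * cmod (omega s) *
          min ((cmod (omega m - omega s))\<^sup>2) (cmod (omega m - omega s) powr (2 - d)))"
    using G d unfolding crack_green_def by meson
  have "\<bar>(G (p + \<rho>) (l + \<tau>) - G (p + \<rho>) l) - (G p (l + \<tau>) - G p l)\<bar> \<le> C * (2 * Y) powr d / (1 + sepn p l)"
    if l: "l \<in> lattice" "\<tau> \<in> dirs_at l" and p: "p \<in> lattice" "\<rho> \<in> dirs_at p"
      and Y: "1 \<le> Y" "cmod l \<le> Y" "cmod p \<le> Y" for l \<tau> p \<rho> Y
  proof -
    define T where "T = cmod (omega p - omega l)"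
    define P L where "P = cmod (omega p)" and "L = cmod (omega l)"
    define \<Phi> where "\<Phi> = (2 * Y) powr d"
    define m where "m = min (T\<^sup>2) (T powr (2 - d))"
    have PL: "0 < P" "0 < L" using lattice_nonzero[OF p(1)] lattice_nonzero[OF l(1)]
      by (simp_all add: P_def L_def omega_eq_csqrt)
    have "Y \<le> Y\<^sup>2" using Y by (simp add: power2_eq_square)
    then have "P\<^sup>2 \<le> Y\<^sup>2" "L\<^sup>2 \<le> Y\<^sup>2" using Y by (simp_all add: P_def L_def)
    then have "P \<le> Y" "L \<le> Y" using Y by (auto intro: power2_le_imp_le)
    then have T: "0 \<le> T" "T \<le> 2 * Y"
      using norm_triangle_ineq4[of "omega p" "omega l"] by (simp_all add: T_def P_def L_def)
    have \<Phi>: "1 \<le> \<Phi>" unfolding \<Phi>_def using Y d by (intro ge_one_powr_ge_zero) auto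
    have T2: "T\<^sup>2 \<le> \<Phi> * m" unfolding \<Phi>_def m_def by (rule min_powr_ge[OF T Y(1) d])
    have "cmod (p - l) \<le> T * (P + L)" unfolding T_def P_def L_def by (rule omega_dist)
    then have "(cmod (p - l))\<^sup>2 \<le> (T * (P + L))\<^sup>2" by (intro power_mono) auto
    then have "(cmod (p - l))\<^sup>2 / (P + L)\<^sup>2 \<le> T\<^sup>2"
      using PL by (simp add: power_mult_distrib divide_simps)
    then have "P * L * ((cmod (p - l))\<^sup>2 / (P + L)\<^sup>2) \<le> P * L * (\<Phi> * m)"
      using T2 PL by (intro mult_left_mono) auto
    then have X: "sepn p l \<le> \<Phi> * (P * L * m)" by (simp add: sepn_def P_def L_def mult_ac)
    have m0: "0 \<le> P * L * m" using PL by (simp add: m_def)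
    have "\<bar>mixed_grad G p l \<rho> \<tau>\<bar> \<le> mixed_norm (mixed_grad G p l)"
      using l p dirs_at_subset by (intro mixed_norm_ge) auto
    also have "\<dots> \<le> C / (1 + P * L * m)"
      using C(2)[OF p(1) l(1)] by (simp add: P_def L_def m_def T_def)
    also have "\<dots> \<le> C * \<Phi> / (1 + sepn p l)"
    proof -
      have "C * (1 + sepn p l) \<le> C * (\<Phi> * (1 + P * L * m))"
        using X \<Phi> C by (intro mult_left_mono) (auto simp: algebra_simps)
      then show ?thesis using m0 sepn_nonneg[of p l] by (simp add: divide_simps mult_ac add_pos_nonneg)
    qed
    finally show ?thesis using l p by (simp add: mixed_grad_def dgrad_def \<Phi>_def)
  qed
  with C show ?thesis by blast
qed

text \<open>Both P^2 and (P + L)^2 are bounded by multiples of |p - l|, namely by 20 and 40 times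
  it, whose product is the constant 800.\<close>

lemma sepn_far:
  assumes p: "p \<in> lattice" and l: "l \<in> lattice" and far: "cmod p + cmod l \<le> 20 * cmod (p - l)"
  shows "1 / (1 + sepn p l) \<le> 800 / (cmod (omega l) * cmod (omega p) ^ 3)"
proof -
  define P L d where "P = cmod (omega p)" and "L = cmod (omega l)" and "d = cmod (p - l)"
  have PL: "0 < P" "0 < L" using lattice_nonzero[OF p(1)] lattice_nonzero[OF l(1)]
    by (simp_all add: P_def L_def omega_eq_csqrt)
  have d: "P\<^sup>2 + L\<^sup>2 \<le> 20 * d" using far by (simp add: P_def L_def d_def)
  have s: "(P + L)\<^sup>2 \<le> 2 * (P\<^sup>2 + L\<^sup>2)" using sum_squares_bound[of P L] by (simp add: power2_sum)
  have "P\<^sup>2 * (P + L)\<^sup>2 \<le> (P\<^sup>2 + L\<^sup>2) * (2 * (P\<^sup>2 + L\<^sup>2))"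
    using s by (intro mult_mono) auto
  also have "\<dots> = 2 * (P\<^sup>2 + L\<^sup>2)\<^sup>2" by (simp add: power2_eq_square)
  also have "\<dots> \<le> 2 * (20 * d)\<^sup>2" using d by (intro mult_left_mono power_mono) auto
  finally have "P\<^sup>2 * (P + L)\<^sup>2 \<le> 800 * d\<^sup>2" by (simp add: power_mult_distrib)
  then have "(P * L) * (P\<^sup>2 * (P + L)\<^sup>2) \<le> (P * L) * (800 * d\<^sup>2)" using PL by (intro mult_left_mono) auto
  then have "L * P ^ 3 * (P + L)\<^sup>2 \<le> 800 * (P * L * d\<^sup>2)" by (simp add: power3_eq_cube power2_eq_square mult_ac)
  then have "L * P ^ 3 \<le> 800 * sepn p l"
    using PL by (simp add: sepn_def P_def[symmetric] L_def[symmetric] d_def[symmetric] pos_le_divide_eq)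
  then have "L * P ^ 3 \<le> 800 * (1 + sepn p l)" by simp
  then show ?thesis using PL sepn_nonneg[of p l]
    by (simp add: P_def[symmetric] L_def[symmetric] divide_simps mult_ac add_pos_nonneg)
qed

text \<open>If P <= 2L, the two roots are comparable and \<open>sepn\<close> dominates |p - l|^2.
  Otherwise |p - l| is comparable to P^2 and \<open>sepn\<close> dominates only P^3, whence the
  exponent 3/2; any exponent above 1 makes sums along a ray bounded.\<close>

lemma sepn_near:
  assumes p: "p \<in> lattice" and l: "l \<in> lattice" and pl: "cmod l \<le> 2 * cmod p"
  shows "1 / (1 + sepn p l) \<le> 26 * (1 + cmod (p - l)) powr (- 3/2)"
proof -
  define P L d where "P = cmod (omega p)" and "L = cmod (omega l)" and "d = cmod (p - l)"
  have PL: "0 < P" "0 < L" using lattice_nonzero[OF p(1)] lattice_nonzero[OF l(1)]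
    by (simp_all add: P_def L_def omega_eq_csqrt)
  have L2: "1/2 \<le> L\<^sup>2" using lattice_norm[OF l] by (simp add: L_def)
  have d0: "0 \<le> d" by (simp add: d_def)
  have X: "sepn p l = P * L * d\<^sup>2 / (P + L)\<^sup>2" by (simp add: sepn_def P_def L_def d_def)
  have "(1 + d) powr (3/2) \<le> 26 * (1 + sepn p l)"
  proof (cases "P \<le> 2 * L")
    case True
    have "L\<^sup>2 \<le> 2 * P\<^sup>2" using pl by (simp add: P_def L_def)
    moreover have "2 * P\<^sup>2 \<le> (3/2 * P)\<^sup>2" by (simp add: power_mult_distrib power2_eq_square)
    ultimately have "L\<^sup>2 \<le> (3/2 * P)\<^sup>2" by linarith
    then have LP: "L \<le> 3/2 * P" using PL by (auto intro: power2_le_imp_le)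
    have "(P + L)\<^sup>2 \<le> 13 * (P * L)"
    proof -
      have "P * P \<le> (2 * L) * P" "L * L \<le> (3/2 * P) * L" using True LP PL by (intro mult_right_mono; simp)+
      then show ?thesis using mult_pos_pos[OF PL] by (simp add: power2_eq_square algebra_simps)
    qed
    then have "(P + L)\<^sup>2 * d\<^sup>2 \<le> 13 * (P * L) * d\<^sup>2" by (intro mult_right_mono) auto
    then have "d\<^sup>2 \<le> 13 * sepn p l" unfolding X using PL by (simp add: divide_simps mult_ac)
    then have s: "2 + 2 * d\<^sup>2 \<le> 26 * (1 + sepn p l)" by simp
    have "(1 + d) powr (3/2) \<le> (1 + d) powr 2" using d0 by (intro powr_mono) auto
    also have "(1 + d) powr 2 = (1 + d)\<^sup>2" using d0 by simp
    also have "(1 + d)\<^sup>2 \<le> 2 + 2 * d\<^sup>2"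
      using sum_squares_bound[of 1 d] by (simp add: power2_sum)
    also note s
    finally show ?thesis .
  next
    case False
    then have "(2 * L)\<^sup>2 \<le> P\<^sup>2" using PL by (intro power_mono) auto
    then have LP: "4 * L\<^sup>2 \<le> P\<^sup>2" by (simp add: power_mult_distrib)
    have "d \<le> P\<^sup>2 + L\<^sup>2" "P\<^sup>2 \<le> d + L\<^sup>2"
      using norm_triangle_ineq4[of p l] norm_triangle_ineq[of "p - l" l] by (simp_all add: P_def L_def d_def)
    then have d1: "1 + d \<le> 7/4 * P\<^sup>2" and d2: "3/4 * P\<^sup>2 \<le> d" using LP L2 by linarith+
    have "(1 + d) powr (3/2) \<le> (7/4 * P\<^sup>2) powr (3/2)" using d0 d1 by (intro powr_mono2) auto
    also have "\<dots> = (7/4) powr (3/2) * (P\<^sup>2) powr (3/2)" by (subst powr_mult) auto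
    also have "P\<^sup>2 = P powr 2" using PL by simp
    also have "(P powr 2) powr (3/2) = P ^ 3" using PL by (simp only: powr_powr) simp
    also have "(7/4) powr (3/2) * P ^ 3 \<le> (7/4) powr 2 * P ^ 3"
      using PL by (intro mult_right_mono powr_mono) auto
    also have "\<dots> \<le> 4 * P ^ 3" using PL by (simp add: power2_eq_square)
    finally have A: "(1 + d) powr (3/2) \<le> 4 * P ^ 3" .
    have "P ^ 3 \<le> 6 * sepn p l"
    proof -
      have L23: "2/3 \<le> L"
      proof (rule power2_le_imp_le)
        show "(2/3)\<^sup>2 \<le> L\<^sup>2" using L2 by (simp add: power2_eq_square)
      qed (use PL in simp)
      have "(P + L)\<^sup>2 \<le> (3/2 * P)\<^sup>2" using False PL by (intro power_mono) auto
      then have "P\<^sup>2 * (P + L)\<^sup>2 \<le> P\<^sup>2 * (3/2 * P)\<^sup>2" by (intro mult_left_mono) auto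
      also have "\<dots> = 4 * (3/4 * P\<^sup>2)\<^sup>2" by (simp add: power2_eq_square)
      also have "\<dots> \<le> 4 * d\<^sup>2" using d2 by (intro mult_left_mono power_mono) auto
      finally have B: "P\<^sup>2 * (P + L)\<^sup>2 \<le> 4 * d\<^sup>2" .
      have "P ^ 3 * (P + L)\<^sup>2 = P * (P\<^sup>2 * (P + L)\<^sup>2)" by (simp add: power3_eq_cube power2_eq_square)
      also have "\<dots> \<le> P * (4 * d\<^sup>2)" using B PL by (intro mult_left_mono) auto
      also have "\<dots> \<le> P * (6 * L * d\<^sup>2)" using L23 PL by (intro mult_left_mono mult_right_mono) auto
      finally have "P ^ 3 * (P + L)\<^sup>2 \<le> 6 * (P * L * d\<^sup>2)" by (simp add: mult_ac)
      then show ?thesis unfolding X using PL by (simp add: pos_le_divide_eq)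
    qed
    then have "4 * P ^ 3 \<le> 26 * (1 + sepn p l)" using sepn_nonneg[of p l] by simp
    with A show ?thesis by (rule order_trans)
  qed
  then have "1 / (1 + sepn p l) \<le> 26 / (1 + d) powr (3/2)"
    using d0 sepn_nonneg[of p l] by (simp add: divide_simps mult_ac add_pos_nonneg)
  also have "\<dots> = 26 * (1 + d) powr (- 3/2)" using d0 by (simp add: powr_minus_divide)
  finally show ?thesis by (simp add: d_def)
qed

lemma abs_telescope_le:
  fixes f :: "nat \<Rightarrow> real"
  assumes "\<And>j. j < m \<Longrightarrow> \<bar>f (Suc j) - f j\<bar> \<le> e j"
  shows "\<bar>f m - f 0\<bar> \<le> (\<Sum>j<m. e j)"
  using assms
proof (induction m)
  case (Suc m)
  then have "\<bar>f m - f 0\<bar> \<le> (\<Sum>j<m. e j)" "\<bar>f (Suc m) - f m\<bar> \<le> e m" by simp_all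
  then show ?case by simp
qed simp

lemma sum_ray_near:
  "\<exists>C>0. \<forall>m \<alpha>. (\<Sum>j<m. (1 + \<bar>real j - \<alpha>\<bar>) powr (- 3/2)) \<le> C"
  using sum_shift_bounded[of "3/2"] by simp

text \<open>Every site is joined to the common end point \<open>far_pt\<close> by a lattice path that avoids the crack
  and the pole \<open>l\<close>: a ray, vertical and away from the crack or horizontal to the right, up to the
  boundary of the square of half-width \<open>N + 1/2\<close>, and then along that boundary.\<close>

locale kernel_paths =
  fixes K :: "complex \<Rightarrow> real" and l :: complex and D d :: real and N :: nat and C1 C2 :: real
  assumes l: "l \<in> lattice" and N: "4 * cmod l \<le> real N" and D: "0 \<le> D" and d: "0 < d" "d \<le> 1"
    and K: "\<And>p \<rho>. p \<in> lattice \<Longrightarrow> \<rho> \<in> dirs_at p \<Longrightarrow> cmod p \<le> 2 * real N + 1 \<Longrightarrow>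
      \<bar>K (p + \<rho>) - K p\<bar> \<le> D * (1 / (1 + sepn p l))"
    and C1: "\<And>m \<alpha>. (\<Sum>j<m. (1 + \<bar>real j - \<alpha>\<bar>) powr (- (1 + d))) \<le> C1"
    and C2: "\<And>m \<alpha>. (\<Sum>j<m. (1 + \<bar>real j - \<alpha>\<bar>) powr (- 3/2)) \<le> C2"
begin

section \<open>Paths along rays and along the rim of a square\<close>

definition B :: real where "B = real N + 1/2"

definition far_pt :: complex where "far_pt = Complex B (1/2)"

definition \<Lambda> :: real where "\<Lambda> = cmod (omega l)"

lemma \<Lambda>_pos: "0 < \<Lambda>"
  using lattice_nonzero[OF l] by (simp add: \<Lambda>_def omega_eq_csqrt)

lemma C_pos: "0 \<le> C1" "0 \<le> C2"
  using C1[where m = 0 and \<alpha> = 0] C2[where m = 0 and \<alpha> = 0] by simp_all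

lemma N_pos: "2 \<le> real N"
  using N lattice_norm[OF l] by linarith

lemma norm_omega_pos: "p \<in> lattice \<Longrightarrow> 0 < cmod (omega p)"
  using lattice_nonzero[of p] by (simp add: omega_eq_csqrt)

lemma K_far:
  assumes p: "p \<in> lattice" "\<rho> \<in> dirs_at p" "cmod p \<le> 2 * real N + 1" and far: "cmod p + cmod l \<le> 20 * cmod (p - l)"
  shows "\<bar>K (p + \<rho>) - K p\<bar> \<le> 800 * D / \<Lambda> * (1 / cmod (omega p) ^ 3)"
proof -
  have "D * (1 / (1 + sepn p l)) \<le> D * (800 / (cmod (omega l) * cmod (omega p) ^ 3))"
    using D by (intro mult_left_mono sepn_far p l far)
  then show ?thesis using K[OF p] by (simp add: \<Lambda>_def mult.commute)
qed

lemma lattice_shift: "p \<in> lattice \<Longrightarrow> \<rho> \<in> dirs \<Longrightarrow> p + of_nat j * \<rho> \<in> lattice"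
  by (intro gint_lattice) (auto simp: gint_def dirs_def)

lemma path:
  assumes p: "p \<in> lattice" and \<rho>: "\<rho> \<in> dirs"
    and e: "\<And>j. j < m \<Longrightarrow> \<bar>K (p + of_nat j * \<rho> + \<rho>) - K (p + of_nat j * \<rho>)\<bar> \<le> e j"
  shows "\<bar>K (p + of_nat m * \<rho>) - K p\<bar> \<le> (\<Sum>j<m. e j)"
  using abs_telescope_le[of m "\<lambda>j. K (p + of_nat j * \<rho>)" e] e by (simp add: algebra_simps)

lemma rim_step:
  assumes p: "p \<in> lattice" "\<rho> \<in> dirs_at p" "cmod p \<le> 2 * real N + 1" and rim: "B \<le> cmod p"
  shows "\<bar>K (p + \<rho>) - K p\<bar> \<le> 800 * D / \<Lambda> * (1 / (B * sqrt B))"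
proof -
  have B0: "0 < B" by (simp add: B_def)
  have "cmod p \<le> cmod (p - l) + cmod l" using norm_triangle_ineq[of "p - l" l] by simp
  moreover have "4 * cmod l \<le> cmod p" using N rim by (simp add: B_def)
  ultimately have "cmod p + cmod l \<le> 20 * cmod (p - l)" using norm_ge_zero[of p] by linarith
  then have "\<bar>K (p + \<rho>) - K p\<bar> \<le> 800 * D / \<Lambda> * (1 / cmod (omega p) ^ 3)" by (rule K_far[OF p])
  also have "\<dots> \<le> 800 * D / \<Lambda> * (1 / (B * sqrt B))"
  proof (intro mult_left_mono divide_left_mono)
    have s: "sqrt B \<le> cmod (omega p)" 
    proof (rule power2_le_imp_le)
      show "(sqrt B)\<^sup>2 \<le> (cmod (omega p))\<^sup>2" using rim B0 by simp
    qed simp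
    have "B * sqrt B = sqrt B ^ 3" using B0 by (simp add: power3_eq_cube)
    also have "\<dots> \<le> cmod (omega p) ^ 3" using s B0 by (intro power_mono) auto
    finally show "B * sqrt B \<le> cmod (omega p) ^ 3" .
    show "0 < cmod (omega p) ^ 3 * (B * sqrt B)" using norm_omega_pos[OF p(1)] B0 by simp
  qed (use D \<Lambda>_pos in auto)
  finally show ?thesis .
qed

text \<open>At most 2B steps of size B^-3/2 each.\<close>

lemma rim_path:
  assumes p: "p \<in> lattice" and \<rho>: "\<rho> \<in> dirs" and m: "real m \<le> 2 * B"
    and allowed: "\<And>j. j < m \<Longrightarrow> \<rho> \<in> dirs_at (p + of_nat j * \<rho>)"
    and rim: "\<And>j. j < m \<Longrightarrow> B \<le> cmod (p + of_nat j * \<rho>) \<and> cmod (p + of_nat j * \<rho>) \<le> 2 * B"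
  shows "\<bar>K (p + of_nat m * \<rho>) - K p\<bar> \<le> 1600 * D / \<Lambda> / sqrt B"
proof -
  have B0: "0 < B" by (simp add: B_def)
  have "\<bar>K (p + of_nat m * \<rho>) - K p\<bar> \<le> (\<Sum>j<m. 800 * D / \<Lambda> * (1 / (B * sqrt B)))"
  proof (rule path[OF p \<rho>])
    fix j assume j: "j < m"
    show "\<bar>K (p + of_nat j * \<rho> + \<rho>) - K (p + of_nat j * \<rho>)\<bar> \<le> 800 * D / \<Lambda> * (1 / (B * sqrt B))"
      using rim[OF j] by (intro rim_step lattice_shift p \<rho> allowed j) (auto simp: B_def)
  qed
  also have "\<dots> = real m * (800 * D / \<Lambda> * (1 / (B * sqrt B)))" by simp
  also have "\<dots> \<le> (2 * B) * (800 * D / \<Lambda> * (1 / (B * sqrt B)))"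
    using m D \<Lambda>_pos B0 by (intro mult_right_mono) auto
  also have "\<dots> = 1600 * D / \<Lambda> / sqrt B" using B0 by simp
  finally show ?thesis .
qed

lemma half_int_gap:
  assumes "t \<in> lattice" "\<bar>Im t\<bar> \<le> B"
  shows "\<exists>m::nat. real m = B - \<bar>Im t\<bar>"
proof -
  obtain b :: int where b: "Im t = of_int b - 1/2" using assms by (auto simp: lattice_iff)
  show ?thesis
  proof (cases "1 \<le> b")
    case True
    then show ?thesis using assms(2) b by (intro exI[of _ "nat (int N + 1 - b)"]) (auto simp: B_def of_nat_diff)
  next
    case False
    then show ?thesis using assms(2) b by (intro exI[of _ "nat (int N + b)"]) (auto simp: B_def)
  qed
qed

lemma half_int_gap_Re:
  assumes "t \<in> lattice" "Re t \<le> B"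
  shows "\<exists>m::nat. real m = B - Re t"
proof -
  obtain a :: int where a: "Re t = of_int a - 1/2" using assms by (auto simp: lattice_iff)
  then show ?thesis using assms(2) by (intro exI[of _ "nat (int N + 1 - a)"]) (auto simp: B_def)
qed

lemma one_allowed: "1 \<in> dirs_at p"
  by (simp add: dirs_at_iff complex_eq_iff)

lemma up_allowed: "0 < Im p \<Longrightarrow> \<i> \<in> dirs_at p"
  by (simp add: dirs_at_iff complex_eq_iff crack_down_def)

lemma down_allowed: "Im p < 0 \<Longrightarrow> - \<i> \<in> dirs_at p"
  by (simp add: dirs_at_iff complex_eq_iff crack_up_def)

lemma right_allowed: "0 < Re p \<Longrightarrow> \<rho> \<in> dirs \<Longrightarrow> \<rho> \<in> dirs_at p"
  by (simp add: dirs_at_iff crack_up_def crack_down_def)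

lemma right_side:
  assumes q: "q \<in> lattice" "Re q = B" "\<bar>Im q\<bar> \<le> B"
  shows "\<bar>K q - K far_pt\<bar> \<le> 1600 * D / \<Lambda> / sqrt B"
proof -
  have B0: "0 < B" by (simp add: B_def)
  obtain b :: int where b: "Im q = of_int b - 1/2" using q by (auto simp: lattice_iff)
  define \<rho> where "\<rho> = (if 1 \<le> b then - \<i> else \<i>)"
  define m where "m = nat \<bar>b - 1\<bar>"
  have \<rho>: "\<rho> \<in> dirs" by (simp add: \<rho>_def)
  have mb: "real m = \<bar>real_of_int b - 1\<bar>" by (simp add: m_def)
  have Re: "Re (q + of_nat j * \<rho>) = B" for j using q by (simp add: \<rho>_def)
  have Im: "\<bar>Im (q + of_nat j * \<rho>)\<bar> \<le> B" if "j < m" for j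
    using q(3) b that mb by (auto simp: \<rho>_def abs_le_iff)
  have "q + of_nat m * \<rho> = far_pt"
    using q b mb by (auto simp: far_pt_def \<rho>_def complex_eq_iff)
  moreover have "\<bar>K (q + of_nat m * \<rho>) - K q\<bar> \<le> 1600 * D / \<Lambda> / sqrt B"
  proof (rule rim_path[OF q(1) \<rho>])
    show "real m \<le> 2 * B" using mb b q(3) N_pos by (auto simp: B_def abs_le_iff)
    fix j assume j: "j < m"
    show "\<rho> \<in> dirs_at (q + of_nat j * \<rho>)" using Re B0 by (intro right_allowed \<rho>) simp
    show "B \<le> cmod (q + of_nat j * \<rho>) \<and> cmod (q + of_nat j * \<rho>) \<le> 2 * B"
      using abs_Re_le_cmod[of "q + of_nat j * \<rho>"] cmod_le[of "q + of_nat j * \<rho>"] Re[of j] Im[OF j] B0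
      by linarith
  qed
  ultimately show ?thesis by (simp add: abs_minus_commute)
qed

lemma top_side:
  assumes q: "q \<in> lattice" "\<bar>Re q\<bar> \<le> B" "\<bar>Im q\<bar> = B"
  shows "\<bar>K q - K far_pt\<bar> \<le> 3200 * D / \<Lambda> / sqrt B"
proof -
  obtain m :: nat where m: "real m = B - Re q" using half_int_gap_Re[OF q(1)] q(2) by (auto simp: abs_le_iff)
  have "\<bar>K (q + of_nat m * 1) - K q\<bar> \<le> 1600 * D / \<Lambda> / sqrt B"
  proof (rule rim_path[OF q(1)])
    show "real m \<le> 2 * B" using m q(2) by (auto simp: abs_le_iff)
    fix j assume j: "j < m"
    show "1 \<in> dirs_at (q + of_nat j * 1)" by (rule one_allowed)
    have "\<bar>Re (q + of_nat j * 1)\<bar> \<le> B" using m q(2) j by (auto simp: abs_le_iff)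
    moreover have "\<bar>Im (q + of_nat j * 1)\<bar> = B" using q by simp
    ultimately show "B \<le> cmod (q + of_nat j * 1) \<and> cmod (q + of_nat j * 1) \<le> 2 * B"
      using abs_Im_le_cmod[of "q + of_nat j * 1"] cmod_le[of "q + of_nat j * 1"] by linarith
  qed simp
  moreover have "\<bar>K (q + of_nat m) - K far_pt\<bar> \<le> 1600 * D / \<Lambda> / sqrt B"
    using lattice_shift[OF q(1), of 1 m] q m by (intro right_side) auto
  ultimately show ?thesis by simp
qed

text \<open>Moving vertically away from the real axis never meets the crack. The bound e is indexed
  by the number of steps, so that the same path serves for points far from l and close to l.\<close>

lemma up_ray:
  assumes t: "t \<in> lattice" "cmod t \<le> real N"
    and e: "\<And>p \<rho> j. p \<in> lattice \<Longrightarrow> \<rho> \<in> dirs_at p \<Longrightarrow> cmod p \<le> 2 * real N + 1 \<Longrightarrow> Re p = Re t \<Longrightarrow>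
      Im p = Im t + sgn (Im t) * real j \<Longrightarrow> \<bar>K (p + \<rho>) - K p\<bar> \<le> e j"
    and s: "\<And>m. (\<Sum>j<m. e j) \<le> E"
  shows "\<bar>K t - K far_pt\<bar> \<le> E + 3200 * D / \<Lambda> / sqrt B"
proof -
  have tB: "\<bar>Re t\<bar> \<le> B" "\<bar>Im t\<bar> \<le> B"
    using abs_Re_le_cmod[of t] abs_Im_le_cmod[of t] t by (auto simp: B_def)
  obtain m :: nat where m: "real m = B - \<bar>Im t\<bar>" using half_int_gap[OF t(1) tB(2)] by blast
  define \<rho> where "\<rho> = (if 0 < Im t then \<i> else - \<i>)"
  have \<rho>: "\<rho> \<in> dirs" by (simp add: \<rho>_def)
  have Im0: "Im t \<noteq> 0" using lattice_nonzero[OF t(1)] by simp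
  have Im: "Im (t + of_nat j * \<rho>) = Im t + sgn (Im t) * real j" for j using Im0 by (auto simp: \<rho>_def)
  have Re: "Re (t + of_nat j * \<rho>) = Re t" for j by (simp add: \<rho>_def)
  have absIm: "\<bar>Im (t + of_nat j * \<rho>)\<bar> = \<bar>Im t\<bar> + real j" for j
    using Im0 unfolding Im by (cases "0 < Im t") auto
  have "\<bar>K (t + of_nat m * \<rho>) - K t\<bar> \<le> (\<Sum>j<m. e j)"
  proof (rule path[OF t(1) \<rho>])
    fix j assume j: "j < m"
    show "\<bar>K (t + of_nat j * \<rho> + \<rho>) - K (t + of_nat j * \<rho>)\<bar> \<le> e j"
    proof (rule e[OF lattice_shift[OF t(1) \<rho>] _ _ Re Im])
      show "\<rho> \<in> dirs_at (t + of_nat j * \<rho>)"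
      proof (cases "0 < Im t")
        case True
        then show ?thesis using up_allowed[of "t + of_nat j * \<i>"] by (simp add: \<rho>_def)
      next
        case False
        then show ?thesis using down_allowed[of "t + of_nat j * (- \<i>)"] Im0 by (simp add: \<rho>_def)
      qed
      have "\<bar>Im (t + of_nat j * \<rho>)\<bar> \<le> B" using absIm[of j] m j by simp
      moreover have "\<bar>Re (t + of_nat j * \<rho>)\<bar> \<le> B" by (simp only: Re tB)
      ultimately show "cmod (t + of_nat j * \<rho>) \<le> 2 * real N + 1"
        using cmod_le[of "t + of_nat j * \<rho>"] unfolding B_def by linarith
    qed
  qed
  moreover have "\<bar>K (t + of_nat m * \<rho>) - K far_pt\<bar> \<le> 3200 * D / \<Lambda> / sqrt B"
    using absIm[of m] m Re[of m] tB by (intro top_side lattice_shift t \<rho>) auto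
  ultimately show ?thesis using s[of m] by linarith
qed

lemma right_ray:
  assumes t: "t \<in> lattice" "cmod t \<le> real N"
    and e: "\<And>p \<rho> j. p \<in> lattice \<Longrightarrow> \<rho> \<in> dirs_at p \<Longrightarrow> cmod p \<le> 2 * real N + 1 \<Longrightarrow> Im p = Im t \<Longrightarrow>
      Re p = Re t + real j \<Longrightarrow> \<bar>K (p + \<rho>) - K p\<bar> \<le> e j"
    and s: "\<And>m. (\<Sum>j<m. e j) \<le> E"
  shows "\<bar>K t - K far_pt\<bar> \<le> E + 3200 * D / \<Lambda> / sqrt B"
proof -
  have B0: "0 < B" by (simp add: B_def)
  have tB: "\<bar>Re t\<bar> \<le> B" "\<bar>Im t\<bar> \<le> B"
    using abs_Re_le_cmod[of t] abs_Im_le_cmod[of t] t by (auto simp: B_def)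
  obtain m :: nat where m: "real m = B - Re t" using half_int_gap_Re[OF t(1)] tB(1) by (auto simp: abs_le_iff)
  have "\<bar>K (t + of_nat m * 1) - K t\<bar> \<le> (\<Sum>j<m. e j)"
  proof (rule path[OF t(1)])
    fix j assume j: "j < m"
    show "\<bar>K (t + of_nat j * 1 + 1) - K (t + of_nat j * 1)\<bar> \<le> e j"
    proof (rule e[OF lattice_shift[OF t(1)] one_allowed])
      have "\<bar>Re (t + of_nat j * 1)\<bar> \<le> B" using m j tB by (auto simp: abs_le_iff)
      then show "cmod (t + of_nat j * 1) \<le> 2 * real N + 1"
        using cmod_le[of "t + of_nat j * 1"] tB unfolding B_def by simp
    qed simp_all
  qed simp
  moreover have "\<bar>K (t + of_nat m) - K far_pt\<bar> \<le> 1600 * D / \<Lambda> / sqrt B"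
    using lattice_shift[OF t(1), of 1 m] m tB by (intro right_side) auto
  moreover have "0 \<le> 1600 * D / \<Lambda> / sqrt B" using D \<Lambda>_pos B0 by simp
  ultimately show ?thesis using s[of m] by simp
qed

lemma sqrt_B:
  assumes "t \<in> lattice" "cmod t \<le> real N"
  shows "1 / sqrt B \<le> 1 / cmod (omega t)"
proof -
  have "(cmod (omega t))\<^sup>2 \<le> (sqrt B)\<^sup>2" using assms(2) by (simp add: B_def)
  then have "cmod (omega t) \<le> sqrt B" by (rule power2_le_imp_le) (simp add: B_def)
  then show ?thesis
    using norm_omega_pos[OF assms(1)] by (intro divide_left_mono mult_pos_pos) (linarith | simp)+
qed

text \<open>The factor |p|^-1/2 is evaluated at the start t of the ray. The remaining 1/|p| would
  sum to a logarithm; giving up \<open>(2 * real N + 1) powr d\<close> raises its exponent to 1 + d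
  and makes the sum bounded.\<close>

lemma power_split:
  assumes p: "p \<in> lattice" "cmod p \<le> 2 * real N + 1" and t: "t \<in> lattice" "cmod t \<le> cmod p" and x: "0 < x" "x \<le> 3 * cmod p"
  shows "1 / cmod (omega p) ^ 3 \<le> 9 * (2 * real N + 1) powr d / cmod (omega t) * x powr (- (1 + d))"
proof -
  define P where "P = cmod (omega p)"
  have P: "0 < P" "P\<^sup>2 = cmod p" using norm_omega_pos[OF p(1)] by (simp_all add: P_def)
  have "(cmod (omega t))\<^sup>2 \<le> P\<^sup>2" using t(2) by (simp add: P_def)
  then have tP: "cmod (omega t) \<le> P" using P by (auto intro: power2_le_imp_le)
  have p0: "0 < cmod p" using x by linarith
  have "1 / P ^ 3 = (1 / P) * (1 / cmod p)" by (simp add: P(2)[symmetric] power3_eq_cube power2_eq_square)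
  also have "\<dots> \<le> (1 / cmod (omega t)) * (1 / cmod p)"
    by (intro mult_right_mono divide_left_mono mult_pos_pos tP P(1) norm_omega_pos t(1)) auto
  also have "\<dots> \<le> (1 / cmod (omega t)) * (9 * (2 * real N + 1) powr d * x powr (- (1 + d)))"
  proof (rule mult_left_mono)
    have "x powr (1 + d) \<le> (3 * cmod p) powr (1 + d)" using x d by (intro powr_mono2) auto
    also have "\<dots> = 3 powr (1 + d) * (cmod p powr 1 * cmod p powr d)"
      by (simp add: powr_mult powr_add)
    also have "\<dots> \<le> 9 * (cmod p * (2 * real N + 1) powr d)"
    proof (intro mult_mono)
      show "3 powr (1 + d) \<le> (9::real)" using powr_mono[of "1 + d" 2 3] d by simp
      show "cmod p powr d \<le> (2 * real N + 1) powr d" using p d by (intro powr_mono2) auto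
    qed (use p0 in auto)
    finally have "x powr (1 + d) \<le> 9 * (cmod p * (2 * real N + 1) powr d)" .
    moreover have "0 < x powr (1 + d)" using x by simp
    moreover have "x powr (- (1 + d)) = 1 / x powr (1 + d)" by (rule powr_minus_divide)
    ultimately show "1 / cmod p \<le> 9 * (2 * real N + 1) powr d * x powr (- (1 + d))"
      using p0 by (simp only:) (simp add: divide_simps mult_ac)
  qed simp
  finally show ?thesis by (simp add: P_def mult_ac)
qed

definition \<kappa> :: real where
  "\<kappa> = 7200 * D * (2 * real N + 1) powr d * C1 + 26 * D * C2 + 3200 * D"

lemma far_sum:
  "800 * D / \<Lambda> * (9 * (2 * real N + 1) powr d / cmod (omega t)) * C1 + 3200 * D / \<Lambda> / cmod (omega t)
    \<le> \<kappa> / \<Lambda> / cmod (omega t)"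
proof -
  have "7200 * D * (2 * real N + 1) powr d * C1 + 3200 * D \<le> \<kappa>"
    using D C_pos by (simp add: \<kappa>_def algebra_simps)
  then have "(7200 * D * (2 * real N + 1) powr d * C1 + 3200 * D) / \<Lambda> / cmod (omega t) \<le> \<kappa> / \<Lambda> / cmod (omega t)"
    using \<Lambda>_pos by (intro divide_right_mono) auto
  then show ?thesis by (simp add: add_divide_distrib mult_ac)
qed

lemma rim_le:
  assumes "t \<in> lattice" "cmod t \<le> real N"
  shows "3200 * D / \<Lambda> / sqrt B \<le> 3200 * D / \<Lambda> / cmod (omega t)"
proof -
  have "3200 * D / \<Lambda> * (1 / sqrt B) \<le> 3200 * D / \<Lambda> * (1 / cmod (omega t))"
    using sqrt_B[OF assms] D \<Lambda>_pos by (intro mult_left_mono) auto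
  then show ?thesis by simp
qed

text \<open>On such a ray |p| does not decrease, so the root of t bounds every later root from below
  and the factor 1/|omega(t)| can be extracted.\<close>

lemma kernel_up:
  assumes t: "t \<in> lattice" "cmod t \<le> real N"
    and far: "\<And>p. Re p = Re t \<Longrightarrow> cmod t \<le> cmod p \<Longrightarrow> cmod p + cmod l \<le> 20 * cmod (p - l)"
  shows "\<bar>K t - K far_pt\<bar> \<le> \<kappa> / \<Lambda> / cmod (omega t)"
proof -
  define c where "c = 800 * D / \<Lambda> * (9 * (2 * real N + 1) powr d / cmod (omega t))"
  have c0: "0 \<le> c" using D \<Lambda>_pos by (simp add: c_def)
  have "\<bar>K t - K far_pt\<bar> \<le> c * C1 + 3200 * D / \<Lambda> / sqrt B"
  proof (rule up_ray[OF t])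
    fix p \<rho> j assume p: "p \<in> lattice" "\<rho> \<in> dirs_at p" "cmod p \<le> 2 * real N + 1" "Re p = Re t"
      "Im p = Im t + sgn (Im t) * real j"
    have absIm: "\<bar>Im p\<bar> = \<bar>Im t\<bar> + real j"
      using p(5) lattice_nonzero[OF t(1)] by (cases "0 < Im t") auto
    then have "\<bar>Im t\<bar>\<^sup>2 \<le> \<bar>Im p\<bar>\<^sup>2" by (intro power_mono) auto
    then have tp: "cmod t \<le> cmod p" using p(4) unfolding cmod_def by simp
    have x: "1 + real j \<le> 3 * cmod p"
      using absIm lattice_Re_Im(2)[OF t(1)] abs_Im_le_cmod[of p] by linarith
    have "\<bar>K (p + \<rho>) - K p\<bar> \<le> 800 * D / \<Lambda> * (1 / cmod (omega p) ^ 3)"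
      by (rule K_far[OF p(1-3) far[OF p(4) tp]])
    also have "\<dots> \<le> 800 * D / \<Lambda> * (9 * (2 * real N + 1) powr d / cmod (omega t) * (1 + real j) powr (- (1 + d)))"
      using D \<Lambda>_pos x by (intro mult_left_mono power_split p t tp) auto
    also have "\<dots> = c * (1 + \<bar>real j - 0\<bar>) powr (- (1 + d))" by (simp add: c_def)
    finally show "\<bar>K (p + \<rho>) - K p\<bar> \<le> c * (1 + \<bar>real j - 0\<bar>) powr (- (1 + d))" .
  next
    show "(\<Sum>j<m. c * (1 + \<bar>real j - 0\<bar>) powr (- (1 + d))) \<le> c * C1" for m
      unfolding sum_distrib_left[symmetric] using c0 C1 by (intro mult_left_mono)
  qed
  then show ?thesis using rim_le[OF t] far_sum[of t] unfolding c_def by linarith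
qed

lemma kernel_far:
  assumes t: "t \<in> lattice" "cmod t \<le> real N" "5/4 * cmod l \<le> cmod t"
  shows "\<bar>K t - K far_pt\<bar> \<le> \<kappa> / \<Lambda> / cmod (omega t)"
proof (rule kernel_up[OF t(1,2)])
  fix p assume "cmod t \<le> cmod p"
  then show "cmod p + cmod l \<le> 20 * cmod (p - l)"
    using norm_triangle_ineq2[of p l] t(3) norm_ge_zero[of l] by linarith
qed

text \<open>Either the vertical or the horizontal ray keeps a distance |l|/8 from l, or t is close
  to l. In the last case the kernel is bounded without the factor 1/|omega(l)|, which is recovered
  from |omega(l)| <= 2 |omega(t)|; this is why the bound grows with |omega(t)|.\<close>

lemma kernel_tip:
  assumes t: "t \<in> lattice" "cmod t \<le> real N"
  shows "\<bar>K t - K far_pt\<bar> \<le> 4 * \<kappa> / \<Lambda> * cmod (omega t)"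
proof -
  define Z where "Z = cmod (omega t)"
  have Z0: "0 < Z" using norm_omega_pos[OF t(1)] by (simp add: Z_def)
  have Z2: "Z\<^sup>2 = cmod t" by (simp add: Z_def)
  have \<kappa>0: "0 \<le> \<kappa>" unfolding \<kappa>_def using D C_pos by (intro add_nonneg_nonneg mult_nonneg_nonneg) auto
  have "1/2 \<le> Z\<^sup>2" using lattice_norm[OF t(1)] unfolding Z2 .
  then have "1 \<le> 2 * Z * Z" by (simp add: power2_eq_square)
  then have "1 / Z \<le> 2 * Z" using Z0 by (simp add: pos_divide_le_eq)
  then have inv_Z: "1 / Z \<le> 4 * Z" using Z0 by linarith
  then have inv: "\<kappa> / \<Lambda> * (1 / Z) \<le> \<kappa> / \<Lambda> * (4 * Z)" using \<kappa>0 \<Lambda>_pos by (intro mult_left_mono) auto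
  have Zhalf: "1/2 \<le> Z"
  proof (rule power2_le_imp_le)
    show "(1/2)\<^sup>2 \<le> Z\<^sup>2" using \<open>1/2 \<le> Z\<^sup>2\<close> by (simp add: power2_eq_square[of "1/2::real"])
  qed (use Z0 in simp)
  define R where "R = 3200 * D / \<Lambda>"
  have R0: "0 \<le> R" using D \<Lambda>_pos by (simp add: R_def)
  have "R / sqrt B \<le> R * (1 / Z)" using rim_le[OF t] by (simp add: R_def Z_def)
  also have "\<dots> \<le> R * (4 * Z)" using inv_Z R0 by (rule mult_left_mono)
  finally have rim: "R / sqrt B \<le> R * (4 * Z)" .
  consider "cmod l / 8 \<le> \<bar>Re t - Re l\<bar>" | "cmod l / 8 \<le> \<bar>Im t - Im l\<bar>"
    | "\<bar>Re t - Re l\<bar> < cmod l / 8" "\<bar>Im t - Im l\<bar> < cmod l / 8" by linarith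
  then show ?thesis
  proof cases
    case 1
    have "\<bar>K t - K far_pt\<bar> \<le> \<kappa> / \<Lambda> / cmod (omega t)"
    proof (rule kernel_up[OF t])
      fix p assume "Re p = Re t"
      then have "cmod l / 8 \<le> cmod (p - l)" using 1 abs_Re_le_cmod[of "p - l"] by simp
      then show "cmod p + cmod l \<le> 20 * cmod (p - l)"
        using norm_triangle_ineq2[of p l] norm_ge_zero[of l] by linarith
    qed
    then show ?thesis using inv by (simp add: Z_def mult_ac)
  next
    case 2
    define c where "c = 800 * D / \<Lambda> * (9 * (2 * real N + 1) powr d) * 2"
    have c0: "0 \<le> c" using D \<Lambda>_pos by (simp add: c_def)
    define X0 where "X0 = 7200 * D * (2 * real N + 1) powr d * C1 / \<Lambda>"
    have X0: "0 \<le> X0" using D \<Lambda>_pos C_pos by (simp add: X0_def)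
    have "\<bar>K t - K far_pt\<bar> \<le> c * C1 + 3200 * D / \<Lambda> / sqrt B"
    proof (rule right_ray[OF t])
      fix p \<rho> j assume p: "p \<in> lattice" "\<rho> \<in> dirs_at p" "cmod p \<le> 2 * real N + 1" "Im p = Im t"
        "Re p = Re t + real j"
      have "cmod l / 8 \<le> cmod (p - l)" using 2 p(4) abs_Im_le_cmod[of "p - l"] by simp
      then have far: "cmod p + cmod l \<le> 20 * cmod (p - l)"
        using norm_triangle_ineq2[of p l] norm_ge_zero[of l] by linarith
      \<comment> \<open>Along a horizontal ray |p| may fall below |t| when the ray passes the tip,
        so \<open>power_split\<close> starts from a site of smallest modulus. The resulting constant
        is absorbed by |omega(t)| >= 1/2.\<close>
      define u where "u = Complex (1/2) (1/2)"
      have u: "u \<in> lattice" unfolding u_def lattice_iff by (intro exI[of _ 1]) simp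
      have up: "cmod u \<le> cmod p"
      proof -
        have "(1/2)\<^sup>2 \<le> \<bar>Re p\<bar>\<^sup>2" "(1/2)\<^sup>2 \<le> \<bar>Im p\<bar>\<^sup>2"
          using lattice_Re_Im[OF p(1)] by (intro power_mono; simp)+
        then show ?thesis unfolding cmod_def u_def by (intro real_sqrt_le_mono) simp
      qed
      have "1/2 \<le> cmod u" by (rule lattice_norm[OF u])
      then have ou: "1/2 \<le> cmod (omega u)"
        by (intro power2_le_imp_le[of "1/2"]) (auto simp: power2_eq_square[of "1/2::real"])
      have x: "1 + \<bar>real j - (- Re t)\<bar> \<le> 3 * cmod p"
      proof -
        have "real j - (- Re t) = Re p" using p(5) by simp
        then show ?thesis using lattice_Re_Im(1)[OF p(1)] abs_Re_le_cmod[of p] by linarith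
      qed
      have "\<bar>K (p + \<rho>) - K p\<bar> \<le> 800 * D / \<Lambda> * (1 / cmod (omega p) ^ 3)"
        by (rule K_far[OF p(1-3) far])
      also have "\<dots> \<le> 800 * D / \<Lambda> * (9 * (2 * real N + 1) powr d / cmod (omega u) * (1 + \<bar>real j - (- Re t)\<bar>) powr (- (1 + d)))"
        using D \<Lambda>_pos x by (intro mult_left_mono power_split p u up) auto
      also have "\<dots> \<le> 800 * D / \<Lambda> * (9 * (2 * real N + 1) powr d / (1/2) * (1 + \<bar>real j - (- Re t)\<bar>) powr (- (1 + d)))"
        using D \<Lambda>_pos ou by (intro mult_left_mono mult_right_mono divide_left_mono mult_pos_pos) auto
      also have "\<dots> = c * (1 + \<bar>real j - (- Re t)\<bar>) powr (- (1 + d))" by (simp add: c_def)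
      finally show "\<bar>K (p + \<rho>) - K p\<bar> \<le> c * (1 + \<bar>real j - (- Re t)\<bar>) powr (- (1 + d))" .
    next
      show "(\<Sum>j<m. c * (1 + \<bar>real j - (- Re t)\<bar>) powr (- (1 + d))) \<le> c * C1" for m
        unfolding sum_distrib_left[symmetric] using c0 C1 by (intro mult_left_mono)
    qed
    also have "\<dots> \<le> X0 * (4 * Z) + R * (4 * Z)"
    proof -
      have "c * C1 = X0 * 2" by (simp add: c_def X0_def)
      also have "\<dots> \<le> X0 * (4 * Z)" using Zhalf X0 by (intro mult_left_mono) auto
      finally show ?thesis using rim unfolding R_def by linarith
    qed
    also have "\<dots> = (X0 + R) * (4 * Z)" by (simp add: distrib_right)
    also have "\<dots> \<le> \<kappa> / \<Lambda> * (4 * Z)"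
    proof (rule mult_right_mono)
      have "X0 + R = (7200 * D * (2 * real N + 1) powr d * C1 + 3200 * D) / \<Lambda>"
        by (simp add: X0_def R_def add_divide_distrib)
      also have "\<dots> \<le> \<kappa> / \<Lambda>" using \<Lambda>_pos D C_pos by (intro divide_right_mono) (auto simp: \<kappa>_def)
      finally show "X0 + R \<le> \<kappa> / \<Lambda>" .
    qed (use Z0 in simp)
    finally show ?thesis by (simp add: Z_def mult_ac)
  next
    case 3
    have "cmod (t - l) \<le> cmod l / 4" using 3 cmod_le[of "t - l"] by simp
    then have tl: "3/4 * cmod l \<le> cmod t" using norm_triangle_ineq2[of l t] by (simp add: norm_minus_commute)
    have "\<Lambda>\<^sup>2 = cmod l" "(2 * Z)\<^sup>2 = 4 * cmod t" by (simp_all add: \<Lambda>_def Z2 power_mult_distrib)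
    then have "\<Lambda>\<^sup>2 \<le> (2 * Z)\<^sup>2" using tl norm_ge_zero[of t] by linarith
    then have \<Lambda>Z: "\<Lambda> \<le> 2 * Z" by (rule power2_le_imp_le) (use Z0 in simp)
    define \<alpha> where "\<alpha> = sgn (Im t) * (Im l - Im t)"
    have "\<bar>K t - K far_pt\<bar> \<le> (D * 26) * C2 + 3200 * D / \<Lambda> / sqrt B"
    proof (rule up_ray[OF t])
      fix p \<rho> j assume p: "p \<in> lattice" "\<rho> \<in> dirs_at p" "cmod p \<le> 2 * real N + 1" "Re p = Re t"
        "Im p = Im t + sgn (Im t) * real j"
      have "\<bar>Im p\<bar> = \<bar>Im t\<bar> + real j"
        using p(5) lattice_nonzero[OF t(1)] by (cases "0 < Im t") auto
      then have "\<bar>Im t\<bar>\<^sup>2 \<le> \<bar>Im p\<bar>\<^sup>2" by (intro power_mono) auto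
      then have tp: "cmod t \<le> cmod p" using p(4) unfolding cmod_def by simp
      have "cmod l \<le> 2 * cmod p" using tl tp norm_ge_zero[of l] norm_ge_zero[of p] by linarith
      note near = sepn_near[OF p(1) l this]
      have "\<bar>Im (p - l)\<bar> = \<bar>real j - \<alpha>\<bar>"
        using p(5) lattice_nonzero[OF t(1)] by (cases "0 < Im t") (auto simp: \<alpha>_def)
      then have "\<bar>real j - \<alpha>\<bar> \<le> cmod (p - l)" using abs_Im_le_cmod[of "p - l"] by linarith
      then have "(1 + cmod (p - l)) powr (- 3/2) \<le> (1 + \<bar>real j - \<alpha>\<bar>) powr (- 3/2)"
        by (intro powr_mono2') auto
      then have "1 / (1 + sepn p l) \<le> 26 * (1 + \<bar>real j - \<alpha>\<bar>) powr (- 3/2)" using near by linarith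
      then have "D * (1 / (1 + sepn p l)) \<le> D * (26 * (1 + \<bar>real j - \<alpha>\<bar>) powr (- 3/2))"
        using D by (intro mult_left_mono) auto
      then show "\<bar>K (p + \<rho>) - K p\<bar> \<le> (D * 26) * (1 + \<bar>real j - \<alpha>\<bar>) powr (- 3/2)"
        using K[OF p(1-3)] by (simp only: mult.assoc)
    next
      show "(\<Sum>j<m. (D * 26) * (1 + \<bar>real j - \<alpha>\<bar>) powr (- 3/2)) \<le> (D * 26) * C2" for m
        unfolding sum_distrib_left[symmetric] using D C2 by (intro mult_left_mono) auto
    qed
    also have "\<dots> \<le> (D * 26 * C2 / \<Lambda>) * (4 * Z) + R * (4 * Z)"
    proof -
      have "D * 26 * C2 = (D * 26 * C2 / \<Lambda>) * \<Lambda>" using \<Lambda>_pos by simp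
      also have "\<dots> \<le> (D * 26 * C2 / \<Lambda>) * (4 * Z)"
        using \<Lambda>Z Z0 D C_pos \<Lambda>_pos by (intro mult_left_mono) auto
      finally show ?thesis using rim unfolding R_def by linarith
    qed
    also have "\<dots> = (D * 26 * C2 / \<Lambda> + R) * (4 * Z)" by (simp add: distrib_right)
    also have "\<dots> \<le> \<kappa> / \<Lambda> * (4 * Z)"
    proof (rule mult_right_mono)
      have "D * 26 * C2 / \<Lambda> + R = (26 * D * C2 + 3200 * D) / \<Lambda>"
        by (simp add: R_def add_divide_distrib)
      also have "\<dots> \<le> \<kappa> / \<Lambda>" using \<Lambda>_pos D C_pos by (intro divide_right_mono) (auto simp: \<kappa>_def)
      finally show "D * 26 * C2 / \<Lambda> + R \<le> \<kappa> / \<Lambda>" .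
    qed (use Z0 in simp)
    finally show ?thesis by (simp add: Z_def mult_ac)
  qed
qed

end

section \<open>The cut-off\<close>

lemma cutoff_derivative:
  assumes "cutoff \<eta>" "0 < t"
  shows "(\<eta> has_real_derivative deriv \<eta> t) (at t)"
    and "(deriv \<eta> has_real_derivative deriv (deriv \<eta>) t) (at t)"
    and "isCont (deriv (deriv \<eta>)) t"
proof -
  have d: "((deriv ^^ k) \<eta>) differentiable at t" for k
    using assms differentiable_on_eq_differentiable_at[of "{0<..}" "(deriv ^^ k) \<eta>"]
    by (auto simp: cutoff_def open_greaterThan)
  show "(\<eta> has_real_derivative deriv \<eta> t) (at t)"
    using d[of 0] by (simp add: DERIV_deriv_iff_real_differentiable)
  show "(deriv \<eta> has_real_derivative deriv (deriv \<eta>) t) (at t)"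
    using d[of 1] by (simp add: DERIV_deriv_iff_real_differentiable)
  show "isCont (deriv (deriv \<eta>)) t"
    using d[of 2] differentiable_imp_continuous_within by (auto simp: numeral_2_eq_2)
qed

lemma cutoff_deriv_zero:
  assumes \<eta>: "cutoff \<eta>" and t: "0 < t" "t < 1/2 \<or> 1 < t"
  shows "deriv \<eta> t = 0" "deriv (deriv \<eta>) t = 0"
proof -
  have zero: "deriv \<eta> t = 0" if t: "0 < t" "t < 1/2 \<or> 1 < t" for t
  proof -
    have "\<exists>c. \<forall>\<^sub>F x in nhds t. \<eta> x = c"
    proof (cases "t < 1/2")
      case True
      have "\<forall>\<^sub>F x in nhds t. x \<in> {0<..<1/2}" using t True by (intro eventually_nhds_in_open) auto
      then show ?thesis using \<eta> by (intro exI[of _ 1]) (auto elim!: eventually_mono simp: cutoff_def)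
    next
      case False
      have "\<forall>\<^sub>F x in nhds t. x \<in> {1<..}" using t False by (intro eventually_nhds_in_open) auto
      then show ?thesis using \<eta> by (intro exI[of _ 0]) (auto elim!: eventually_mono simp: cutoff_def)
    qed
    then obtain c where "\<forall>\<^sub>F x in nhds t. \<eta> x = c" by blast
    then have "deriv \<eta> t = deriv (\<lambda>_. c) t" by (intro deriv_cong_ev) auto
    then show ?thesis by simp
  qed
  show "deriv \<eta> t = 0" by (rule zero[OF t])
  have "\<forall>\<^sub>F x in nhds t. x \<in> {0<..<1/2} \<union> {1<..}"
    using t by (intro eventually_nhds_in_open open_Un) auto
  then have "\<forall>\<^sub>F x in nhds t. deriv \<eta> x = 0" by (rule eventually_mono) (use zero in auto)
  then have "deriv (deriv \<eta>) t = deriv (\<lambda>_. 0) t" by (intro deriv_cong_ev) auto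
  then show "deriv (deriv \<eta>) t = 0" by simp
qed

text \<open>The three quantities are those that occur in the derivatives of \<eta>(x y): the mixed
  derivative in x and y is \<eta>'(t) + t \<eta>''(t) at t = x y.\<close>

lemma cutoff_bounds:
  assumes \<eta>: "cutoff \<eta>"
  shows "\<exists>H>0. \<forall>t>0. \<bar>deriv \<eta> t\<bar> \<le> H \<and> \<bar>t * deriv \<eta> t\<bar> \<le> H \<and> \<bar>deriv \<eta> t + t * deriv (deriv \<eta>) t\<bar> \<le> H"
proof -
  have cont1: "continuous_on {1/4..2} (deriv \<eta>)"
    by (intro continuous_at_imp_continuous_on ballI DERIV_isCont[OF cutoff_derivative(2)[OF \<eta>]]) auto
  have cont2: "continuous_on {1/4..2} (deriv (deriv \<eta>))"
    by (intro continuous_at_imp_continuous_on ballI cutoff_derivative(3)[OF \<eta>]) auto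
  \<comment> \<open>The compact interval contains [1/2, 1], outside of which all derivatives of the
    cut-off vanish.\<close>
  have bd: "\<exists>H. \<forall>t>0. \<bar>f t\<bar> \<le> H" if c: "continuous_on {1/4..2} f"
    and z: "\<And>t. 0 < t \<Longrightarrow> t < 1/2 \<or> 1 < t \<Longrightarrow> f t = 0" for f :: "real \<Rightarrow> real"
  proof -
    have "bounded (f ` {1/4..2})" by (rule compact_imp_bounded[OF compact_continuous_image[OF c compact_Icc]])
    then obtain H where "\<forall>x\<in>f ` {1/4..2}. norm x \<le> H" unfolding bounded_iff by blast
    then have H: "\<bar>f t\<bar> \<le> H" if "t \<in> {1/4..2}" for t using that by simp
    have "\<bar>f t\<bar> \<le> H" if "0 < t" for t
    proof (cases "t \<in> {1/4..2}")
      case False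
      then have "f t = 0" using that by (intro z) auto
      then show ?thesis using H[of 1] abs_ge_zero[of "f 1"] by simp
    qed (rule H)
    then show ?thesis by blast
  qed
  obtain H1 H2 H3 where H: "\<And>t. 0 < t \<Longrightarrow> \<bar>deriv \<eta> t\<bar> \<le> H1" "\<And>t. 0 < t \<Longrightarrow> \<bar>t * deriv \<eta> t\<bar> \<le> H2"
    "\<And>t. 0 < t \<Longrightarrow> \<bar>deriv \<eta> t + t * deriv (deriv \<eta>) t\<bar> \<le> H3"
  proof -
    have "\<exists>H. \<forall>t>0. \<bar>deriv \<eta> t\<bar> \<le> H"
      by (rule bd[OF cont1]) (use cutoff_deriv_zero[OF \<eta>] in auto)
    moreover have "\<exists>H. \<forall>t>0. \<bar>t * deriv \<eta> t\<bar> \<le> H"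
      by (rule bd[OF continuous_on_mult[OF continuous_on_id cont1]]) (use cutoff_deriv_zero[OF \<eta>] in auto)
    moreover have "\<exists>H. \<forall>t>0. \<bar>deriv \<eta> t + t * deriv (deriv \<eta>) t\<bar> \<le> H"
      by (rule bd[OF continuous_on_add[OF cont1 continuous_on_mult[OF continuous_on_id cont2]]])
         (use cutoff_deriv_zero[OF \<eta>] in auto)
    ultimately show ?thesis using that by blast
  qed
  have H0: "0 \<le> H1" "0 \<le> H2" "0 \<le> H3" using H[of 1, OF zero_less_one] by linarith+
  show ?thesis
  proof (intro exI[of _ "H1 + H2 + H3 + 1"] conjI allI impI)
    show "0 < H1 + H2 + H3 + 1" using H0 by linarith
    fix t :: real assume "0 < t"
    from H[OF this] H0 show "\<bar>deriv \<eta> t\<bar> \<le> H1 + H2 + H3 + 1" "\<bar>t * deriv \<eta> t\<bar> \<le> H1 + H2 + H3 + 1"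
      "\<bar>deriv \<eta> t + t * deriv (deriv \<eta>) t\<bar> \<le> H1 + H2 + H3 + 1" by linarith+
  qed
qed

text \<open>Mean value estimates for (x, y) mapped to \<eta>(x y), to be used with x = |l| and y =
  1/|omega(s)|. The mixed difference is bounded by a mean value estimate in x whose derivative is
  itself a difference in y.\<close>

lemma cutoff_differences:
  assumes \<eta>: "cutoff \<eta>" and H: "\<And>t. 0 < t \<Longrightarrow> \<bar>deriv \<eta> t\<bar> \<le> H"
    "\<And>t. 0 < t \<Longrightarrow> \<bar>t * deriv \<eta> t\<bar> \<le> H" "\<And>t. 0 < t \<Longrightarrow> \<bar>deriv \<eta> t + t * deriv (deriv \<eta>) t\<bar> \<le> H"
    and x: "0 < x" "0 < x'" and y: "0 < m" "m \<le> y" "m \<le> y'"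
  shows "\<bar>\<eta> (x' * y') - \<eta> (x * y')\<bar> \<le> H * y' * \<bar>x' - x\<bar>"
    and "\<bar>\<eta> (x * y') - \<eta> (x * y)\<bar> \<le> H / m * \<bar>y' - y\<bar>"
    and "\<bar>(\<eta> (x' * y') - \<eta> (x' * y)) - (\<eta> (x * y') - \<eta> (x * y))\<bar> \<le> H * \<bar>y' - y\<bar> * \<bar>x' - x\<bar>"
proof -
  have y0: "0 < y" "0 < y'" using y by auto
  have D1: "((\<lambda>x. \<eta> (x * c)) has_real_derivative (deriv \<eta> (v * c) * c)) (at v within U)"
    if "0 < v" "0 < c" for v c U
    by (rule DERIV_chain2[OF cutoff_derivative(1)[OF \<eta>]]) (use that in \<open>auto intro!: derivative_eq_intros\<close>)
  have D1': "((\<lambda>x. \<eta> (c * x)) has_real_derivative (deriv \<eta> (c * v) * c)) (at v within U)"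
    if "0 < v" "0 < c" for v c U
    by (rule DERIV_chain2[OF cutoff_derivative(1)[OF \<eta>]]) (use that in \<open>auto intro!: derivative_eq_intros\<close>)
  have D2: "((\<lambda>x. deriv \<eta> (c * x)) has_real_derivative (deriv (deriv \<eta>) (c * v) * c)) (at v within U)"
    if "0 < v" "0 < c" for v c U
    by (rule DERIV_chain2[OF cutoff_derivative(2)[OF \<eta>]]) (use that in \<open>auto intro!: derivative_eq_intros\<close>)
  have "norm (\<eta> (x' * y') - \<eta> (x * y')) \<le> H * y' * norm (x' - x)"
  proof (rule field_differentiable_bound[where S = "{0<..}" and f = "\<lambda>x. \<eta> (x * y')"])
    fix v :: real assume v: "v \<in> {0<..}"
    show "((\<lambda>x. \<eta> (x * y')) has_real_derivative (deriv \<eta> (v * y') * y')) (at v within {0<..})"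
      using v y0 by (intro D1) auto
    show "norm (deriv \<eta> (v * y') * y') \<le> H * y'"
      using H(1)[of "v * y'"] v y0 by (simp add: abs_mult)
  qed (use x in auto)
  then show "\<bar>\<eta> (x' * y') - \<eta> (x * y')\<bar> \<le> H * y' * \<bar>x' - x\<bar>" by simp
  have "norm (\<eta> (x * y') - \<eta> (x * y)) \<le> H / m * norm (y' - y)"
  proof (rule field_differentiable_bound[where S = "{m..}" and f = "\<lambda>y. \<eta> (x * y)"])
    fix v assume v: "v \<in> {m..}"
    then have v0: "0 < v" using y by simp
    show "((\<lambda>y. \<eta> (x * y)) has_real_derivative (deriv \<eta> (x * v) * x)) (at v within {m..})"
      using v0 x by (intro D1') auto
    have "norm (deriv \<eta> (x * v) * x) = \<bar>(x * v) * deriv \<eta> (x * v)\<bar> / v"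
      using v0 x by (simp add: abs_mult)
    also have "\<dots> \<le> H / m"
      using H(2)[of "x * v"] v v0 x y by (intro frac_le) (auto intro: order_trans[OF abs_ge_zero])
    finally show "norm (deriv \<eta> (x * v) * x) \<le> H / m" .
  qed (use y in auto)
  then show "\<bar>\<eta> (x * y') - \<eta> (x * y)\<bar> \<le> H / m * \<bar>y' - y\<bar>" by simp
  have "norm ((\<eta> (x' * y') - \<eta> (x' * y)) - (\<eta> (x * y') - \<eta> (x * y))) \<le> (H * \<bar>y' - y\<bar>) * norm (x' - x)"
  proof (rule field_differentiable_bound[where S = "{0<..}" and f = "\<lambda>x. \<eta> (x * y') - \<eta> (x * y)"])
    fix v :: real assume v: "v \<in> {0<..}"
    show "((\<lambda>x. \<eta> (x * y') - \<eta> (x * y)) has_real_derivative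
        (deriv \<eta> (v * y') * y' - deriv \<eta> (v * y) * y)) (at v within {0<..})"
      using v y0 by (intro DERIV_diff D1) auto
    have "norm (deriv \<eta> (v * y') * y' - deriv \<eta> (v * y) * y) \<le> H * norm (y' - y)"
    proof (rule field_differentiable_bound[where S = "{0<..}" and f = "\<lambda>y. deriv \<eta> (v * y) * y"])
      fix q :: real assume q: "q \<in> {0<..}"
      show "((\<lambda>y. deriv \<eta> (v * y) * y) has_real_derivative
          (deriv (deriv \<eta>) (v * q) * v * q + deriv \<eta> (v * q))) (at q within {0<..})"
        using v q by (intro DERIV_cong[OF DERIV_mult[OF D2 DERIV_ident]]) auto
      show "norm (deriv (deriv \<eta>) (v * q) * v * q + deriv \<eta> (v * q)) \<le> H"
        using H(3)[of "v * q"] v q by (simp add: algebra_simps)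
    qed (use y0 in auto)
    then show "norm (deriv \<eta> (v * y') * y' - deriv \<eta> (v * y) * y) \<le> H * \<bar>y' - y\<bar>" by simp
  qed (use x in auto)
  then show "\<bar>(\<eta> (x' * y') - \<eta> (x' * y)) - (\<eta> (x * y') - \<eta> (x * y))\<bar> \<le> H * \<bar>y' - y\<bar> * \<bar>x' - x\<bar>" by simp
qed

lemma cutoff_range: "cutoff \<eta> \<Longrightarrow> 0 \<le> t \<Longrightarrow> 0 \<le> \<eta> t \<and> \<eta> t \<le> 1"
proof -
  assume \<eta>: "cutoff \<eta>" and t: "0 \<le> t"
  have mono: "\<eta> b \<le> \<eta> a" if "0 \<le> a" "a \<le> b" for a b
    using \<eta> that unfolding cutoff_def monotone_on_def by auto
  have "\<eta> 0 = 1" using \<eta> by (simp add: cutoff_def)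
  moreover have "\<eta> (max 1 t) = 0" using \<eta> by (simp add: cutoff_def)
  ultimately show ?thesis using mono[of 0 t] mono[of t "max 1 t"] t by simp
qed

text \<open>The exponent 2d has two sources: one d from the decay hypothesis through
  \<open>min_powr_ge\<close>, one from summing along rays in \<open>power_split\<close>. The
  constant c is the value of the kernel at \<open>far_pt\<close>.\<close>

lemma green_kernel:
  assumes G: "crack_green G" and d: "0 < d" "d \<le> 1"
  shows "\<exists>C>0. \<forall>l\<in>lattice. \<forall>\<tau>\<in>dirs_at l. \<forall>N::nat. 4 * cmod l \<le> real N \<longrightarrow>
    (\<exists>c. \<forall>t\<in>lattice. cmod t \<le> real N \<longrightarrow>
      \<bar>(G t (l + \<tau>) - G t l) - c\<bar> \<le> C * (2 * real N + 1) powr (2 * d) / cmod (omega l) * cmod (omega t) \<and>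
      (5/4 * cmod l \<le> cmod t \<longrightarrow>
        \<bar>(G t (l + \<tau>) - G t l) - c\<bar> \<le> C * (2 * real N + 1) powr (2 * d) / cmod (omega l) / cmod (omega t) \<and>
        (\<forall>\<rho>\<in>dirs_at t. \<bar>(G (t + \<rho>) (l + \<tau>) - G (t + \<rho>) l) - (G t (l + \<tau>) - G t l)\<bar>
          \<le> C * (2 * real N + 1) powr (2 * d) / cmod (omega l) / cmod (omega t) ^ 3)))"
proof -
  obtain C0 where C0: "C0 > 0" "\<And>l \<tau> p \<rho> Y. l \<in> lattice \<Longrightarrow> \<tau> \<in> dirs_at l \<Longrightarrow> p \<in> lattice \<Longrightarrow> \<rho> \<in> dirs_at p
    \<Longrightarrow> 1 \<le> Y \<Longrightarrow> cmod l \<le> Y \<Longrightarrow> cmod p \<le> Y \<Longrightarrow>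
    \<bar>(G (p + \<rho>) (l + \<tau>) - G (p + \<rho>) l) - (G p (l + \<tau>) - G p l)\<bar> \<le> C0 * (2 * Y) powr d / (1 + sepn p l)"
    using green_kernel_step[OF G d(1)] by meson
  obtain C1 where cp1: "C1 > 0" "\<And>m \<alpha>. (\<Sum>j<m. (1 + \<bar>real j - \<alpha>\<bar>) powr (- (1 + d))) \<le> C1"
    using sum_shift_bounded[of "1 + d"] d by auto
  obtain C2 where cp2: "C2 > 0" "\<And>m \<alpha>. (\<Sum>j<m. (1 + \<bar>real j - \<alpha>\<bar>) powr (- 3/2)) \<le> C2"
    using sum_ray_near by blast
  define C where "C = 4 * (7200 * C1 + 26 * C2 + 3200) * (2 * C0)"
  have C: "0 < C" using C0 cp1 cp2 by (simp add: C_def add_pos_pos)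
  have main: "\<exists>c. \<forall>t\<in>lattice. cmod t \<le> real N \<longrightarrow>
      \<bar>(G t (l + \<tau>) - G t l) - c\<bar> \<le> C * (2 * real N + 1) powr (2 * d) / cmod (omega l) * cmod (omega t) \<and>
      (5/4 * cmod l \<le> cmod t \<longrightarrow>
        \<bar>(G t (l + \<tau>) - G t l) - c\<bar> \<le> C * (2 * real N + 1) powr (2 * d) / cmod (omega l) / cmod (omega t) \<and>
        (\<forall>\<rho>\<in>dirs_at t. \<bar>(G (t + \<rho>) (l + \<tau>) - G (t + \<rho>) l) - (G t (l + \<tau>) - G t l)\<bar>
          \<le> C * (2 * real N + 1) powr (2 * d) / cmod (omega l) / cmod (omega t) ^ 3))"
    if l: "l \<in> lattice" and \<tau>: "\<tau> \<in> dirs_at l" and N: "4 * cmod l \<le> real N" for l \<tau> N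
  proof -
    define Y where "Y = 2 * real N + 1"
    have Y: "1 \<le> Y" by (simp add: Y_def)
    define K where "K t = G t (l + \<tau>) - G t l" for t
    define D where "D = C0 * (2 * Y) powr d"
    have D0: "0 < D" using C0 Y by (simp add: D_def)
    interpret kernel_paths K l D d N C1 C2
    proof
      show "\<bar>K (p + \<rho>) - K p\<bar> \<le> D * (1 / (1 + sepn p l))"
        if "p \<in> lattice" "\<rho> \<in> dirs_at p" "cmod p \<le> 2 * real N + 1" for p \<rho>
        using C0(2)[OF l \<tau> that(1,2) Y] that(3) N norm_ge_zero[of l] by (simp add: K_def D_def Y_def)
    qed (use l N D0 d cp1 cp2 in auto)
    have Yd: "1 \<le> Y powr d" using Y d by (intro ge_one_powr_ge_zero) auto
    have "D = C0 * (2 powr d * Y powr d)" using Y by (simp add: D_def powr_mult)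
    also have "\<dots> \<le> C0 * (2 * Y powr d)"
      using C0 powr_mono[of d 1 2] d by (intro mult_left_mono mult_right_mono) auto
    finally have D: "D \<le> 2 * C0 * Y powr d" by simp
    have "4 * \<kappa> = 4 * (7200 * (Y powr d * C1) + 26 * C2 + 3200) * D"
      by (simp add: \<kappa>_def Y_def algebra_simps)
    also have "\<dots> \<le> 4 * (Y powr d * (7200 * C1 + 26 * C2 + 3200)) * (2 * C0 * Y powr d)"
    proof (rule mult_mono)
      have "1 * (26 * C2 + 3200) \<le> Y powr d * (26 * C2 + 3200)"
        using Yd cp2(1) by (intro mult_right_mono) auto
      then show "4 * (7200 * (Y powr d * C1) + 26 * C2 + 3200) \<le> 4 * (Y powr d * (7200 * C1 + 26 * C2 + 3200))"
        by (simp add: algebra_simps)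
      show "0 \<le> 4 * (Y powr d * (7200 * C1 + 26 * C2 + 3200))" using cp1(1) cp2(1) by simp
    qed (use D D0 in simp_all)
    also have "\<dots> = C * (Y powr d * Y powr d)" by (simp add: C_def algebra_simps)
    also have "Y powr d * Y powr d = Y powr (2 * d)" by (simp flip: powr_add)
    finally have \<kappa>: "4 * \<kappa> \<le> C * Y powr (2 * d)" .
    have \<kappa>0: "0 \<le> \<kappa>" "800 * D \<le> \<kappa>" unfolding \<kappa>_def using D0 cp1 cp2 by (auto intro!: add_nonneg_nonneg add_increasing)
    have k1: "\<kappa> / \<Lambda> / P \<le> C * Y powr (2 * d) / \<Lambda> / P" if "0 < P" for P
      using that \<kappa> \<kappa>0 \<Lambda>_pos by (intro divide_right_mono) auto
    show ?thesis
    proof (intro exI[of _ "K far_pt"] ballI impI conjI)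
      fix t assume t: "t \<in> lattice" "cmod t \<le> real N"
      have P: "0 < cmod (omega t)" by (rule norm_omega_pos[OF t(1)])
      have "4 * \<kappa> / \<Lambda> * cmod (omega t) \<le> C * Y powr (2 * d) / \<Lambda> * cmod (omega t)"
        using \<kappa> \<Lambda>_pos by (intro mult_right_mono divide_right_mono) auto
      then show "\<bar>(G t (l + \<tau>) - G t l) - K far_pt\<bar> \<le> C * (2 * real N + 1) powr (2 * d) / cmod (omega l) * cmod (omega t)"
        using kernel_tip[OF t] by (simp only: K_def[of t] \<Lambda>_def[symmetric] Y_def[symmetric])
      assume tl: "5/4 * cmod l \<le> cmod t"
      show "\<bar>(G t (l + \<tau>) - G t l) - K far_pt\<bar> \<le> C * (2 * real N + 1) powr (2 * d) / cmod (omega l) / cmod (omega t)"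
        using kernel_far[OF t tl] k1[OF P] by (simp only: K_def[of t] \<Lambda>_def[symmetric] Y_def[symmetric])
      fix \<rho> assume \<rho>: "\<rho> \<in> dirs_at t"
      have "cmod t + cmod l \<le> 20 * cmod (t - l)"
        using norm_triangle_ineq2[of t l] tl norm_ge_zero[of l] by linarith
      then have "\<bar>K (t + \<rho>) - K t\<bar> \<le> 800 * D / \<Lambda> * (1 / cmod (omega t) ^ 3)"
        using t \<rho> by (intro K_far) auto
      also have "\<dots> = 800 * D / \<Lambda> / cmod (omega t) ^ 3" by simp
      also have "\<dots> \<le> \<kappa> / \<Lambda> / cmod (omega t) ^ 3"
        using \<kappa>0 \<Lambda>_pos by (intro divide_right_mono) auto
      also have "\<dots> \<le> C * Y powr (2 * d) / \<Lambda> / cmod (omega t) ^ 3" using P by (intro k1) simp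
      finally show "\<bar>(G (t + \<rho>) (l + \<tau>) - G (t + \<rho>) l) - (G t (l + \<tau>) - G t l)\<bar>
          \<le> C * (2 * real N + 1) powr (2 * d) / cmod (omega l) / cmod (omega t) ^ 3"
        by (simp only: K_def \<Lambda>_def[symmetric] Y_def[symmetric])
    qed
  qed
  show ?thesis using C main by blast
qed

section \<open>Expansion of the mixed difference\<close>

lemma norm_omega_proj: "cmod (omega (proj Z)) = cmod Z"
proof -
  have "(cmod (omega (proj Z)))\<^sup>2 = (cmod Z)\<^sup>2" by (simp add: norm_proj)
  then show ?thesis by (rule power2_eq_imp_eq) auto
qed

lemma Im_omega_proj: "Z \<in> cov \<Longrightarrow> Im (omega (proj Z)) = Im Z"
proof -
  assume "Z \<in> cov"
  from cov_cases[OF this] have "Im Z = Im (omega (proj Z))"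
  proof
    assume "Z = omega (proj Z)" then show ?thesis by (rule arg_cong)
  next
    assume "Z = sheet (omega (proj Z))"
    then have "Im Z = Im (sheet (omega (proj Z)))" by (rule arg_cong)
    then show ?thesis by (simp add: sheet_def)
  qed
  then show ?thesis by simp
qed

text \<open>\<open>sheet\<close> is an isometry, so the mirror image of the source may be traded for
  the mirror image of the argument: both terms are one function evaluated at the two lifts of
  t.\<close>

lemma Ghat0_lifts:
  assumes "t \<noteq> s"
  shows "Ghat0 t s = Fundsol (omega s - omega t) + Fundsol (omega s - sheet (omega t))"
proof -
  have "omega_star s - omega t = sheet (omega s - sheet (omega t))"
    by (simp add: omega_star_def sheet_def complex_eq_iff)
  then have "cmod (omega_star s - omega t) = cmod (omega s - sheet (omega t))" by simp
  then show ?thesis using assms by (simp add: Ghat0_def Fundsol_def)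
qed

context crack_core
begin

lemma w_inner:
  assumes Z: "(cmod Z)\<^sup>2 \<le> (cmod z)\<^sup>2 / 12"
  shows "w Z = dF z z' Z + slope / 2 * g Z"
proof -
  have "(cmod z / 2)\<^sup>2 = (cmod z)\<^sup>2 / 4" by (simp add: power_divide)
  then have "(cmod Z)\<^sup>2 \<le> (cmod z / 2)\<^sup>2" using Z zero_le_power2[of "cmod z"] by linarith
  then have "cmod Z \<le> cmod z / 2" by (rule power2_le_imp_le) simp
  moreover have "1 / cmod z < cmod z / 2" using big z0 by (simp add: divide_simps power2_eq_square)
  ultimately have "1 / cmod z < cmod (Z - z)"
    using norm_triangle_ineq2[of z Z] by (simp add: norm_minus_commute)
  then have "E Z = dF z z' Z" by (rule E_eq_dF)
  moreover have "cutN ((cmod z)\<^sup>2 / 12) Z = 1" using Z z0 by (intro cutN_eq_1) auto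
  moreover have "cutN (cmod z ^ 6) Z = 1"
  proof (intro cutN_eq_1)
    have "cmod z ^ 2 \<le> cmod z ^ 6" using zeta by (intro power_increasing) auto
    then show "(cmod Z)\<^sup>2 \<le> cmod z ^ 6" using Z zero_le_power2[of "cmod z"] by linarith
  qed (use z0 in simp)
  ultimately show ?thesis by (simp add: w_def)
qed

text \<open>Each lift of t and of t' carries a mass 1/2, and the cut-offs give \<open>w\<close>
  bounded support; summation by parts therefore evaluates \<open>w\<close>, summed over the sheets,
  at the two sites.\<close>

lemma sum_k_lap_w:
  assumes t: "t \<in> lattice" "cmod t \<le> (cmod z)\<^sup>2 / 12" and t': "t' \<in> lattice" "cmod t' \<le> (cmod z)\<^sup>2 / 12"
    and M: "2 * cmod z ^ 6 + 3 \<le> M"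
    and lapk: "\<And>Z. Z \<in> cov \<Longrightarrow> lap k Z = ((if proj Z = t then 1 else 0) - (if proj Z = t' then 1 else 0)) / 2"
  shows "2 * (\<Sum>Z\<in>covball M. k Z * lap w Z) =
    (w (omega t) + w (sheet (omega t))) - (w (omega t') + w (sheet (omega t')))"
proof -
  have M12: "(cmod z)\<^sup>2 / 12 \<le> M" using M z_power_mono zero_le_power2[of "cmod z"] by linarith
  have "(\<Sum>Z\<in>covball M. k Z * lap w Z) = (\<Sum>Z\<in>covball M. w Z * lap k Z)"
  proof (rule sum_by_parts)
    fix Z assume Z: "M - 1 < (cmod Z)\<^sup>2"
    have "cutN (cmod z ^ 6) Z = 0" using Z M z0 by (intro cutN_eq_0) auto
    moreover have "cutN ((cmod z)\<^sup>2 / 12) Z = 0"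
    proof (intro cutN_eq_0)
      show "2 * ((cmod z)\<^sup>2 / 12) \<le> (cmod Z)\<^sup>2"
        using Z M z_power_mono zero_le_power2[of "cmod z"] by linarith
    qed (use z0 in simp)
    ultimately show "w Z = 0" by (simp add: w_def)
  qed
  also have "2 * \<dots> = (\<Sum>Z\<in>covball M. w Z * (if proj Z = t then 1 else 0) - w Z * (if proj Z = t' then 1 else 0))"
    unfolding sum_distrib_left
  proof (rule sum.cong[OF refl])
    fix Z assume "Z \<in> covball M"
    then have "Z \<in> cov" by (simp add: covball_def)
    from lapk[OF this] show "2 * (w Z * lap k Z) =
      w Z * (if proj Z = t then 1 else 0) - w Z * (if proj Z = t' then 1 else 0)"
      by (simp only:) (simp add: algebra_simps)
  qed
  also have "\<dots> = (w (omega t) + w (sheet (omega t))) - (w (omega t') + w (sheet (omega t')))"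
    unfolding sum_subtractf using t t' M12 by (simp only: sum_lifts order_trans[OF _ M12])
  finally show ?thesis .
qed

end

section \<open>The corrector and the expansion for distant sources\<close>

lemma stencil_norm_ge:
  assumes "\<rho> \<in> dirs"
  shows "\<bar>v \<rho>\<bar> \<le> stencil_norm v"
proof -
  have "(v \<rho>)\<^sup>2 \<le> (\<Sum>\<rho>\<in>dirs. (v \<rho>)\<^sup>2)" using assms by (intro member_le_sum) auto
  then show ?thesis unfolding stencil_norm_def by (intro real_le_rsqrt) simp
qed

lemma ddiv_diff: "m \<in> lattice \<Longrightarrow> ddiv (dgrad (\<lambda>x. u x - v x)) m = ddiv (dgrad u) m - ddiv (dgrad v) m"
  by (simp add: ddiv_dgrad dgrad_def sum_subtractf[symmetric] right_diff_distrib[symmetric] if_distrib cong: if_cong)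
     (rule sum.cong, auto)

lemma lap_minus_const: "lap (\<lambda>Z. f Z - c) Z = lap f Z"
  by (simp add: lap_def)

lemma Ghat1s_omega: "Ghat1s s = 1 / (2 * pi) * (Im (omega s) / (cmod (omega s))\<^sup>2)"
  by (simp add: Ghat1s_def)

lemma Im_inverse': "Im (1 / z) = - Im z / (cmod z)\<^sup>2"
  by (simp add: Im_divide cmod_power2)

text \<open>The decay of the corrector with the loss moved into R powr d, so that pure powers of
  |omega(t)| are left, as the commutator estimates require.\<close>

definition corrector_bound :: "(complex \<Rightarrow> real) \<Rightarrow> real \<Rightarrow> real \<Rightarrow> bool" where
  "corrector_bound u A0 d \<longleftrightarrow> (\<forall>t\<in>lattice. \<forall>R. cmod t \<le> R \<longrightarrow>
     \<bar>u t\<bar> \<le> A0 * R powr d / cmod (omega t) \<and>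
     (\<forall>\<rho>\<in>dirs. \<bar>dgrad u t \<rho>\<bar> \<le> A0 * R powr d / cmod (omega t) ^ 3))"

lemma tip_corrector_bound:
  assumes u: "tip_corrector u" and d: "0 < d"
  shows "\<exists>A0>0. corrector_bound u A0 d"
proof -
  obtain C1 where C1: "C1 > 0" "\<And>t. t \<in> lattice \<Longrightarrow> \<bar>u t\<bar> \<le> C1 * cmod t powr (- 1/2 + d)"
    using u d unfolding tip_corrector_def by meson
  obtain C2 where C2: "C2 > 0" "\<And>t. t \<in> lattice \<Longrightarrow> stencil_norm (dgrad u t) \<le> C2 * cmod t powr (- 3/2 + d)"
    using u d unfolding tip_corrector_def by meson
  have "\<bar>u t\<bar> \<le> (C1 + C2) * R powr d / cmod (omega t) \<and>
     (\<forall>\<rho>\<in>dirs. \<bar>dgrad u t \<rho>\<bar> \<le> (C1 + C2) * R powr d / cmod (omega t) ^ 3)"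
    if t: "t \<in> lattice" and R: "cmod t \<le> R" for t R
  proof -
    define T where "T = cmod (omega t)"
    have T: "0 < T" using lattice_nonzero[OF t] by (simp add: T_def omega_eq_csqrt)
    have t2: "cmod t = T powr 2" using T by (simp add: T_def)
    have tR: "cmod t powr d \<le> R powr d" using R d by (intro powr_mono2) auto
    have e1: "cmod t powr (- 1/2 + d) = cmod t powr d / T"
    proof -
      have "cmod t powr (- 1/2 + d) = cmod t powr (- 1/2) * cmod t powr d" by (simp only: powr_add)
      also have "cmod t powr (- 1/2) = T powr (- 1)" unfolding t2 by (simp only: powr_powr) simp
      also have "\<dots> = 1 / T" using T by (simp add: powr_minus_divide)
      finally show ?thesis by simp
    qed
    have e2: "cmod t powr (- 3/2 + d) = cmod t powr d / T ^ 3"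
    proof -
      have "cmod t powr (- 3/2 + d) = cmod t powr (- 3/2) * cmod t powr d" by (simp only: powr_add)
      also have "cmod t powr (- 3/2) = T powr (- 3)" unfolding t2 by (simp only: powr_powr) simp
      also have "\<dots> = 1 / T ^ 3" using T by (simp add: powr_minus_divide)
      finally show ?thesis by simp
    qed
    have "\<bar>u t\<bar> \<le> C1 * (cmod t powr d / T)" using C1(2)[OF t] by (simp only: e1)
    also have "\<dots> \<le> (C1 + C2) * (R powr d / T)"
      using C1(1) C2(1) tR T by (intro mult_mono divide_right_mono) auto
    finally have 1: "\<bar>u t\<bar> \<le> (C1 + C2) * R powr d / T" by simp
    have 2: "\<bar>dgrad u t \<rho>\<bar> \<le> (C1 + C2) * R powr d / T ^ 3" if "\<rho> \<in> dirs" for \<rho>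
    proof -
      have "\<bar>dgrad u t \<rho>\<bar> \<le> C2 * (cmod t powr d / T ^ 3)"
        using order_trans[OF stencil_norm_ge[OF that] C2(2)[OF t]] by (simp only: e2)
      also have "\<dots> \<le> (C1 + C2) * (R powr d / T ^ 3)"
        using C1(1) C2(1) tR T by (intro mult_mono divide_right_mono) auto
      finally show ?thesis by simp
    qed
    show ?thesis using 1 2 by (simp add: T_def)
  qed
  then show ?thesis using C1(1) C2(1) unfolding corrector_bound_def by (intro exI[of _ "C1 + C2"]) auto
qed

text \<open>Transfer of \<open>core_bound\<close> to the lattice: \<open>k z' - k z\<close> is the
  mixed difference of G, and twice the tested sum is minus that of \<open>Ghat0\<close> plus the
  corrector term without cut-off. The bound for the increment of \<open>Ghat1s\<close> is recorded
  for the treatment of \<mu>.\<close>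

lemma green_expansion:
  assumes G: "crack_green G" and u: "tip_corrector u" and d: "0 < d" "d \<le> 1"
    and A0: "0 < A0" "corrector_bound u A0 d"
  shows "\<exists>C>0. \<forall>s\<in>lattice. \<forall>l\<in>lattice. \<forall>\<sigma>\<in>dirs_at s. \<forall>\<tau>\<in>dirs_at l.
    100000 \<le> cmod s \<longrightarrow> cmod l \<le> cmod s / 16 \<longrightarrow>
    \<bar>((G (l + \<tau>) (s + \<sigma>) - G (l + \<tau>) s) - (G l (s + \<sigma>) - G l s))
      - ((Ghat0 (l + \<tau>) (s + \<sigma>) - Ghat0 (l + \<tau>) s) - (Ghat0 l (s + \<sigma>) - Ghat0 l s))
      - (Ghat1s (s + \<sigma>) - Ghat1s s) * (u (l + \<tau>) - u l)\<bar>
    \<le> C * cmod s powr (9 * d) / cmod (omega l) / cmod (omega s) ^ 4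
    \<and> \<bar>Ghat1s (s + \<sigma>) - Ghat1s s\<bar> \<le> 1 / cmod (omega s) ^ 3"
proof -
  obtain S where S: "0 < S" "\<And>F. finite F \<Longrightarrow> F \<subseteq> cov \<Longrightarrow> (\<Sum>Z\<in>F. 1 / cmod Z ^ 5) \<le> S"
    using cov_sum_bounded by blast
  obtain S' where S': "0 < S'" "\<And>F. finite F \<Longrightarrow> F \<subseteq> gint \<Longrightarrow> (\<Sum>x\<in>F. 1 / (1 + cmod x) ^ 3) \<le> S'"
    using gint_sum_bounded by blast
  from green_kernel[OF G d] obtain Ck where Ck: "0 < Ck" and kernel: "\<And>l \<tau> N. l \<in> lattice \<Longrightarrow> \<tau> \<in> dirs_at l
    \<Longrightarrow> 4 * cmod l \<le> real N \<Longrightarrow>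
    (\<exists>c. \<forall>t\<in>lattice. cmod t \<le> real N \<longrightarrow>
      \<bar>(G t (l + \<tau>) - G t l) - c\<bar> \<le> Ck * (2 * real N + 1) powr (2 * d) / cmod (omega l) * cmod (omega t) \<and>
      (5/4 * cmod l \<le> cmod t \<longrightarrow>
        \<bar>(G t (l + \<tau>) - G t l) - c\<bar> \<le> Ck * (2 * real N + 1) powr (2 * d) / cmod (omega l) / cmod (omega t) \<and>
        (\<forall>\<rho>\<in>dirs_at t. \<bar>(G (t + \<rho>) (l + \<tau>) - G (t + \<rho>) l) - (G t (l + \<tau>) - G t l)\<bar>
          \<le> Ck * (2 * real N + 1) powr (2 * d) / cmod (omega l) / cmod (omega t) ^ 3)))"
    by meson
  define C where "C = 10^20 * (1 + A0) * (1 + S + S') * Ck"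
  have C: "0 < C" using A0 S S' Ck by (simp add: C_def)
  have main: "\<bar>((G (l + \<tau>) (s + \<sigma>) - G (l + \<tau>) s) - (G l (s + \<sigma>) - G l s))
      - ((Ghat0 (l + \<tau>) (s + \<sigma>) - Ghat0 (l + \<tau>) s) - (Ghat0 l (s + \<sigma>) - Ghat0 l s))
      - (Ghat1s (s + \<sigma>) - Ghat1s s) * (u (l + \<tau>) - u l)\<bar>
    \<le> C * cmod s powr (9 * d) / cmod (omega l) / cmod (omega s) ^ 4
    \<and> \<bar>Ghat1s (s + \<sigma>) - Ghat1s s\<bar> \<le> 1 / cmod (omega s) ^ 3"
    if s: "s \<in> lattice" and l: "l \<in> lattice" and \<sigma>: "\<sigma> \<in> dirs_at s" and \<tau>: "\<tau> \<in> dirs_at l"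
      and sbig: "100000 \<le> cmod s" and ls: "cmod l \<le> cmod s / 16" for s l \<sigma> \<tau>
  proof -
    define z where "z = omega s"
    have zz: "(cmod z)\<^sup>2 = cmod s" "z\<^sup>2 = s" by (simp_all add: z_def)
    have z6: "cmod z ^ 6 = cmod s ^ 3" using zz by (simp flip: zz(1) power_mult)
    have \<sigma>d: "\<sigma> \<in> dirs" and \<tau>d: "\<tau> \<in> dirs" using \<sigma> \<tau> dirs_at_subset by auto
    have s': "s + \<sigma> \<in> lattice" and l': "l + \<tau> \<in> lattice" using s l \<sigma>d \<tau>d lattice_add_dirs by auto
    have z': "step \<sigma> z = omega (s + \<sigma>)" using step_omega[OF s \<sigma>d] \<sigma> by (simp add: z_def)
    have l'n: "cmod (l + \<tau>) \<le> cmod s / 12"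
      using norm_triangle_ineq[of l \<tau>] norm_dirs[OF \<tau>d] ls sbig by linarith
    have ln: "cmod l \<le> cmod s / 12" using ls sbig by linarith
    \<comment> \<open>\<open>crack_core\<close> uses the kernel up to |Z|^2 = 2|z|^6 + 1, and |Z|^2
      is the modulus of the site below Z.\<close>
    define N where "N = nat \<lceil>2 * cmod z ^ 6 + 1\<rceil>"
    have N: "2 * cmod z ^ 6 + 1 \<le> real N" "real N \<le> 2 * cmod z ^ 6 + 2"
    proof -
      have "0 \<le> cmod z ^ 6" by simp
      then show "2 * cmod z ^ 6 + 1 \<le> real N" "real N \<le> 2 * cmod z ^ 6 + 2"
        unfolding N_def by linarith+
    qed
    have s3: "cmod s \<le> cmod s ^ 3" using sbig power_increasing[of 1 3 "cmod s"] by simp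
    have sN: "cmod s \<le> real N" using N(1) s3 sbig unfolding z6 by linarith
    have lN: "4 * cmod l \<le> real N" using sN ls norm_ge_zero[of s] by linarith
    define \<kappa> where "\<kappa> = Ck * (2 * real N + 1) powr (2 * d)"
    define lam where "lam = cmod (omega l)"
    have lam: "0 < lam" "lam\<^sup>2 = cmod l" using lattice_nonzero[OF l] by (simp_all add: lam_def omega_eq_csqrt)
    have \<kappa>: "0 < \<kappa>" using Ck by (simp add: \<kappa>_def)
    from kernel[OF l \<tau> lN] obtain c where c: "\<And>t. t \<in> lattice \<Longrightarrow> cmod t \<le> real N \<Longrightarrow>
        \<bar>(G t (l + \<tau>) - G t l) - c\<bar> \<le> \<kappa> / lam * cmod (omega t)"
      "\<And>t. t \<in> lattice \<Longrightarrow> cmod t \<le> real N \<Longrightarrow> 5/4 * cmod l \<le> cmod t \<Longrightarrow>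
        \<bar>(G t (l + \<tau>) - G t l) - c\<bar> \<le> \<kappa> / lam / cmod (omega t)"
      "\<And>t \<rho>. t \<in> lattice \<Longrightarrow> \<rho> \<in> dirs_at t \<Longrightarrow> cmod t \<le> real N \<Longrightarrow> 5/4 * cmod l \<le> cmod t \<Longrightarrow>
        \<bar>(G (t + \<rho>) (l + \<tau>) - G (t + \<rho>) l) - (G t (l + \<tau>) - G t l)\<bar> \<le> \<kappa> / lam / cmod (omega t) ^ 3"
      unfolding \<kappa>_def lam_def by blast
    define K where "K t = G t (l + \<tau>) - G t l" for t
    define k where "k Z = K (proj Z) - c" for Z
    define g where "g Z = u (proj Z)" for Z
    define A where "A = A0 * cmod s powr d"
    have A: "0 \<le> A" using A0 by (simp add: A_def)
    \<comment> \<open>The factor 2 of \<open>ddiv_dgrad\<close> halves the unit masses of G, and the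
      constant c disappears.\<close>
    have lapk: "lap k Z = ((if proj Z = l then 1 else 0) - (if proj Z = l + \<tau> then 1 else 0)) / 2"
      if Z: "Z \<in> cov" for Z
    proof -
      have p: "proj Z \<in> lattice" by (rule proj_lattice[OF Z])
      have g1: "ddiv (dgrad (\<lambda>m'. G m' q)) (proj Z) = - (if proj Z = q then 1 else 0)" if "q \<in> lattice" for q
      proof -
        have "- ddiv (dgrad (\<lambda>m'. G m' q)) (proj Z) = (if proj Z = q then 1 else 0)"
          using G p that unfolding crack_green_def by blast
        then show ?thesis by linarith
      qed
      have "lap k Z = lap (\<lambda>Z. K (proj Z)) Z" unfolding k_def[abs_def] by (rule lap_minus_const)
      also have "\<dots> = ddiv (dgrad K) (proj Z) / 2" by (rule lap_proj[OF Z])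
      also have "ddiv (dgrad K) (proj Z) = - (if proj Z = l + \<tau> then 1 else 0) - - (if proj Z = l then 1 else 0)"
        unfolding K_def[abs_def] ddiv_diff[OF p] g1[OF l'] g1[OF l] ..
      finally show ?thesis by simp
    qed
    interpret crack_core k g z "step \<sigma> z" \<sigma> \<kappa> lam A S S'
    proof
      show "z \<in> cov" unfolding z_def by (rule omega_cov[OF s])
      show "100000 \<le> (cmod z)\<^sup>2" "16 * lam\<^sup>2 \<le> (cmod z)\<^sup>2" using sbig ls by (simp_all add: zz lam)
      fix Z assume Z: "Z \<in> cov"
      have p: "proj Z \<in> lattice" by (rule proj_lattice[OF Z])
      show "k (sheet Z) = k Z" by (simp add: k_def proj_sheet[OF Z])
      show "lap k Z = 0" if "(cmod z)\<^sup>2 / 2 \<le> (cmod Z)\<^sup>2"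
      proof -
        have "cmod s / 2 \<le> cmod (proj Z)" using that by (simp add: norm_proj zz)
        then have "proj Z \<noteq> l" "proj Z \<noteq> l + \<tau>" using ln l'n sbig by auto
        then show ?thesis using lapk[OF Z] by simp
      qed
      show "\<bar>k Z\<bar> \<le> \<kappa> / lam * cmod Z" if "(cmod Z)\<^sup>2 \<le> (cmod z)\<^sup>2"
        using c(1)[OF p] that sN by (simp add: norm_proj zz norm_omega_proj k_def K_def)
      show "\<bar>k Z\<bar> \<le> \<kappa> / lam / cmod Z" if "5/4 * lam\<^sup>2 \<le> (cmod Z)\<^sup>2" "(cmod Z)\<^sup>2 \<le> 2 * cmod z ^ 6 + 1"
        using c(2)[OF p] that N(1) by (simp add: norm_proj lam norm_omega_proj k_def K_def)
      show "\<bar>k (step \<rho> Z) - k Z\<bar> \<le> \<kappa> / lam / cmod Z ^ 3"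
        if \<rho>: "\<rho> \<in> dirs" and b: "5/4 * lam\<^sup>2 \<le> (cmod Z)\<^sup>2" "(cmod Z)\<^sup>2 \<le> 2 * cmod z ^ 6 + 1" for \<rho>
      proof (cases "pdir Z \<rho> \<in> dirs_at (proj Z)")
        case True
        then have "k (step \<rho> Z) - k Z = K (proj Z + pdir Z \<rho>) - K (proj Z)"
          using proj_step[OF Z \<rho>] by (simp add: k_def)
        moreover have "\<bar>K (proj Z + pdir Z \<rho>) - K (proj Z)\<bar> \<le> \<kappa> / lam / cmod (omega (proj Z)) ^ 3"
          unfolding K_def using b N(1) by (intro c(3)[OF p True]) (auto simp: norm_proj lam)
        ultimately show ?thesis by (simp add: norm_omega_proj)
      next
        case False
        then have "k (step \<rho> Z) - k Z = 0" using proj_step[OF Z \<rho>] by (simp add: k_def)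
        then show ?thesis using \<kappa> lam(1) by simp
      qed
      show "\<bar>g Z\<bar> \<le> A / cmod Z" if "(cmod Z)\<^sup>2 \<le> (cmod z)\<^sup>2"
      proof -
        have "cmod (proj Z) \<le> cmod s" using that by (simp add: norm_proj zz)
        then show ?thesis using A0(2) p unfolding corrector_bound_def g_def A_def by (metis norm_omega_proj)
      qed
      show "\<bar>g (step \<rho> Z) - g Z\<bar> \<le> A / cmod Z ^ 3" if "\<rho> \<in> dirs" "(cmod Z)\<^sup>2 \<le> (cmod z)\<^sup>2" for \<rho>
      proof -
        have "cmod (proj Z) \<le> cmod s" using that by (simp add: norm_proj zz)
        then have "\<bar>dgrad u (proj Z) (pdir Z \<rho>)\<bar> \<le> A0 * cmod s powr d / cmod (omega (proj Z)) ^ 3"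
          using A0(2) p pdir_dirs[OF that(1)] unfolding corrector_bound_def by blast
        then show ?thesis unfolding g_def A_def proj_step_diff[OF Z that(1)] norm_omega_proj .
      qed
      show "lap g Z = - lap Im Z"
      proof -
        have "lap Im Z = lap (\<lambda>Z. Im (omega (proj Z))) Z"
          using Z step_cov[OF Z] by (intro lap_cong) (simp_all add: Im_omega_proj)
        also have "\<dots> = ddiv (dgrad (\<lambda>x. Im (omega x))) (proj Z) / 2" by (rule lap_proj[OF Z])
        finally have 1: "lap Im Z = ddiv (dgrad (\<lambda>x. Im (omega x))) (proj Z) / 2" .
        have "- ddiv (dgrad u) (proj Z) = ddiv (dgrad (\<lambda>x. Im (omega x))) (proj Z)"
          using u p unfolding tip_corrector_def by blast
        then show ?thesis unfolding 1 g_def[abs_def] lap_proj[OF Z] by simp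
      qed
    qed (use \<sigma>d lam \<kappa> A S S' in auto)
    define M where "M = 2 * cmod z ^ 6 + 3"
    have slope: "slope = Ghat1s (s + \<sigma>) - Ghat1s s"
      unfolding slope_def c1_def unfolding minus_complex.sel(2) Im_inverse' Ghat1s_omega z'
      by (simp only: z_def[symmetric]) (simp add: right_diff_distrib)
    \<comment> \<open>Summed over the two lifts, \<open>dF\<close> becomes the source increment of
      \<open>Ghat0\<close>, and the even corrector is counted twice; hence the factor
      \<open>slope / 2\<close> in \<open>w\<close>.\<close>
    have Ghat: "w (omega t) + w (sheet (omega t)) = (Ghat0 t (s + \<sigma>) - Ghat0 t s) + slope * u t"
      if t: "t \<in> lattice" "cmod t \<le> cmod s / 12" for t
    proof -
      have ne: "t \<noteq> s" "t \<noteq> s + \<sigma>"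
        using t(2) sbig norm_triangle_ineq2[of s "- \<sigma>"] norm_dirs[OF \<sigma>d] by auto
      have "w (omega t) = dF z (step \<sigma> z) (omega t) + slope / 2 * u t"
        using w_inner[of "omega t"] t by (simp add: zz g_def)
      moreover have "w (sheet (omega t)) = dF z (step \<sigma> z) (sheet (omega t)) + slope / 2 * u t"
        using w_inner[of "sheet (omega t)"] t omega_cov[OF t(1)] by (simp add: zz g_def proj_sheet)
      ultimately show ?thesis unfolding Ghat0_lifts[OF ne(1)] Ghat0_lifts[OF ne(2)] z' dF_def
        by (simp add: z_def)
    qed
    have eq: "2 * (\<Sum>Z\<in>covball M. k Z * lap w Z) =
        ((Ghat0 l (s + \<sigma>) - Ghat0 l s) + slope * u l)
        - ((Ghat0 (l + \<tau>) (s + \<sigma>) - Ghat0 (l + \<tau>) s) + slope * u (l + \<tau>))"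
      using sum_k_lap_w[OF l _ l' _ _ lapk, of M] ln l'n by (simp add: zz M_def Ghat l l')
    have kz: "k (step \<sigma> z) - k z = (G (l + \<tau>) (s + \<sigma>) - G (l + \<tau>) s) - (G l (s + \<sigma>) - G l s)"
    proof -
      have sym: "G a b = G b a" if "a \<in> lattice" "b \<in> lattice" for a b
        using G that unfolding crack_green_def by blast
      have "k (step \<sigma> z) - k z = K (s + \<sigma>) - K s"
        unfolding z' by (simp add: k_def z_def s s')
      then show ?thesis
        unfolding K_def sym[OF s' l'] sym[OF s' l] sym[OF s l'] sym[OF s l] by simp
    qed
    have "\<bar>((G (l + \<tau>) (s + \<sigma>) - G (l + \<tau>) s) - (G l (s + \<sigma>) - G l s))
      - ((Ghat0 (l + \<tau>) (s + \<sigma>) - Ghat0 (l + \<tau>) s) - (Ghat0 l (s + \<sigma>) - Ghat0 l s))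
      - slope * (u (l + \<tau>) - u l)\<bar> = \<bar>2 * (\<Sum>Z\<in>covball M. k Z * lap w Z) + (k (step \<sigma> z) - k z)\<bar>"
      unfolding eq kz by (rule arg_cong[of _ _ abs]) (simp add: right_diff_distrib)
    also have "\<dots> \<le> 10^20 * (1 + A) * (1 + S + S') * (\<kappa> / lam / cmod z ^ 4)"
      by (rule core_bound) (simp add: M_def)
    also have "\<dots> \<le> 10^20 * ((1 + A0) * cmod s powr d) * (1 + S + S') * (Ck * cmod s powr (8 * d) / lam / cmod z ^ 4)"
    proof (intro mult_mono divide_right_mono)
      have "1 \<le> cmod s powr d" using sbig d by (intro ge_one_powr_ge_zero) auto
      then show "1 + A \<le> (1 + A0) * cmod s powr d" by (simp add: A_def distrib_right)
      show "\<kappa> \<le> Ck * cmod s powr (8 * d)"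
        unfolding \<kappa>_def
      proof (intro mult_left_mono)
        \<comment> \<open>This gives 2N + 1 <= |s|^4, which turns the exponent 2d into 8d; the ninth
          d comes from the corrector.\<close>
        have "4 * cmod s ^ 3 + 5 \<le> cmod s * cmod s ^ 3"
        proof -
          have "5 * cmod s ^ 3 \<le> cmod s * cmod s ^ 3" using sbig by (intro mult_right_mono) auto
          then show ?thesis using s3 sbig by linarith
        qed
        then have "2 * real N + 1 \<le> cmod s ^ 4" using N(2) unfolding z6 by (simp add: power_numeral_reduce)
        also have "\<dots> = cmod s powr 4" using sbig by simp
        finally have "(2 * real N + 1) powr (2 * d) \<le> (cmod s powr 4) powr (2 * d)"
          using d by (intro powr_mono2) auto
        also have "\<dots> = cmod s powr (8 * d)" by (simp only: powr_powr) simp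
        finally show "(2 * real N + 1) powr (2 * d) \<le> cmod s powr (8 * d)" .
      qed (use Ck in auto)
    qed (use A0 S_pos Ck \<kappa> lam A in auto)
    also have "\<dots> = C * (cmod s powr d * cmod s powr (8 * d)) / lam / cmod z ^ 4"
    proof -
      have "n * (a * p) * b * (k * q / x / w) = n * a * b * k * (p * q) / x / w" for n a p b k q x w :: real
        by simp
      then show ?thesis by (simp only: C_def)
    qed
    also have "cmod s powr d * cmod s powr (8 * d) = cmod s powr (9 * d)" by (simp flip: powr_add)
    finally show ?thesis using slope_bound unfolding slope unfolding lam_def z_def by simp
  qed
  show ?thesis using C main by blast
qed

section \<open>The effect of the cut-off on the corrector term\<close>

lemma mu_omega: "mu \<eta> m s = \<eta> (cmod m * (1 / cmod (omega s)))"
  by (simp add: mu_def omega_eq_csqrt powr_half_sqrt)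

text \<open>If |l| is small compared with |s|^(1/2), all four values of \<mu> equal 1 and nothing
  changes. Otherwise |l| is at least of order |s|^(1/2), and each term of the product rule is as
  small as the remainder, including the uncut term itself.\<close>

lemma cutoff_term:
  assumes \<eta>: "cutoff \<eta>" and d: "0 < d" and A0: "0 < A0" "corrector_bound u A0 d"
  shows "\<exists>C>0. \<forall>s\<in>lattice. \<forall>l\<in>lattice. \<forall>\<sigma>\<in>dirs_at s. \<forall>\<tau>\<in>dirs_at l.
    100000 \<le> cmod s \<longrightarrow> cmod l \<le> cmod s / 16 \<longrightarrow>
    \<bar>Ghat1s (s + \<sigma>) - Ghat1s s\<bar> \<le> 1 / cmod (omega s) ^ 3 \<longrightarrow>
    \<bar>(Ghat1s (s + \<sigma>) - Ghat1s s) * (u (l + \<tau>) - u l)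
      - ((Ghat1mu u \<eta> (l + \<tau>) (s + \<sigma>) - Ghat1mu u \<eta> (l + \<tau>) s) - (Ghat1mu u \<eta> l (s + \<sigma>) - Ghat1mu u \<eta> l s))\<bar>
    \<le> C * cmod s powr d / cmod (omega l) / cmod (omega s) ^ 4"
proof -
  obtain H where H: "0 < H" "\<And>t. 0 < t \<Longrightarrow> \<bar>deriv \<eta> t\<bar> \<le> H"
    "\<And>t. 0 < t \<Longrightarrow> \<bar>t * deriv \<eta> t\<bar> \<le> H" "\<And>t. 0 < t \<Longrightarrow> \<bar>deriv \<eta> t + t * deriv (deriv \<eta>) t\<bar> \<le> H"
    using cutoff_bounds[OF \<eta>] by blast
  define C where "C = (6 + 16 * H) * A0"
  have C: "0 < C" using H A0 by (simp add: C_def)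
  have main: "\<bar>(Ghat1s (s + \<sigma>) - Ghat1s s) * (u (l + \<tau>) - u l)
      - ((Ghat1mu u \<eta> (l + \<tau>) (s + \<sigma>) - Ghat1mu u \<eta> (l + \<tau>) s) - (Ghat1mu u \<eta> l (s + \<sigma>) - Ghat1mu u \<eta> l s))\<bar>
    \<le> C * cmod s powr d / cmod (omega l) / cmod (omega s) ^ 4"
    if s: "s \<in> lattice" and l: "l \<in> lattice" and \<sigma>: "\<sigma> \<in> dirs_at s" and \<tau>: "\<tau> \<in> dirs_at l"
      and big: "100000 \<le> cmod s" and ls: "cmod l \<le> cmod s / 16"
      and slope: "\<bar>Ghat1s (s + \<sigma>) - Ghat1s s\<bar> \<le> 1 / cmod (omega s) ^ 3" for s l \<sigma> \<tau>
  proof -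
    define \<zeta> \<zeta>' where "\<zeta> = cmod (omega s)" and "\<zeta>' = cmod (omega (s + \<sigma>))"
    have \<sigma>d: "\<sigma> \<in> dirs" and \<tau>d: "\<tau> \<in> dirs" using \<sigma> \<tau> dirs_at_subset by auto
    have l': "l + \<tau> \<in> lattice" using l \<tau>d lattice_add_dirs by auto
    have sq: "\<zeta>\<^sup>2 = cmod s" "\<zeta>'\<^sup>2 = cmod (s + \<sigma>)" by (simp_all add: \<zeta>_def \<zeta>'_def)
    have z100: "100 \<le> \<zeta>"
    proof (rule power2_le_imp_le)
      show "100\<^sup>2 \<le> \<zeta>\<^sup>2" using big by (simp add: sq)
    qed (simp add: \<zeta>_def)
    have z'0: "0 \<le> \<zeta>'" by (simp add: \<zeta>'_def)
    have zdiff: "\<bar>\<zeta>' - \<zeta>\<bar> \<le> 1 / \<zeta>"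
    proof -
      have "\<bar>\<zeta>'\<^sup>2 - \<zeta>\<^sup>2\<bar> \<le> 1"
        using norm_triangle_ineq3[of "s + \<sigma>" s] norm_dirs[OF \<sigma>d] by (simp add: sq)
      moreover have "\<bar>\<zeta>'\<^sup>2 - \<zeta>\<^sup>2\<bar> = \<bar>\<zeta>' - \<zeta>\<bar> * (\<zeta>' + \<zeta>)"
      proof -
        have "\<zeta>'\<^sup>2 - \<zeta>\<^sup>2 = (\<zeta>' - \<zeta>) * (\<zeta>' + \<zeta>)" by (simp add: power2_eq_square algebra_simps)
        then show ?thesis using z'0 z100 by (simp add: abs_mult)
      qed
      moreover have "\<bar>\<zeta>' - \<zeta>\<bar> * \<zeta> \<le> \<bar>\<zeta>' - \<zeta>\<bar> * (\<zeta>' + \<zeta>)" using z'0 by (intro mult_left_mono) auto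
      ultimately have "\<bar>\<zeta>' - \<zeta>\<bar> * \<zeta> \<le> 1" by linarith
      then show ?thesis using z100 by (simp add: pos_le_divide_eq)
    qed
    have "1 / \<zeta> \<le> 1" using z100 by simp
    then have z'lo: "\<zeta> - 1 \<le> \<zeta>'" "\<zeta>' \<le> \<zeta> + 1" using zdiff by linarith+
    then have z'pos: "0 < \<zeta>'" "\<zeta> / 2 \<le> \<zeta>'" using z100 by linarith+
    define y y' where "y = 1 / \<zeta>" and "y' = 1 / \<zeta>'"
    define x x' where "x = cmod l" and "x' = cmod (l + \<tau>)"
    have x0: "0 < x" "0 < x'" using lattice_norm[OF l] lattice_norm[OF l'] by (auto simp: x_def x'_def)
    have xx: "\<bar>x' - x\<bar> \<le> 1"
      using norm_triangle_ineq3[of "l + \<tau>" l] norm_dirs[OF \<tau>d] by (simp add: x_def x'_def)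
    define b b' where "b = Ghat1s s" and "b' = Ghat1s (s + \<sigma>)"
    define U U' where "U = u l" and "U' = u (l + \<tau>)"
    define m00 m01 m10 m11 where "m00 = \<eta> (x * y)" and "m01 = \<eta> (x * y')" and "m10 = \<eta> (x' * y)" and "m11 = \<eta> (x' * y')"
    have mu: "mu \<eta> l s = m00" "mu \<eta> l (s + \<sigma>) = m01" "mu \<eta> (l + \<tau>) s = m10" "mu \<eta> (l + \<tau>) (s + \<sigma>) = m11"
      by (simp_all add: mu_omega m00_def m01_def m10_def m11_def x_def x'_def y_def y'_def \<zeta>_def \<zeta>'_def)
    \<comment> \<open>A discrete product rule: the four terms contain no difference of \<mu>, one in
      l, one in s, and the mixed one.\<close>
    have expr: "(Ghat1s (s + \<sigma>) - Ghat1s s) * (u (l + \<tau>) - u l)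
      - ((Ghat1mu u \<eta> (l + \<tau>) (s + \<sigma>) - Ghat1mu u \<eta> (l + \<tau>) s) - (Ghat1mu u \<eta> l (s + \<sigma>) - Ghat1mu u \<eta> l s))
      = (b' - b) * (U' - U) - ((b' - b) * (m11 * (U' - U)) + (b' - b) * ((m11 - m01) * U)
          + b * ((m11 - m10) * (U' - U)) + b * (((m11 - m10) - (m01 - m00)) * U))"
      unfolding Ghat1mu_def mu by (simp add: b_def b'_def U_def U'_def algebra_simps)
    define L where "L = cmod (omega l)"
    have L: "0 < L" "L\<^sup>2 = x" using lattice_nonzero[OF l] by (simp_all add: L_def x_def omega_eq_csqrt)
    define A where "A = A0 * cmod s powr d"
    have A: "0 \<le> A" using A0 by (simp add: A_def)
    have final: "\<bar>(b' - b) * (U' - U) - ((b' - b) * (m11 * (U' - U)) + (b' - b) * ((m11 - m01) * U)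
          + b * ((m11 - m10) * (U' - U)) + b * (((m11 - m10) - (m01 - m00)) * U))\<bar>
        \<le> (6 + 16 * H) * (A / L / \<zeta> ^ 4)"
    \<comment> \<open>The threshold 1/3 lies below the value 1/2 up to which \<eta> = 1; the gap
      accommodates the unit step in l and the change of |omega(s)| in a step of s.\<close>
    proof (cases "x < \<zeta> / 3")
      case True
      have one: "\<eta> (p * (1 / q)) = 1" if "0 \<le> p" "p \<le> \<zeta> / 3 + 1" "\<zeta> - 1 \<le> q" for p q
      proof -
        have "p * (1 / q) \<le> 1/2" using that z100 by (simp add: divide_simps)
        moreover have "0 \<le> p * (1 / q)" using that z100 by simp
        ultimately show ?thesis using \<eta> by (simp add: cutoff_def)
      qed
      have "m00 = 1" "m01 = 1" "m10 = 1" "m11 = 1"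
        unfolding m00_def m01_def m10_def m11_def y_def y'_def
        using x0 xx True z'lo by (intro one; linarith)+
      then show ?thesis using H A L z100 by simp
    next
      case False
      \<comment> \<open>A gradient of the corrector gains |omega(l)|^-2, of order at most 1/\<zeta>,
        which supplies the fourth power missing from the bound \<zeta>^-3 of the slope.\<close>
      have Linv: "1 / L\<^sup>2 \<le> 3 / \<zeta>" using False z100 x0 by (simp add: L(2) divide_simps)
      have "cmod l \<le> cmod s" using ls norm_ge_zero[of s] by linarith
      then have cb: "\<bar>u l\<bar> \<le> A / L" "\<forall>\<rho>\<in>dirs. \<bar>dgrad u l \<rho>\<bar> \<le> A / L ^ 3"
        using A0(2) l unfolding corrector_bound_def A_def L_def by blast+
      have U: "\<bar>U\<bar> \<le> A / L" using cb(1) by (simp add: U_def)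
      have "\<bar>U' - U\<bar> \<le> A / L ^ 3" using bspec[OF cb(2) \<tau>d] \<tau> by (simp add: dgrad_def U_def U'_def)
      also have "\<dots> = A / L * (1 / L\<^sup>2)" by (simp add: power2_eq_square power3_eq_cube)
      also have "\<dots> \<le> A / L * (3 / \<zeta>)" using Linv A L by (intro mult_left_mono) auto
      finally have DU: "\<bar>U' - U\<bar> \<le> 3 / \<zeta> * (A / L)" by (simp add: mult.commute)
      have yy: "\<bar>y' - y\<bar> \<le> 2 / \<zeta> ^ 3"
      proof -
        have "y' - y = (\<zeta> - \<zeta>') / (\<zeta> * \<zeta>')" using z'pos z100 by (simp add: y_def y'_def field_simps)
        then have "\<bar>y' - y\<bar> = \<bar>\<zeta>' - \<zeta>\<bar> / (\<zeta> * \<zeta>')" using z'pos z100 by (simp add: abs_mult abs_minus_commute)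
        also have "\<dots> \<le> (1 / \<zeta>) / (\<zeta> * (\<zeta> / 2))"
          using zdiff z'pos z100 by (intro frac_le mult_left_mono mult_pos_pos) auto
        also have "\<dots> = 2 / \<zeta> ^ 3" by (simp add: power3_eq_cube)
        finally show ?thesis .
      qed
      have ym: "1 / (2 * \<zeta>) \<le> y" "1 / (2 * \<zeta>) \<le> y'"
        unfolding y_def y'_def using z100 z'lo z'pos by (intro divide_left_mono mult_pos_pos; linarith)+
      have y'2: "y' \<le> 2 / \<zeta>"
      proof -
        have "1 / \<zeta>' \<le> 1 / (\<zeta> / 2)" using z'pos z100 by (intro divide_left_mono mult_pos_pos) auto
        then show ?thesis by (simp add: y'_def)
      qed
      have m0: "0 < 1 / (2 * \<zeta>)" using z100 by simp
      note cd = cutoff_differences[OF \<eta> H(2-4) x0 m0 ym]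
      have "H * y' * \<bar>x' - x\<bar> \<le> H * (2 / \<zeta>) * 1" using H y'2 xx z'pos z100 by (intro mult_mono) (auto simp: y'_def)
      then have d1: "\<bar>m11 - m01\<bar> \<le> 2 * H / \<zeta>" using cd(1) by (simp add: m11_def m01_def mult.commute[of H 2])
      have d2: "\<bar>m11 - m10\<bar> \<le> 4 * H / \<zeta>\<^sup>2"
      proof -
        have "\<bar>m11 - m10\<bar> \<le> H / (1 / (2 * \<zeta>)) * \<bar>y' - y\<bar>"
          unfolding m11_def m10_def
          by (rule cutoff_differences(2)[OF \<eta> H(2-4) x0(2) x0(2) m0 ym])
        also have "\<dots> \<le> H / (1 / (2 * \<zeta>)) * (2 / \<zeta> ^ 3)" using yy H z100 by (intro mult_left_mono) auto
        also have "\<dots> = 4 * H / \<zeta>\<^sup>2" using z100 by (simp add: power2_eq_square power3_eq_cube)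
        finally show ?thesis .
      qed
      have "H * \<bar>y' - y\<bar> * \<bar>x' - x\<bar> \<le> H * (2 / \<zeta> ^ 3) * 1" using H yy xx z100 by (intro mult_mono) auto
      then have d3: "\<bar>(m11 - m10) - (m01 - m00)\<bar> \<le> 2 * H / \<zeta> ^ 3"
        using cd(3) by (simp add: m11_def m01_def m10_def m00_def mult.commute[of H 2])
      have m1: "\<bar>m11\<bar> \<le> 1" using cutoff_range[OF \<eta>, of "x' * y'"] x0 z'pos by (simp add: m11_def y'_def)
      have bb: "\<bar>b' - b\<bar> \<le> 1 / \<zeta> ^ 3" using slope by (simp add: b_def b'_def \<zeta>_def)
      have b1: "\<bar>b\<bar> \<le> 1 / \<zeta>"
      proof -
        have "\<bar>b\<bar> = \<bar>1 / (2 * pi)\<bar> * (\<bar>Im (omega s)\<bar> / \<zeta>\<^sup>2)" by (simp add: b_def Ghat1s_omega \<zeta>_def abs_mult)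
        also have "\<dots> \<le> 1 * (\<zeta> / \<zeta>\<^sup>2)"
          using pi_gt3 abs_Im_le_cmod[of "omega s"] z100
          by (intro mult_mono divide_right_mono) (auto simp: \<zeta>_def divide_simps)
        also have "\<dots> = 1 / \<zeta>" by (simp add: power2_eq_square)
        finally show ?thesis .
      qed
      define Q where "Q = A / L / \<zeta> ^ 4"
      have Q: "0 \<le> Q" using A L z100 by (simp add: Q_def)
      have t0: "\<bar>(b' - b) * (U' - U)\<bar> \<le> 3 * Q"
      proof -
        have "\<bar>(b' - b) * (U' - U)\<bar> \<le> 1 / \<zeta> ^ 3 * (3 / \<zeta> * (A / L))"
          unfolding abs_mult using bb DU z100 by (intro mult_mono) auto
        then show ?thesis by (simp add: Q_def power_numeral_reduce mult_ac)
      qed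
      have t1: "\<bar>(b' - b) * (m11 * (U' - U))\<bar> \<le> 3 * Q"
      proof -
        have "\<bar>(b' - b) * (m11 * (U' - U))\<bar> = \<bar>m11\<bar> * \<bar>(b' - b) * (U' - U)\<bar>" by (simp add: abs_mult)
        also have "\<dots> \<le> 1 * (3 * Q)" using m1 t0 by (intro mult_mono) auto
        finally show ?thesis by simp
      qed
      have t2: "\<bar>(b' - b) * ((m11 - m01) * U)\<bar> \<le> 2 * H * Q"
      proof -
        have "\<bar>(b' - b) * ((m11 - m01) * U)\<bar> \<le> 1 / \<zeta> ^ 3 * (2 * H / \<zeta> * (A / L))"
          unfolding abs_mult using bb d1 U H z100 by (intro mult_mono) auto
        then show ?thesis by (simp add: Q_def power_numeral_reduce mult_ac)
      qed
      have t3: "\<bar>b * ((m11 - m10) * (U' - U))\<bar> \<le> 12 * H * Q"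
      proof -
        have "\<bar>b * ((m11 - m10) * (U' - U))\<bar> \<le> 1 / \<zeta> * (4 * H / \<zeta>\<^sup>2 * (3 / \<zeta> * (A / L)))"
          unfolding abs_mult using b1 d2 DU H z100 by (intro mult_mono) auto
        then show ?thesis by (simp add: Q_def power_numeral_reduce mult_ac)
      qed
      have t4: "\<bar>b * (((m11 - m10) - (m01 - m00)) * U)\<bar> \<le> 2 * H * Q"
      proof -
        have "\<bar>b * (((m11 - m10) - (m01 - m00)) * U)\<bar> \<le> 1 / \<zeta> * (2 * H / \<zeta> ^ 3 * (A / L))"
          unfolding abs_mult using b1 d3 U H z100 by (intro mult_mono) auto
        then show ?thesis by (simp add: Q_def power_numeral_reduce mult_ac)
      qed
      have "\<bar>p - (q1 + q2 + q3 + q4)\<bar> \<le> \<bar>p\<bar> + \<bar>q1\<bar> + \<bar>q2\<bar> + \<bar>q3\<bar> + \<bar>q4\<bar>" for p q1 q2 q3 q4 :: real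
        by linarith
      note order_trans[OF this add_mono[OF add_mono[OF add_mono[OF add_mono[OF t0 t1] t2] t3] t4]]
      also have "3 * Q + 3 * Q + 2 * H * Q + 12 * H * Q + 2 * H * Q = (6 + 16 * H) * (A / L / \<zeta> ^ 4)"
        unfolding Q_def by algebra
      finally show ?thesis .
    qed
    have "(6 + 16 * H) * (A / L / \<zeta> ^ 4) = C * cmod s powr d / L / \<zeta> ^ 4"
      by (simp add: C_def A_def)
    then show ?thesis using final unfolding expr L_def \<zeta>_def by (simp only:)
  qed
  show ?thesis using C main by blast
qed

section \<open>Assembly of the estimate\<close>

theorem theorem2p9:
  fixes G :: "complex \<Rightarrow> complex \<Rightarrow> real"
    and G1m :: "complex \<Rightarrow> real"
    and \<eta> :: "real \<Rightarrow> real"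
  assumes "crack_green G"
    and "tip_corrector G1m"
    and "cutoff \<eta>"
  shows "\<forall>\<delta>>0. \<exists>c>0. \<forall>l\<in>lattice. \<forall>s\<in>lattice. cmod l \<le> cmod s / 16 \<longrightarrow>
           mixed_norm (mixed_grad (Gbar1mu G G1m \<eta>) l s)
             \<le> c * cmod s powr (- 2 + \<delta>) * cmod l powr (- 1/2)"
proof (intro allI impI)
  fix \<delta> :: real assume \<delta>: "0 < \<delta>"
  \<comment> \<open>The total loss |s| powr (9 d) has to stay below |s| powr \<delta>.\<close>
  define d where "d = min \<delta> 1 / 9"
  have d: "0 < d" "d \<le> 1" "9 * d \<le> \<delta>" using \<delta> by (auto simp: d_def)
  obtain A0 where A0: "0 < A0" "corrector_bound G1m A0 d"
    using tip_corrector_bound[OF assms(2) d(1)] by blast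
  define X where "X l s \<tau> \<sigma> = ((G (l + \<tau>) (s + \<sigma>) - G (l + \<tau>) s) - (G l (s + \<sigma>) - G l s))
      - ((Ghat0 (l + \<tau>) (s + \<sigma>) - Ghat0 (l + \<tau>) s) - (Ghat0 l (s + \<sigma>) - Ghat0 l s))" for l s \<tau> \<sigma>
  define Y where "Y l s \<tau> \<sigma> = (Ghat1s (s + \<sigma>) - Ghat1s s) * (G1m (l + \<tau>) - G1m l)" for l s \<tau> \<sigma>
  define W where "W l s \<tau> \<sigma> = (Ghat1mu G1m \<eta> (l + \<tau>) (s + \<sigma>) - Ghat1mu G1m \<eta> (l + \<tau>) s)
      - (Ghat1mu G1m \<eta> l (s + \<sigma>) - Ghat1mu G1m \<eta> l s)" for l s \<tau> \<sigma>
  from green_expansion[OF assms(1,2) d(1,2) A0] obtain C1 where C1: "0 < C1"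
    "\<And>s l \<sigma> \<tau>. s \<in> lattice \<Longrightarrow> l \<in> lattice \<Longrightarrow> \<sigma> \<in> dirs_at s \<Longrightarrow> \<tau> \<in> dirs_at l \<Longrightarrow>
      100000 \<le> cmod s \<Longrightarrow> cmod l \<le> cmod s / 16 \<Longrightarrow>
      \<bar>X l s \<tau> \<sigma> - Y l s \<tau> \<sigma>\<bar> \<le> C1 * cmod s powr (9 * d) / cmod (omega l) / cmod (omega s) ^ 4
      \<and> \<bar>Ghat1s (s + \<sigma>) - Ghat1s s\<bar> \<le> 1 / cmod (omega s) ^ 3"
    unfolding X_def Y_def by blast
  from cutoff_term[OF assms(3) d(1) A0] obtain C2 where C2: "0 < C2"
    "\<And>s l \<sigma> \<tau>. s \<in> lattice \<Longrightarrow> l \<in> lattice \<Longrightarrow> \<sigma> \<in> dirs_at s \<Longrightarrow> \<tau> \<in> dirs_at l \<Longrightarrow>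
      100000 \<le> cmod s \<Longrightarrow> cmod l \<le> cmod s / 16 \<Longrightarrow>
      \<bar>Ghat1s (s + \<sigma>) - Ghat1s s\<bar> \<le> 1 / cmod (omega s) ^ 3 \<Longrightarrow>
      \<bar>Y l s \<tau> \<sigma> - W l s \<tau> \<sigma>\<bar> \<le> C2 * cmod s powr d / cmod (omega l) / cmod (omega s) ^ 4"
    unfolding Y_def W_def by blast
  define r where "r l s = cmod s powr (- 2 + \<delta>) * cmod l powr (- 1/2)" for l s :: complex
  define m where "m l s = mixed_norm (mixed_grad (Gbar1mu G G1m \<eta>) l s)" for l s
  have r: "0 < r l s" if "l \<in> lattice" "s \<in> lattice" for l s
    using lattice_nonzero[OF that(1)] lattice_nonzero[OF that(2)] by (simp add: r_def)
  have m0: "0 \<le> m l s" for l s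
    unfolding m_def mixed_norm_def by (intro real_sqrt_ge_zero sum_nonneg) auto
  have large: "m l s \<le> 4 * (C1 + C2) * r l s"
    if l: "l \<in> lattice" and s: "s \<in> lattice" and ls: "cmod l \<le> cmod s / 16" and big: "100000 \<le> cmod s" for l s
  proof -
    have entry: "\<bar>mixed_grad (Gbar1mu G G1m \<eta>) l s \<tau> \<sigma>\<bar> \<le> (C1 + C2) * r l s" for \<tau> \<sigma>
    proof (cases "\<tau> \<in> dirs_at l \<and> \<sigma> \<in> dirs_at s")
      case True
      have "mixed_grad (Gbar1mu G G1m \<eta>) l s \<tau> \<sigma> = X l s \<tau> \<sigma> - W l s \<tau> \<sigma>"
        using True by (simp add: mixed_grad_def dgrad_def Gbar1mu_def X_def W_def algebra_simps)
      moreover have "\<bar>X l s \<tau> \<sigma> - Y l s \<tau> \<sigma>\<bar> \<le> C1 * (cmod s powr (9 * d) / cmod (omega l) / cmod (omega s) ^ 4)"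
        using C1(2)[OF s l _ _ big ls] True by simp
      moreover have "\<bar>Y l s \<tau> \<sigma> - W l s \<tau> \<sigma>\<bar> \<le> C2 * (cmod s powr d / cmod (omega l) / cmod (omega s) ^ 4)"
        using C2(2)[OF s l _ _ big ls] C1(2)[OF s l _ _ big ls] True by simp
      moreover have pw: "cmod s powr e / cmod (omega l) / cmod (omega s) ^ 4 \<le> r l s" if "e \<le> \<delta>" for e
      proof -
        have "cmod s powr e \<le> cmod s powr \<delta>" using that big by (intro powr_mono) auto
        then have "cmod s powr e / cmod (omega l) / cmod (omega s) ^ 4 \<le> cmod s powr \<delta> / cmod (omega l) / cmod (omega s) ^ 4"
          by (intro divide_right_mono) auto
        also have w4: "cmod (omega s) ^ 4 = cmod s ^ 2"
          using power_mult[of "cmod (omega s)" 2 2] by simp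
        also have "cmod s powr \<delta> / cmod (omega l) / cmod s ^ 2 = r l s"
        proof -
          have "cmod s powr (- 2 + \<delta>) = cmod s powr (- 2) * cmod s powr \<delta>" by (simp only: powr_add)
          also have "cmod s powr (- 2) = 1 / cmod s ^ 2" using big by (simp add: powr_minus_divide)
          finally have 1: "cmod s powr (- 2 + \<delta>) = 1 / cmod s ^ 2 * cmod s powr \<delta>" .
          have "cmod l powr (- 1/2) = 1 / cmod l powr (1/2)" by (simp add: powr_minus_divide)
          also have "cmod l powr (1/2) = cmod (omega l)" by (simp add: powr_half_sqrt omega_eq_csqrt)
          finally have 2: "cmod l powr (- 1/2) = 1 / cmod (omega l)" .
          show ?thesis unfolding r_def 1 2 by simp
        qed
        finally show ?thesis unfolding w4 .
      qed
      have "C1 * (cmod s powr (9 * d) / cmod (omega l) / cmod (omega s) ^ 4) \<le> C1 * r l s"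
        using pw[of "9 * d"] d C1(1) by (intro mult_left_mono) auto
      moreover have "C2 * (cmod s powr d / cmod (omega l) / cmod (omega s) ^ 4) \<le> C2 * r l s"
        using pw[of d] d C2(1) by (intro mult_left_mono) auto
      ultimately have "\<bar>mixed_grad (Gbar1mu G G1m \<eta>) l s \<tau> \<sigma>\<bar> \<le> C1 * r l s + C2 * r l s" by linarith
      then show ?thesis by (simp add: distrib_right)
    next
      case False
      then have "mixed_grad (Gbar1mu G G1m \<eta>) l s \<tau> \<sigma> = 0" by (auto simp: mixed_grad_def dgrad_def)
      then show ?thesis using C1(1) C2(1) r[OF l s] by simp
    qed
    have "m l s \<le> 4 * ((C1 + C2) * r l s)"
      unfolding m_def using C1(1) C2(1) r[OF l s] by (intro mixed_norm_le entry) auto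
    then show ?thesis by (simp only: mult.assoc)
  qed
  \<comment> \<open>For |s| < 100000 only finitely many pairs (l, s) occur, and the sum of their
    ratios to the right-hand side serves as a constant.\<close>
  define F where "F = {t \<in> lattice. cmod t \<le> 100000}"
  have F: "finite F" unfolding F_def by (rule finite_lattice_ball)
  define c0 where "c0 = (\<Sum>(l, s)\<in>F \<times> F. m l s / r l s)"
  have pos: "0 \<le> m l s / r l s" if "l \<in> F" "s \<in> F" for l s
    using m0[of l s] r[of l s] that by (simp add: F_def)
  have c0: "0 \<le> c0" unfolding c0_def by (intro sum_nonneg) (use pos in auto)
  have small: "m l s \<le> c0 * r l s"
    if l: "l \<in> lattice" and s: "s \<in> lattice" and ls: "cmod l \<le> cmod s / 16" and small: "cmod s < 100000" for l s
  proof -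
    have "cmod l \<le> 100000" using ls small norm_ge_zero[of s] by linarith
    then have mem: "(l, s) \<in> F \<times> F" using l s small by (simp add: F_def)
    have "(\<lambda>(l, s). m l s / r l s) (l, s) \<le> c0"
      unfolding c0_def by (rule member_le_sum[OF mem]) (use F pos in auto)
    then show ?thesis using r[OF l s] by (simp add: pos_divide_le_eq)
  qed
  show "\<exists>c>0. \<forall>l\<in>lattice. \<forall>s\<in>lattice. cmod l \<le> cmod s / 16 \<longrightarrow>
    mixed_norm (mixed_grad (Gbar1mu G G1m \<eta>) l s) \<le> c * cmod s powr (- 2 + \<delta>) * cmod l powr (- 1/2)"
  proof (intro exI[of _ "4 * (C1 + C2) + c0"] conjI ballI impI)
    show "0 < 4 * (C1 + C2) + c0" using C1(1) C2(1) c0 by simp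
    fix l s assume ls: "l \<in> lattice" "s \<in> lattice" "cmod l \<le> cmod s / 16"
    have "m l s \<le> (4 * (C1 + C2) + c0) * r l s"
    proof (cases "100000 \<le> cmod s")
      case True
      have "m l s \<le> 4 * (C1 + C2) * r l s" by (rule large[OF ls True])
      also have "\<dots> \<le> (4 * (C1 + C2) + c0) * r l s"
        using c0 r[OF ls(1,2)] by (intro mult_right_mono) auto
      finally show ?thesis .
    next
      case False
      then have "m l s \<le> c0 * r l s" using ls by (intro small) auto
      also have "\<dots> \<le> (4 * (C1 + C2) + c0) * r l s"
        using C1(1) C2(1) r[OF ls(1,2)] by (intro mult_right_mono) auto
      finally show ?thesis .
    qed
    then show "mixed_norm (mixed_grad (Gbar1mu G G1m \<eta>) l s)
      \<le> (4 * (C1 + C2) + c0) * cmod s powr (- 2 + \<delta>) * cmod l powr (- 1/2)"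
      by (simp add: m_def r_def mult.assoc)
  qed
qed

end
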